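(* Let $\Sigma$ be a vertical $c_+$-grim reaper of $\mathbb{H}^2\times\mathbb{R}$ parametrized by $\Psi(s,t)=(x(s),y(s),t)$, $s\in I\subset\mathbb{R}$, $t\in\mathbb{R}$, such that its generating curve $\alpha(s)=(x(s),y(s))$ satisfies $x'(s)=y(s)\cos\theta(s)$, $y'(s)=y(s)\sin\theta(s)$ for some smooth function $\theta=\theta(s)$. Then $\Sigma$ is one of the following examples: (1) The vertical plane of equation $y=2$. (2) The vertical planes of equation $x=x_0$, $x_0\in\mathbb{R}$. (3) A one-parameter family of entire graphs $\mathcal{G}^+(y_0)$ on the $xz$-plane that are periodic along the $x$-direction. The value $y_0$ indicates the Euclidean distance of $\mathcal{G}^+(y_0)$ to the plane $y=0$. As $y_0\to0$, $\mathcal{G}^+(y_0)$ converges to a double covering of a vertical plane of equation $x=x_0$; if $y_0\to2$, then $\mathcal{G}^+(y_0)$ converges to the vertical plane of equation $y=2$.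
   Context: $\mathbb{H}^2\times\mathbb{R}$ is $\{(x,y,z)\in\mathbb{R}^3: y>0\}$ with metric $\frac{dx^2+dy^2}{y^2}+dz^2$. For an orientable immersed surface $\Sigma$ with unit normal $N$, $H$ denotes the mean curvature with respect to $N$, i.e. half the trace of the second fundamental form $\langle N,\overline\nabla_{\cdot}\,\cdot\rangle$, where $\overline\nabla$ is the Levi-Civita connection. A $c_+$-grim reaper is a surface satisfying $H=\langle N,\partial_y\rangle$, where $\partial_y$ is a conformal vector field; it is vertical if it is invariant by the one-parameter group of vertical translations $(x,y,z)\mapsto(x,y,z+t)$, $t\in\mathbb{R}$. *)

theory Defs
  imports "HOL-Analysis.Analysis"
begin

text \<open>
  The space \<open>\<bbbH>\<^sup>2 \<times> \<real>\<close> is the half-space \<open>y > 0\<close> of \<open>\<real>\<^sup>3\<close> with \<open>(x, y, z) = (p $ 1, p $ 2, p $ 3)\<close>.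
  All tensors are written in these coordinates; a tangent vector at a point is its
  coordinate vector with respect to \<open>\<partial>\<^sub>x, \<partial>\<^sub>y, \<partial>\<^sub>z\<close>.
\<close>

definition H2xR :: "(real^3) set" where
  "H2xR = {p. p $ 2 > 0}"

definition amb_metric :: "real^3 \<Rightarrow> real^3^3" where
  "amb_metric p = (\<chi> i j. if i = j then (if i = 3 then 1 else 1 / (p $ 2)\<^sup>2) else 0)"

definition riem :: "real^3 \<Rightarrow> real^3 \<Rightarrow> real^3 \<Rightarrow> real" where
  "riem p v w = v \<bullet> (amb_metric p *v w)"

definition partial :: "'n \<Rightarrow> (real^'n::finite \<Rightarrow> 'b::real_normed_vector) \<Rightarrow> real^'n \<Rightarrow> 'b" where
  "partial i F p = vector_derivative (\<lambda>h. F (p + h *\<^sub>R axis i 1)) (at 0)"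

abbreviation partials :: "'n list \<Rightarrow> (real^'n::finite \<Rightarrow> 'b::real_normed_vector) \<Rightarrow> real^'n \<Rightarrow> 'b" where
  "partials is F \<equiv> foldr partial is F"

text \<open>On an open set, being \<open>C\<^sup>\<infinity>\<close> is the same as having differentiable iterated partial
  derivatives of every order.\<close>

definition smooth_on :: "(real^'n::finite) set \<Rightarrow> (real^'n \<Rightarrow> 'b::real_normed_vector) \<Rightarrow> bool" where
  "smooth_on U F \<longleftrightarrow> open U \<and> (\<forall>is. \<forall>u\<in>U. partials is F differentiable (at u))"

definition smooth_fun_on :: "real set \<Rightarrow> (real \<Rightarrow> real) \<Rightarrow> bool" where
  "smooth_fun_on I f \<longleftrightarrow> open I \<and> (\<forall>k. \<forall>s\<in>I. (deriv ^^ k) f differentiable (at s))"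

text \<open>The Levi-Civita connection, through its Christoffel symbols \<open>\<Gamma>\<^sup>k\<^sub>i\<^sub>j\<close>.\<close>

definition christoffel :: "real^3 \<Rightarrow> 3 \<Rightarrow> 3 \<Rightarrow> 3 \<Rightarrow> real" where
  "christoffel p k i j =
     (1/2) * (\<Sum>l\<in>UNIV. matrix_inv (amb_metric p) $ k $ l *
        (partial i (\<lambda>q. amb_metric q $ j $ l) p + partial j (\<lambda>q. amb_metric q $ i $ l) p
          - partial l (\<lambda>q. amb_metric q $ i $ j) p))"

text \<open>The covariant derivative \<open>\<nabla>\<^bsub>\<partial>\<^sub>i\<Psi>\<^esub> \<partial>\<^sub>j\<Psi>\<close> in the ambient space.\<close>

definition cov_deriv :: "(real^2 \<Rightarrow> real^3) \<Rightarrow> 2 \<Rightarrow> 2 \<Rightarrow> real^2 \<Rightarrow> real^3" where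
  "cov_deriv \<Psi> i j u = partial i (partial j \<Psi>) u +
     (\<chi> k. \<Sum>a\<in>UNIV. \<Sum>b\<in>UNIV.
        christoffel (\<Psi> u) k a b * partial i \<Psi> u $ a * partial j \<Psi> u $ b)"

definition fund_form1 :: "(real^2 \<Rightarrow> real^3) \<Rightarrow> real^2 \<Rightarrow> real^2^2" where
  "fund_form1 \<Psi> u = (\<chi> i j. riem (\<Psi> u) (partial i \<Psi> u) (partial j \<Psi> u))"

definition fund_form2 :: "(real^2 \<Rightarrow> real^3) \<Rightarrow> (real^2 \<Rightarrow> real^3) \<Rightarrow> real^2 \<Rightarrow> real^2^2" where
  "fund_form2 \<Psi> N u = (\<chi> i j. riem (\<Psi> u) (N u) (cov_deriv \<Psi> i j u))"

text \<open>The trace of the second fundamental form is taken with respect to the induced metric.\<close>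

definition mean_curvature :: "(real^2 \<Rightarrow> real^3) \<Rightarrow> (real^2 \<Rightarrow> real^3) \<Rightarrow> real^2 \<Rightarrow> real" where
  "mean_curvature \<Psi> N u = (1/2) * trace (matrix_inv (fund_form1 \<Psi> u) ** fund_form2 \<Psi> N u)"

definition immersed_surface :: "(real^2) set \<Rightarrow> (real^2 \<Rightarrow> real^3) \<Rightarrow> bool" where
  "immersed_surface U \<Psi> \<longleftrightarrow>
     smooth_on U \<Psi> \<and> \<Psi> ` U \<subseteq> H2xR \<and> (\<forall>u\<in>U. inj (frechet_derivative \<Psi> (at u)))"

definition unit_normal :: "(real^2) set \<Rightarrow> (real^2 \<Rightarrow> real^3) \<Rightarrow> (real^2 \<Rightarrow> real^3) \<Rightarrow> bool" where
  "unit_normal U \<Psi> N \<longleftrightarrow> continuous_on U N \<and>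
     (\<forall>u\<in>U. riem (\<Psi> u) (N u) (N u) = 1 \<and> (\<forall>i. riem (\<Psi> u) (N u) (partial i \<Psi> u) = 0))"

text \<open>The equation is unchanged when \<open>N\<close> is replaced by \<open>-N\<close>, so that the choice of the unit
  normal is immaterial.\<close>

definition cplus_grim_reaper :: "(real^2) set \<Rightarrow> (real^2 \<Rightarrow> real^3) \<Rightarrow> bool" where
  "cplus_grim_reaper U \<Psi> \<longleftrightarrow> immersed_surface U \<Psi> \<and>
     (\<exists>N. unit_normal U \<Psi> N \<and>
          (\<forall>u\<in>U. mean_curvature \<Psi> N u = riem (\<Psi> u) (N u) (axis 2 1)))"

definition vertical_cplus_grim_reaper :: "(real^2) set \<Rightarrow> (real^2 \<Rightarrow> real^3) \<Rightarrow> bool" where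
  "vertical_cplus_grim_reaper U \<Psi> \<longleftrightarrow> cplus_grim_reaper U \<Psi> \<and>
     (\<forall>t. (\<lambda>p. p + t *\<^sub>R axis 3 1) ` (\<Psi> ` U) = \<Psi> ` U)"

definition strip :: "real set \<Rightarrow> (real^2) set" where
  "strip I = {u. u $ 1 \<in> I}"

definition cylinder :: "(real \<Rightarrow> real) \<Rightarrow> (real \<Rightarrow> real) \<Rightarrow> real^2 \<Rightarrow> real^3" where
  "cylinder x y u = vector [x (u $ 1), y (u $ 1), u $ 2]"

definition generating_curve ::
  "real set \<Rightarrow> (real \<Rightarrow> real) \<Rightarrow> (real \<Rightarrow> real) \<Rightarrow> (real \<Rightarrow> real) \<Rightarrow> bool" where
  "generating_curve I x y \<theta> \<longleftrightarrow> smooth_fun_on I \<theta> \<and>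
     (\<forall>s\<in>I. (x has_real_derivative y s * cos (\<theta> s)) (at s) \<and>
             (y has_real_derivative y s * sin (\<theta> s)) (at s))"

definition graph_xz :: "(real^2 \<Rightarrow> real) \<Rightarrow> real^2 \<Rightarrow> real^3" where
  "graph_xz f u = vector [u $ 1, f u, u $ 2]"

definition translate_x :: "real \<Rightarrow> (real^3) set \<Rightarrow> (real^3) set" where
  "translate_x a S = (\<lambda>p. p + a *\<^sub>R axis 1 1) ` S"

text \<open>
  Smooth convergence on compact sets, with multiplicity \<open>m\<close>, of a family of surfaces \<open>S \<tau>\<close> to
  the plane \<open>P = {p. p $ j = c}\<close> of the half-space: over every relatively compact open part \<open>D\<close>
  of the plane and inside every tube around \<open>D\<close> of Euclidean radius \<open>r\<close>, the surface
  \<open>S \<tau>\<close> eventually consists of exactly \<open>m\<close> pairwise disjoint smooth graphs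
  \<open>p + w i \<tau> p *\<^sub>R axis j 1\<close>, and all derivatives (including those of order \<open>0\<close>) of the functions
  \<open>w i \<tau>\<close> tend to \<open>0\<close> uniformly on \<open>D\<close>. The case \<open>m = 2\<close> is the convergence to a double
  covering. The functions \<open>w i \<tau>\<close> are relevant on \<open>P\<close> only, which is why only the partial
  derivatives in directions other than \<open>j\<close> occur.
\<close>

definition converges_to_plane ::
  "nat \<Rightarrow> (real \<Rightarrow> (real^3) set) \<Rightarrow> 3 \<Rightarrow> real \<Rightarrow> real filter \<Rightarrow> bool" where
  "converges_to_plane m S j c F \<longleftrightarrow>
     (\<forall>D r. openin (top_of_set {p. p $ j = c}) D \<longrightarrow> bounded D \<longrightarrow> closure D \<subseteq> H2xR \<longrightarrow> r > 0 \<longrightarrow>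
        (\<exists>w :: nat \<Rightarrow> real \<Rightarrow> real^3 \<Rightarrow> real.
           (\<forall>\<^sub>F \<tau> in F.
              S \<tau> \<inter> {p + h *\<^sub>R axis j 1 | p h. p \<in> D \<and> \<bar>h\<bar> < r}
                = (\<Union>i<m. (\<lambda>p. p + w i \<tau> p *\<^sub>R axis j 1) ` D) \<and>
              (\<forall>p\<in>D. inj_on (\<lambda>i. w i \<tau> p) {..<m}) \<and>
              (\<forall>i<m. \<forall>is. set is \<subseteq> - {j} \<longrightarrow>
                 (\<forall>p\<in>D. partials is (w i \<tau>) differentiable (at p within {p. p $ j = c})))) \<and>
           (\<forall>i<m. \<forall>is. set is \<subseteq> - {j} \<longrightarrow>
              uniform_limit D (\<lambda>\<tau>. partials is (w i \<tau>)) (\<lambda>_. 0) F)))"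

end

theory Submission
  imports Defs
begin

text \<open>
  Parametrize the generating curve by hyperbolic arc length, with Euclidean angle \<open>\<theta>\<close>. The surface is a
  cylinder whose rulings are ambient geodesics, so \<open>H\<close> is half the hyperbolic curvature
  \<open>\<theta>' + cos \<theta>\<close> of the curve, and the grim reaper equation becomes
  \<open>x' = y cos \<theta>\<close>, \<open>y' = y sin \<theta>\<close>, \<open>\<theta>' = cos \<theta> (2 / y - 1)\<close>.
  This is \<open>reaper_imp_reaper_curve\<close>, with converse \<open>reaper_curve_imp_reaper\<close>.

  The quotient \<open>cos \<theta> / mu y\<close> with \<open>mu y = y * exp (2 / y)\<close> is a first integral, and \<open>mu\<close> has a strict minimum at
  \<open>2\<close>. If \<open>cos \<theta>\<close> vanishes at one point it vanishes identically and the curve is a vertical line.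
  If \<open>\<bar>cos \<theta>\<bar> / mu y\<close> has the largest possible value \<open>1 / mu 2\<close>, the height is constantly \<open>2\<close>. Every other level is
  \<open>1 / mu y0\<close> for exactly one \<open>y0\<close> between \<open>0\<close> and \<open>2\<close>. The solution that starts horizontally at height \<open>y0\<close> exists
  for all times; since its height and its angle are bounded, it must become horizontal
  again at a maximum beyond \<open>2\<close>. Uniqueness makes it symmetric about both points, hence periodic, and
  \<open>cos \<theta>\<close> is bounded away from \<open>0\<close>, so it is an entire graph. By uniqueness once more, every solution on the same level
  is a piece of this one up to translation and orientation (\<open>reaper_curve_classification\<close>).

  In graph form \<open>y = f x\<close> the first integral is \<open>1 + f'\<^sup>2 = (mu y0 / mu f)\<^sup>2\<close>. If \<open>y0\<close> tends to \<open>2\<close>, it forces \<open>f\<close> to \<open>2\<close>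
  and \<open>f'\<close> to \<open>0\<close>. If \<open>y0\<close> tends to \<open>0\<close>, it makes the graph arbitrarily steep between any two fixed heights while
  the period tends to infinity, so that near the plane \<open>x = 0\<close> exactly two symmetric sheets remain.
  In both cases the differential equation expresses the derivatives of the small quantities as multiples of these
  quantities with bounded coefficients, so that smallness propagates to derivatives of all orders
  (\<open>jet_graph\<close> and \<open>jet_sheet\<close>).
\<close>

section \<open>Vertical cylinders in the half-space\<close>

lemma vector_3_axis:
  "(vector [a, b, c] :: real^3) = a *\<^sub>R axis 1 1 + b *\<^sub>R axis 2 1 + c *\<^sub>R axis 3 1"
  by (simp add: vec_eq_iff forall_3 axis_def)

lemma partial_cong_open:
  assumes "open U" "u \<in> U" "\<And>v. v \<in> U \<Longrightarrow> F v = G v"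
  shows "partial i F u = partial i G u"
proof -
  have "isCont (\<lambda>h. u + h *\<^sub>R axis i 1) 0" by (intro continuous_intros)
  hence "\<forall>\<^sub>F h in nhds 0. u + h *\<^sub>R axis i 1 \<in> U"
    using assms(1,2) by (simp add: isCont_def continuous_at_open[symmetric] eventually_nhds)
       (metis (no_types, lifting) add.right_neutral assms(1) continuous_at_open isCont_def scaleR_zero_left)
  hence "\<forall>\<^sub>F h in nhds 0. F (u + h *\<^sub>R axis i 1) = G (u + h *\<^sub>R axis i 1)"
    by eventually_elim (use assms(3) in auto)
  thus ?thesis unfolding partial_def
    by (intro vector_derivative_cong_eq) auto
qed

text \<open>
  Every iterated partial derivative of a vertical cylinder has the shape
  \<open>(a (u $ 1), b (u $ 1), k * u $ 2 + d)\<close>, so this shape is the one to differentiate.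
\<close>

lemma partial_cylinder_field:
  assumes "(a has_real_derivative a') (at (u $ 1))" "(b has_real_derivative b') (at (u $ 1))"
  shows "partial 1 (\<lambda>u::real^2. vector [a (u $ 1), b (u $ 1), k * u $ 2 + d] :: real^3) u
           = vector [a', b', 0]"
    and "partial 2 (\<lambda>u::real^2. vector [a (u $ 1), b (u $ 1), k * u $ 2 + d] :: real^3) u
           = vector [0, 0, k]"
proof -
  have [simp]: "axis 2 1 $ (1::2) = (0::real)" "axis 1 1 $ (2::2) = (0::real)"
    by (auto simp: axis_def)
  have 1: "((\<lambda>h. g (u $ 1 + h)) has_vector_derivative g') (at 0)"
    if "(g has_real_derivative g') (at (u $ 1))" for g g'
    using that DERIV_at_within_shift[of g g' "u $ 1" 0 UNIV]
    by (simp add: has_real_derivative_iff_has_vector_derivative add.commute)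
  show "partial 1 (\<lambda>u::real^2. vector [a (u $ 1), b (u $ 1), k * u $ 2 + d] :: real^3) u
           = vector [a', b', 0]"
    unfolding partial_def vector_3_axis
    by (rule vector_derivative_at)
       (auto intro!: derivative_eq_intros 1[OF assms(1), unfolded has_real_derivative_iff_has_vector_derivative[symmetric]]
          1[OF assms(2), unfolded has_real_derivative_iff_has_vector_derivative[symmetric]] simp: axis_def)
  show "partial 2 (\<lambda>u::real^2. vector [a (u $ 1), b (u $ 1), k * u $ 2 + d] :: real^3) u
           = vector [0, 0, k]"
    unfolding partial_def vector_3_axis
    by (rule vector_derivative_at) (auto intro!: derivative_eq_intros simp: axis_def)
qed

lemma matrix_inv_eqI:
  fixes A B :: "real^'n^'n"
  assumes "A ** B = mat 1" "B ** A = mat 1"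
  shows "matrix_inv A = B"
proof -
  have "invertible A" using assms by (auto simp: invertible_def)
  hence "matrix_inv A ** A = mat 1" unfolding invertible_def matrix_inv_def by (rule someI2_ex) auto
  thus ?thesis using assms by (metis matrix_mul_assoc matrix_mul_lid matrix_mul_rid)
qed

lemma matrix_inv_diagonal:
  fixes d :: "'n::finite \<Rightarrow> real"
  assumes "\<And>i. d i \<noteq> 0"
  shows "matrix_inv (\<chi> i j. if i = j then d i else 0) = (\<chi> i j. if i = j then 1 / d i else 0)"
  by (rule matrix_inv_eqI)
     (use assms in \<open>auto simp: matrix_matrix_mult_def vec_eq_iff mat_def if_distrib[where f="\<lambda>x. x * _"]
         if_distrib[where f="\<lambda>x. _ * x"] sum.delta cong: if_cong\<close>)

lemma riem_eq: "riem p v w = (v $ 1 * w $ 1 + v $ 2 * w $ 2) / (p $ 2)\<^sup>2 + v $ 3 * w $ 3"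
  by (simp add: riem_def amb_metric_def matrix_vector_mult_def inner_vec_def sum_3 add_divide_distrib)

lemma matrix_inv_amb_metric:
  assumes "p $ 2 > 0"
  shows "matrix_inv (amb_metric p) = (\<chi> i j. if i = j then (if i = 3 then 1 else (p $ 2)\<^sup>2) else 0)"
proof -
  have "matrix_inv (amb_metric p)
        = (\<chi> i j. if i = j then 1 / (if i = 3 then 1 else 1 / (p $ 2)\<^sup>2) else 0)"
    unfolding amb_metric_def by (rule matrix_inv_diagonal) (use assms in auto)
  thus ?thesis by (simp add: vec_eq_iff)
qed

lemma partial_amb_metric:
  assumes "p $ 2 > 0"
  shows "partial i (\<lambda>q. amb_metric q $ j $ l) p
          = (if i = 2 \<and> j = l \<and> j \<noteq> 3 then - 2 / (p $ 2)^3 else 0)"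
proof -
  have [simp]: "(p + h *\<^sub>R axis i 1) $ 2 = p $ 2 + (if i = 2 then h else 0)" for h
    by (auto simp: axis_def)
  have "((\<lambda>h. 1 / (p $ 2 + h)\<^sup>2) has_real_derivative - 2 / (p $ 2)^3) (at 0)"
    by (rule derivative_eq_intros refl | use assms in \<open>force simp: field_simps power_eq_if\<close>)+
  hence "((\<lambda>h. 1 / (p $ 2 + h)\<^sup>2) has_vector_derivative - 2 / (p $ 2)^3) (at 0)"
    by (simp add: has_real_derivative_iff_has_vector_derivative)
  thus ?thesis unfolding partial_def amb_metric_def
    by (cases "i = 2"; cases "j = l"; cases "l = 3") (auto intro!: vector_derivative_at simp: axis_def)
qed

text \<open>
  The only nonzero Christoffel symbols are those of the hyperbolic plane; the factor \<open>\<real>\<close> is flat.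
\<close>

lemma christoffel_eq:
  assumes "p $ 2 > 0"
  shows "christoffel p k i j =
    (if k = 1 \<and> (i = 1 \<and> j = 2 \<or> i = 2 \<and> j = 1) then - 1 / p $ 2
     else if k = 2 \<and> i = 1 \<and> j = 1 then 1 / p $ 2
     else if k = 2 \<and> i = 2 \<and> j = 2 then - 1 / p $ 2 else 0)"
  using assms exhaust_3[of k] exhaust_3[of i] exhaust_3[of j]
  unfolding christoffel_def partial_amb_metric[OF assms] matrix_inv_amb_metric[OF assms] sum_3
  by (elim disjE) (simp_all add: field_simps power_eq_if)

lemma cylinder_eq_field: "cylinder x y = (\<lambda>u. vector [x (u $ 1), y (u $ 1), 1 * u $ 2 + 0])"
  by (simp add: cylinder_def fun_eq_iff)

lemma open_strip: "open I \<Longrightarrow> open (strip I)"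
  unfolding strip_def using open_vimage[of I "\<lambda>u::real^2. u $ 1"]
  by (simp add: vimage_def continuous_on_component)

context
  fixes I :: "real set" and x y x' y' x'' y'' :: "real \<Rightarrow> real"
  assumes I: "open I"
    and x: "\<And>s. s \<in> I \<Longrightarrow> (x has_real_derivative x' s) (at s)"
    and y: "\<And>s. s \<in> I \<Longrightarrow> (y has_real_derivative y' s) (at s)"
    and x': "\<And>s. s \<in> I \<Longrightarrow> (x' has_real_derivative x'' s) (at s)"
    and y': "\<And>s. s \<in> I \<Longrightarrow> (y' has_real_derivative y'' s) (at s)"
begin

lemma partial_cylinder:
  assumes "u \<in> strip I"
  shows "partial 1 (cylinder x y) u = vector [x' (u $ 1), y' (u $ 1), 0]"
    and "partial 2 (cylinder x y) u = vector [0, 0, 1]"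
  using partial_cylinder_field[of x "x' (u $ 1)" u y "y' (u $ 1)" 1 0] x y assms
  by (auto simp: strip_def cylinder_eq_field)

lemma partial_partial_cylinder:
  assumes "u \<in> strip I"
  shows "partial 1 (partial 1 (cylinder x y)) u = vector [x'' (u $ 1), y'' (u $ 1), 0]"
    and "partial 2 (partial 2 (cylinder x y)) u = 0"
proof -
  have "partial 1 (partial 1 (cylinder x y)) u
      = partial 1 (\<lambda>u. vector [x' (u $ 1), y' (u $ 1), 0 * u $ 2 + 0]) u"
    by (rule partial_cong_open[OF open_strip[OF I] assms]) (simp add: partial_cylinder)
  also have "\<dots> = vector [x'' (u $ 1), y'' (u $ 1), 0]"
    by (rule partial_cylinder_field) (use x' y' assms in \<open>auto simp: strip_def\<close>)
  finally show "partial 1 (partial 1 (cylinder x y)) u = vector [x'' (u $ 1), y'' (u $ 1), 0]" .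
  have "partial 2 (partial 2 (cylinder x y)) u
      = partial 2 (\<lambda>u::real^2. vector [0, 0, 0 * u $ 2 + 1]) u"
    by (rule partial_cong_open[OF open_strip[OF I] assms]) (simp add: partial_cylinder)
  also have "\<dots> = vector [0, 0, 0]"
    by (rule partial_cylinder_field(2)[where a="\<lambda>_. 0" and b="\<lambda>_. 0" and a'=0 and b'=0]) auto
  finally show "partial 2 (partial 2 (cylinder x y)) u = 0" 
    by (simp add: vec_eq_iff forall_3)
qed

text \<open>
  The rulings are geodesics of the ambient space, so only the covariant acceleration of the
  generating curve contributes to the second fundamental form.
\<close>

lemma cov_deriv_cylinder:
  assumes "u \<in> strip I" "y (u $ 1) > 0"
  shows "cov_deriv (cylinder x y) 1 1 u =
           vector [x'' (u $ 1) - 2 * x' (u $ 1) * y' (u $ 1) / y (u $ 1),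
                   y'' (u $ 1) + ((x' (u $ 1))\<^sup>2 - (y' (u $ 1))\<^sup>2) / y (u $ 1), 0]"
    and "cov_deriv (cylinder x y) 2 2 u = 0"
proof -
  have p: "cylinder x y u $ 2 > 0" using assms by (simp add: cylinder_def)
  show "cov_deriv (cylinder x y) 1 1 u =
           vector [x'' (u $ 1) - 2 * x' (u $ 1) * y' (u $ 1) / y (u $ 1),
                   y'' (u $ 1) + ((x' (u $ 1))\<^sup>2 - (y' (u $ 1))\<^sup>2) / y (u $ 1), 0]"
    unfolding cov_deriv_def partial_cylinder[OF assms(1)] partial_partial_cylinder[OF assms(1)]
    by (simp add: vec_eq_iff forall_3 sum_3 christoffel_eq[OF p])
       (use assms(2) in \<open>simp add: cylinder_def field_simps power2_eq_square\<close>)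
  show "cov_deriv (cylinder x y) 2 2 u = 0"
    unfolding cov_deriv_def partial_cylinder[OF assms(1)] partial_partial_cylinder[OF assms(1)]
    by (simp add: vec_eq_iff forall_3 sum_3 christoffel_eq[OF p])
qed

lemma mean_curvature_cylinder:
  assumes "u \<in> strip I" "y (u $ 1) > 0" "x' (u $ 1) \<noteq> 0 \<or> y' (u $ 1) \<noteq> 0"
  shows "mean_curvature (cylinder x y) N u =
     (N u $ 1 * cov_deriv (cylinder x y) 1 1 u $ 1 + N u $ 2 * cov_deriv (cylinder x y) 1 1 u $ 2)
       / (2 * ((x' (u $ 1))\<^sup>2 + (y' (u $ 1))\<^sup>2))"
proof -
  define D where "D = ((x' (u $ 1))\<^sup>2 + (y' (u $ 1))\<^sup>2) / (y (u $ 1))\<^sup>2"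
  have D: "D \<noteq> 0" using assms by (auto simp: D_def)
  have "fund_form1 (cylinder x y) u = (\<chi> i j. if i = j then (if i = 1 then D else 1) else 0)"
    unfolding fund_form1_def
    by (simp add: vec_eq_iff forall_2 partial_cylinder[OF assms(1)] riem_eq D_def cylinder_def power2_eq_square)
  hence inv: "matrix_inv (fund_form1 (cylinder x y) u)
      = (\<chi> i j. if i = j then 1 / (if i = 1 then D else 1) else 0)"
    using matrix_inv_diagonal[of "\<lambda>i::2. if i = 1 then D else 1"] D by auto
  have "mean_curvature (cylinder x y) N u
      = (1/2) * (1 / D) * riem (cylinder x y u) (N u) (cov_deriv (cylinder x y) 1 1 u)"
    unfolding mean_curvature_def inv fund_form2_def
    by (simp add: trace_def matrix_matrix_mult_def sum_2 cov_deriv_cylinder(2)[OF assms(1,2)] riem_eq)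
  also have "\<dots> = (N u $ 1 * cov_deriv (cylinder x y) 1 1 u $ 1
        + N u $ 2 * cov_deriv (cylinder x y) 1 1 u $ 2)
       / (2 * ((x' (u $ 1))\<^sup>2 + (y' (u $ 1))\<^sup>2))"
    using assms(2,3) by (simp add: riem_eq D_def cylinder_def cov_deriv_cylinder(1)[OF assms(1,2)])
  finally show ?thesis .
qed

text \<open>
  The conditions on \<open>N u\<close> force it to be a nonzero multiple \<open>l\<close> of \<open>(-y', x', 0)\<close>. The equation
  \<open>H = \<langle>N, \<partial>\<^sub>y\<rangle>\<close> is homogeneous of degree one in \<open>N\<close>, so \<open>l\<close> cancels, and a scalar equation for the
  curve remains that does not mention the unit normal.
\<close>

lemma reaper_equation_cylinder:
  assumes u: "u \<in> strip I" and pos: "y (u $ 1) > 0" and reg: "x' (u $ 1) \<noteq> 0 \<or> y' (u $ 1) \<noteq> 0"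
    and N1: "riem (cylinder x y u) (N u) (N u) = 1"
    and N0: "\<And>i. riem (cylinder x y u) (N u) (partial i (cylinder x y) u) = 0"
  shows "mean_curvature (cylinder x y) N u = riem (cylinder x y u) (N u) (axis 2 1) \<longleftrightarrow>
     (y (u $ 1))\<^sup>2 * (x' (u $ 1) * y'' (u $ 1) - y' (u $ 1) * x'' (u $ 1))
       = x' (u $ 1) * ((x' (u $ 1))\<^sup>2 + (y' (u $ 1))\<^sup>2) * (2 - y (u $ 1))"
proof -
  define Y X1 Y1 X2 Y2 where "Y = y (u $ 1)" and "X1 = x' (u $ 1)" and "Y1 = y' (u $ 1)"
    and "X2 = x'' (u $ 1)" and "Y2 = y'' (u $ 1)"
  define R where "R = X1\<^sup>2 + Y1\<^sup>2"
  have Y: "Y > 0" using pos by (simp add: Y_def)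
  have R: "R > 0" using reg by (auto simp: R_def X1_def Y1_def sum_power2_gt_zero_iff)
  have "N u $ 3 = 0" using N0[of 2] by (simp add: riem_eq partial_cylinder[OF u])
  moreover have perp: "N u $ 1 * X1 + N u $ 2 * Y1 = 0"
    using N0[of 1] Y by (simp add: riem_eq partial_cylinder[OF u] X1_def Y1_def cylinder_def Y_def)
  ultimately have nz: "(N u $ 1)\<^sup>2 + (N u $ 2)\<^sup>2 = Y\<^sup>2"
    using N1 Y by (simp add: riem_eq cylinder_def Y_def field_simps power2_eq_square)
  \<comment> \<open>\<open>l\<close> is the coefficient of \<open>N u\<close> along \<open>(-y', x', 0)\<close>\<close>
  define l where "l = (N u $ 2 * X1 - N u $ 1 * Y1) / R"
  have a: "N u $ 1 * R = - (N u $ 2 * X1 - N u $ 1 * Y1) * Y1" 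
    using perp unfolding R_def by algebra
  have b: "N u $ 2 * R = (N u $ 2 * X1 - N u $ 1 * Y1) * X1" 
    using perp unfolding R_def by algebra
  have N1l: "N u $ 1 = - l * Y1" and N2l: "N u $ 2 = l * X1"
    using a b R by (simp_all add: l_def field_simps)
  have l: "l \<noteq> 0" using nz N1l N2l Y by auto
  have "mean_curvature (cylinder x y) N u = riem (cylinder x y u) (N u) (axis 2 1) \<longleftrightarrow>
      l * (X1 * (Y2 + (X1\<^sup>2 - Y1\<^sup>2) / Y) - Y1 * (X2 - 2 * X1 * Y1 / Y)) / (2 * R) = l * X1 / Y\<^sup>2"
    unfolding mean_curvature_cylinder[OF u pos reg, of N] cov_deriv_cylinder(1)[OF u pos]
    by (simp add: riem_eq N1l N2l cylinder_def axis_def R_def X1_def Y1_def X2_def Y2_def Y_def algebra_simps)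
  also have "\<dots> \<longleftrightarrow> (X1 * (Y2 + (X1\<^sup>2 - Y1\<^sup>2) / Y) - Y1 * (X2 - 2 * X1 * Y1 / Y)) / (2 * R) = X1 / Y\<^sup>2"
    using l by (metis (no_types, opaque_lifting) mult_left_cancel times_divide_eq_right)
  also have "X1 * (Y2 + (X1\<^sup>2 - Y1\<^sup>2) / Y) - Y1 * (X2 - 2 * X1 * Y1 / Y)
      = X1 * Y2 - Y1 * X2 + X1 * R / Y"
    unfolding R_def using Y by (simp add: field_simps power2_eq_square)
  also have "(X1 * Y2 - Y1 * X2 + X1 * R / Y) / (2 * R) = X1 / Y\<^sup>2 \<longleftrightarrow>
      Y\<^sup>2 * (X1 * Y2 - Y1 * X2) = X1 * R * (2 - Y)"
  proof -
    have "(X1 * Y2 - Y1 * X2 + X1 * R / Y) / (2 * R) = X1 / Y\<^sup>2 \<longleftrightarrow>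
       (X1 * Y2 - Y1 * X2 + X1 * R / Y) * Y\<^sup>2 = X1 * (2 * R)"
      by (rule frac_eq_eq) (use R Y in auto)
    also have "(X1 * Y2 - Y1 * X2 + X1 * R / Y) * Y\<^sup>2 = Y\<^sup>2 * (X1 * Y2 - Y1 * X2) + X1 * R * Y"
      using Y by (simp add: field_simps power2_eq_square)
    finally show ?thesis by (auto simp: algebra_simps)
  qed
  finally show ?thesis by (simp add: X1_def Y1_def X2_def Y2_def Y_def R_def)
qed

end


section \<open>Derivatives of one-parameter families of functions\<close>

text \<open>
  For a family \<open>f\<close> of functions indexed by \<open>\<tau>\<close>, all derivatives up to order \<open>n\<close> exist on \<open>J\<close> for
  \<open>\<tau>\<close> close to its limit along \<open>F\<close>, and each of them, as a family, has the property \<open>P\<close>. The choices of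
  \<open>P\<close> that matter are: no condition (smoothness), uniform boundedness, and uniform convergence
  to \<open>0\<close>. The derivatives are existentially quantified one order at a time, so that a differential
  equation can be used directly to pass from order \<open>n\<close> to order \<open>n + 1\<close>.
\<close>

primrec jet :: "(('t \<Rightarrow> real \<Rightarrow> real) \<Rightarrow> bool) \<Rightarrow> 't filter \<Rightarrow> real set \<Rightarrow> nat \<Rightarrow> ('t \<Rightarrow> real \<Rightarrow> real) \<Rightarrow> bool"
  where
  "jet P F J 0 f \<longleftrightarrow> P f"
| "jet P F J (Suc n) f \<longleftrightarrow> P f \<and>
     (\<exists>f'. (\<forall>\<^sub>F \<tau> in F. \<forall>y\<in>J. (f \<tau> has_real_derivative f' \<tau> y) (at y)) \<and> jet P F J n f')"

lemma jet_0: "jet P F J n f \<Longrightarrow> P f"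
  by (cases n) auto

lemma jet_SucI:
  assumes "\<forall>\<^sub>F \<tau> in F. \<forall>y\<in>J. (f \<tau> has_real_derivative f' \<tau> y) (at y)" "jet P F J n f'" "P f"
  shows "jet P F J (Suc n) f"
  using assms by auto

lemma jet_SucD: "jet P F J (Suc n) f \<Longrightarrow> jet P F J n f"
proof (induction n arbitrary: f)
  case (Suc n)
  then obtain f' where f': "\<forall>\<^sub>F \<tau> in F. \<forall>y\<in>J. (f \<tau> has_real_derivative f' \<tau> y) (at y)"
    "jet P F J (Suc n) f'" "P f"
    by (subst (asm) (2) jet.simps) blast
  show ?case by (rule jet_SucI[OF f'(1) Suc.IH[OF f'(2)] f'(3)])
qed simp

lemma jet_mono:
  assumes PQ: "\<And>f. P f \<Longrightarrow> Q f"
  shows "jet P F J n f \<Longrightarrow> jet Q F J n f"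
proof (induction n arbitrary: f)
  case (Suc n)
  obtain f' where f': "\<forall>\<^sub>F \<tau> in F. \<forall>y\<in>J. (f \<tau> has_real_derivative f' \<tau> y) (at y)"
    "jet P F J n f'" "P f"
    using Suc.prems unfolding jet.simps by blast
  show ?case by (rule jet_SucI[OF f'(1) Suc.IH[OF f'(2)] PQ[OF f'(3)]])
qed (simp add: PQ)

lemma jet_zero:
  assumes "P (\<lambda>_ _. 0)"
  shows "jet P F J n (\<lambda>_ _. 0)"
proof (induction n)
  case (Suc n)
  show ?case by (rule jet_SucI[where f'="\<lambda>_ _. 0"]) (auto simp: assms Suc)
qed (simp add: assms)

lemma jet_const:
  assumes "\<And>c. P (\<lambda>_ _. c)"
  shows "jet P F J n (\<lambda>_ _. c)"
proof (cases n)
  case (Suc k)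
  show ?thesis unfolding Suc
    by (rule jet_SucI[where f'="\<lambda>_ _. 0"]) (auto simp: assms jet_zero)
qed (simp add: assms)

lemma jet_add:
  assumes add: "\<And>f g. P f \<Longrightarrow> P g \<Longrightarrow> P (\<lambda>\<tau> y. f \<tau> y + g \<tau> y)"
  shows "jet P F J n f \<Longrightarrow> jet P F J n g \<Longrightarrow> jet P F J n (\<lambda>\<tau> y. f \<tau> y + g \<tau> y)"
proof (induction n arbitrary: f g)
  case (Suc n)
  obtain f' where f': "\<forall>\<^sub>F \<tau> in F. \<forall>y\<in>J. (f \<tau> has_real_derivative f' \<tau> y) (at y)" "jet P F J n f'"
    using Suc.prems unfolding jet.simps by blast
  obtain g' where g': "\<forall>\<^sub>F \<tau> in F. \<forall>y\<in>J. (g \<tau> has_real_derivative g' \<tau> y) (at y)" "jet P F J n g'"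
    using Suc.prems unfolding jet.simps by blast
  show ?case
  proof (rule jet_SucI)
    show "\<forall>\<^sub>F \<tau> in F. \<forall>y\<in>J. ((\<lambda>y. f \<tau> y + g \<tau> y) has_real_derivative f' \<tau> y + g' \<tau> y) (at y)"
      using f'(1) g'(1) by eventually_elim (auto intro!: derivative_eq_intros)
    show "jet P F J n (\<lambda>\<tau> y. f' \<tau> y + g' \<tau> y)" by (rule Suc.IH[OF f'(2) g'(2)])
    show "P (\<lambda>\<tau> y. f \<tau> y + g \<tau> y)" by (intro add jet_0[OF Suc.prems(1)] jet_0[OF Suc.prems(2)])
  qed
qed (simp add: add)

text \<open>
  Leibniz rule. Three properties are allowed because a bounded family times a family tending
  to \<open>0\<close> tends to \<open>0\<close>.
\<close>

lemma jet_mult: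
  assumes mult: "\<And>f g. P f \<Longrightarrow> Q g \<Longrightarrow> R (\<lambda>\<tau> y. f \<tau> y * g \<tau> y)"
    and add: "\<And>f g. R f \<Longrightarrow> R g \<Longrightarrow> R (\<lambda>\<tau> y. f \<tau> y + g \<tau> y)"
  shows "jet P F J n f \<Longrightarrow> jet Q F J n g \<Longrightarrow> jet R F J n (\<lambda>\<tau> y. f \<tau> y * g \<tau> y)"
proof (induction n arbitrary: f g)
  case (Suc n)
  obtain f' where f': "\<forall>\<^sub>F \<tau> in F. \<forall>y\<in>J. (f \<tau> has_real_derivative f' \<tau> y) (at y)" "jet P F J n f'"
    using Suc.prems unfolding jet.simps by blast
  obtain g' where g': "\<forall>\<^sub>F \<tau> in F. \<forall>y\<in>J. (g \<tau> has_real_derivative g' \<tau> y) (at y)" "jet Q F J n g'"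
    using Suc.prems unfolding jet.simps by blast
  show ?case
  proof (rule jet_SucI)
    show "\<forall>\<^sub>F \<tau> in F. \<forall>y\<in>J. ((\<lambda>y. f \<tau> y * g \<tau> y) has_real_derivative
        f' \<tau> y * g \<tau> y + f \<tau> y * g' \<tau> y) (at y)"
      using f'(1) g'(1) by eventually_elim (auto intro!: derivative_eq_intros)
    show "jet R F J n (\<lambda>\<tau> y. f' \<tau> y * g \<tau> y + f \<tau> y * g' \<tau> y)"
      by (intro jet_add[where P=R] add Suc.IH f'(2) g'(2) jet_SucD[OF Suc.prems(1)] jet_SucD[OF Suc.prems(2)])
    show "R (\<lambda>\<tau> y. f \<tau> y * g \<tau> y)" by (intro mult jet_0[OF Suc.prems(1)] jet_0[OF Suc.prems(2)])
  qed
qed (simp add: mult)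

text \<open>
  A function of the single coordinate \<open>p $ m\<close> has iterated partial derivatives of the same kind:
  the \<open>m\<close>-th partial derivative shifts the jet by one order, any other one gives \<open>0\<close>.
\<close>

lemma partials_jet:
  fixes w :: "'t \<Rightarrow> real^'n::finite \<Rightarrow> real" and m :: 'n
  assumes J: "open J" and zero: "P (\<lambda>_ _. 0)"
    and jet: "jet P F J (n + length is) \<phi>"
    and w: "\<forall>\<^sub>F \<tau> in F. \<forall>p. p $ m \<in> J \<longrightarrow> w \<tau> p = \<phi> \<tau> (p $ m)"
  shows "\<exists>\<psi>. jet P F J n \<psi> \<and>
           (\<forall>\<^sub>F \<tau> in F. \<forall>p. p $ m \<in> J \<longrightarrow> partials is (w \<tau>) p = \<psi> \<tau> (p $ m))"
  using jet
proof (induction "is" arbitrary: n)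
  case Nil
  have "jet P F J n \<phi>" using Nil by simp
  thus ?case using w unfolding foldr.simps id_apply by blast
next
  case (Cons i "is")
  have "jet P F J (Suc n + length is) \<phi>" using Cons.prems by simp
  from Cons.IH[OF this] obtain \<psi> where \<psi>: "jet P F J (Suc n) \<psi>"
    "\<forall>\<^sub>F \<tau> in F. \<forall>p. p $ m \<in> J \<longrightarrow> partials is (w \<tau>) p = \<psi> \<tau> (p $ m)" by blast
  from \<psi>(1) obtain \<psi>' where \<psi>': "jet P F J n \<psi>'"
    "\<forall>\<^sub>F \<tau> in F. \<forall>y\<in>J. (\<psi> \<tau> has_real_derivative \<psi>' \<tau> y) (at y)" unfolding jet.simps by blast
  have op: "open {p::real^'n. p $ m \<in> J}"
    using open_vimage[OF J, of "\<lambda>u::real^'n. u $ m"] by (simp add: vimage_def continuous_on_component)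
  define \<eta> where "\<eta> = (if i = m then \<psi>' else (\<lambda>_ _. 0))"
  have "jet P F J n \<eta>" using \<psi>' by (simp add: \<eta>_def jet_zero zero)
  moreover have "\<forall>\<^sub>F \<tau> in F. \<forall>p. p $ m \<in> J \<longrightarrow> partials (i # is) (w \<tau>) p = \<eta> \<tau> (p $ m)"
    using \<psi>(2) \<psi>'(2)
  proof eventually_elim
    case (elim \<tau>)
    show ?case
    proof (intro allI impI)
      fix p :: "real^'n" assume p: "p $ m \<in> J"
      have "partials (i # is) (w \<tau>) p = partial i (\<lambda>p. \<psi> \<tau> (p $ m)) p"
        using partial_cong_open[OF op, of p "partials is (w \<tau>)"] elim(1) p by simp
      also have "\<dots> = \<eta> \<tau> (p $ m)"
      proof (cases "i = m")
        case True
        have "((\<lambda>h. \<psi> \<tau> (p $ m + h)) has_real_derivative \<psi>' \<tau> (p $ m)) (at 0)"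
          using elim(2) p DERIV_at_within_shift[of "\<psi> \<tau>" "\<psi>' \<tau> (p $ m)" "p $ m" 0 UNIV]
          by (simp add: add.commute)
        thus ?thesis unfolding partial_def \<eta>_def
          by (intro vector_derivative_at)
             (simp add: has_real_derivative_iff_has_vector_derivative True axis_def)
      next
        case False
        thus ?thesis unfolding partial_def \<eta>_def
          by (intro vector_derivative_at) (simp add: axis_def)
      qed
      finally show "partials (i # is) (w \<tau>) p = \<eta> \<tau> (p $ m)" .
    qed
  qed
  ultimately show ?case by blast
qed


section \<open>From the geometric equation to a first-order system\<close>

text \<open>
  A single function, seen as a family indexed by \<open>unit\<close>.
\<close>

definition smooth_jet :: "nat \<Rightarrow> (real \<Rightarrow> real) \<Rightarrow> bool" where
  "smooth_jet n f \<longleftrightarrow> jet (\<lambda>_. True) (principal (UNIV :: unit set)) UNIV n (\<lambda>_. f)"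

lemma smooth_jet_0: "smooth_jet 0 f"
  by (simp add: smooth_jet_def)

lemma smooth_jet_SucI:
  assumes "\<And>s. (f has_real_derivative f' s) (at s)" "smooth_jet n f'"
  shows "smooth_jet (Suc n) f"
  unfolding smooth_jet_def
  by (rule jet_SucI[where f'="\<lambda>_. f'"]) (use assms in \<open>auto simp: smooth_jet_def\<close>)

lemma smooth_jet_SucE:
  assumes "smooth_jet (Suc n) f"
  obtains f' where "\<And>s. (f has_real_derivative f' s) (at s)" "smooth_jet n f'"
proof -
  obtain f' :: "unit \<Rightarrow> real \<Rightarrow> real" where "\<And>s. (f has_real_derivative f' () s) (at s)"
    "jet (\<lambda>_. True) (principal UNIV) UNIV n f'"
    using assms unfolding smooth_jet_def jet.simps eventually_principal by blast
  moreover have "f' = (\<lambda>_. f' ())" by (simp add: fun_eq_iff)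
  ultimately show ?thesis using that[of "f' ()"] by (simp add: smooth_jet_def)
qed

lemma smooth_jet_mult: "smooth_jet n f \<Longrightarrow> smooth_jet n g \<Longrightarrow> smooth_jet n (\<lambda>s. f s * g s)"
  unfolding smooth_jet_def by (rule jet_mult) auto

lemma smooth_jet_add: "smooth_jet n f \<Longrightarrow> smooth_jet n g \<Longrightarrow> smooth_jet n (\<lambda>s. f s + g s)"
  unfolding smooth_jet_def by (rule jet_add) auto

lemma smooth_jet_const: "smooth_jet n (\<lambda>_. c)"
  unfolding smooth_jet_def by (rule jet_const) auto

lemma smooth_jet_minus: "smooth_jet n f \<Longrightarrow> smooth_jet n (\<lambda>s. - f s)"
  using smooth_jet_mult[OF smooth_jet_const[of n "-1"], of f] by simp

lemma smooth_jet_diff: "smooth_jet n f \<Longrightarrow> smooth_jet n g \<Longrightarrow> smooth_jet n (\<lambda>s. f s - g s)"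
  using smooth_jet_add[OF _ smooth_jet_minus] by simp

lemmas smooth_jet_intros =
  smooth_jet_mult smooth_jet_add smooth_jet_const smooth_jet_minus smooth_jet_diff

lemma smooth_fun_onI:
  assumes "\<And>n. smooth_jet n f"
  shows "smooth_fun_on UNIV f"
proof -
  have "smooth_jet n ((deriv ^^ k) f)" for n k
  proof (induction k arbitrary: n)
    case (Suc k)
    obtain f' where f': "\<And>s. ((deriv ^^ k) f has_real_derivative f' s) (at s)" "smooth_jet n f'"
      using Suc.IH[of "Suc n"] by (rule smooth_jet_SucE) blast
    have "deriv ((deriv ^^ k) f) = f'" using DERIV_imp_deriv[OF f'(1)] by auto
    thus ?case using f'(2) by simp
  qed (simp add: assms)
  hence "(deriv ^^ k) f differentiable (at s)" for k s
    by (meson smooth_jet_SucE real_differentiable_def)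
  thus ?thesis unfolding smooth_fun_on_def by blast
qed

lemma has_derivative_cylinder_field:
  assumes "(a has_real_derivative a') (at (u $ 1))" "(b has_real_derivative b') (at (u $ 1))"
  shows "((\<lambda>u::real^2. vector [a (u $ 1), b (u $ 1), k * u $ 2 + d] :: real^3)
           has_derivative (\<lambda>h. vector [a' * h $ 1, b' * h $ 1, k * h $ 2])) (at u)"
proof -
  have 1: "((\<lambda>u::real^2. g (u $ 1)) has_derivative (\<lambda>h. g' * h $ 1)) (at u)"
    if "(g has_real_derivative g') (at (u $ 1))" for g g'
    using that has_derivative_compose[of "\<lambda>u::real^2. u $ 1" "\<lambda>h. h $ 1" u UNIV g "\<lambda>h. g' * h"]
    by (simp add: has_field_derivative_def bounded_linear_vec_nth bounded_linear_imp_has_derivative)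
  show ?thesis unfolding vector_3_axis
    by (auto intro!: derivative_eq_intros 1[OF assms(1)] 1[OF assms(2)]
        bounded_linear_vec_nth bounded_linear_imp_has_derivative)
qed

lemma smooth_on_cylinder:
  assumes "\<And>n. smooth_jet n x" "\<And>n. smooth_jet n y"
  shows "smooth_on UNIV (cylinder x y)"
proof -
  have *: "\<exists>a b k d. smooth_jet n a \<and> smooth_jet n b \<and>
      partials is (cylinder x y) = (\<lambda>u. vector [a (u $ 1), b (u $ 1), k * u $ 2 + d])" for n "is"
  proof (induction "is" arbitrary: n)
    case Nil
    show ?case
      by (intro exI[of _ x] exI[of _ y] exI[of _ 1] exI[of _ 0]) (simp add: assms cylinder_eq_field)
  next
    case (Cons i "is")
    obtain a b k d where ab: "smooth_jet (Suc n) a" "smooth_jet (Suc n) b"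
      and eq: "partials is (cylinder x y) = (\<lambda>u. vector [a (u $ 1), b (u $ 1), k * u $ 2 + d])"
      using Cons.IH[of "Suc n"] by blast
    obtain a' where a': "\<And>s. (a has_real_derivative a' s) (at s)" "smooth_jet n a'"
      using ab(1) by (rule smooth_jet_SucE) blast
    obtain b' where b': "\<And>s. (b has_real_derivative b' s) (at s)" "smooth_jet n b'"
      using ab(2) by (rule smooth_jet_SucE) blast
    consider "i = 1" | "i = 2" using exhaust_2 by blast
    thus ?case
    proof cases
      case 1
      have "partials (i # is) (cylinder x y)
          = (\<lambda>u. vector [a' (u $ 1), b' (u $ 1), 0 * u $ 2 + 0])"
        using partial_cylinder_field(1)[OF a'(1) b'(1)] by (simp add: eq 1 fun_eq_iff)
      thus ?thesis using a'(2) b'(2) by blast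
    next
      case 2
      have "partials (i # is) (cylinder x y)
          = (\<lambda>u. vector [(\<lambda>_. 0) (u $ 1), (\<lambda>_. 0) (u $ 1), 0 * u $ 2 + k])"
        using partial_cylinder_field(2)[OF a'(1) b'(1)] by (simp add: eq 2 fun_eq_iff)
      thus ?thesis using smooth_jet_const[of n 0] by blast
    qed
  qed
  show ?thesis unfolding smooth_on_def
  proof (intro conjI allI ballI)
    fix "is" and u :: "real^2"
    obtain a b k d where ab: "smooth_jet (Suc 0) a" "smooth_jet (Suc 0) b"
      and eq: "partials is (cylinder x y) = (\<lambda>u. vector [a (u $ 1), b (u $ 1), k * u $ 2 + d])"
      using *[of "Suc 0"] by blast
    obtain a' where a': "\<And>s. (a has_real_derivative a' s) (at s)"
      using ab(1) by (rule smooth_jet_SucE) blast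
    obtain b' where b': "\<And>s. (b has_real_derivative b' s) (at s)"
      using ab(2) by (rule smooth_jet_SucE) blast
    show "partials is (cylinder x y) differentiable at u"
      unfolding eq differentiable_def using has_derivative_cylinder_field[OF a' b'] by blast
  qed simp
qed

text \<open>
  Converse of the reduction, for an arbitrary regular parametrization: it serves both for arc length
  parametrizations and for graphs. The unit normal is the rotated tangent, normalized.
\<close>

lemma vertical_cplus_grim_reaper_cylinder:
  assumes x: "\<And>s. (x has_real_derivative x' s) (at s)" and x': "\<And>s. (x' has_real_derivative x'' s) (at s)"
    and y: "\<And>s. (y has_real_derivative y' s) (at s)" and y': "\<And>s. (y' has_real_derivative y'' s) (at s)"
    and smooth: "\<And>n. smooth_jet n x" "\<And>n. smooth_jet n y"
    and pos: "\<And>s. y s > 0" and reg: "\<And>s. x' s \<noteq> 0 \<or> y' s \<noteq> 0"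
    and eq: "\<And>s. (y s)\<^sup>2 * (x' s * y'' s - y' s * x'' s)
                 = x' s * ((x' s)\<^sup>2 + (y' s)\<^sup>2) * (2 - y s)"
  shows "vertical_cplus_grim_reaper UNIV (cylinder x y)"
proof -
  have strip: "strip UNIV = UNIV" by (simp add: strip_def)
  have nz: "(x' s)\<^sup>2 + (y' s)\<^sup>2 > 0" for s using reg[of s] by (auto simp: sum_power2_gt_zero_iff)
  have partial: "partial 1 (cylinder x y) u = vector [x' (u $ 1), y' (u $ 1), 0]"
    "partial 2 (cylinder x y) u = vector [0, 0, 1]" for u
    using partial_cylinder[OF open_UNIV x y x' y'] strip by auto
  define N :: "real^2 \<Rightarrow> real^3" where
    "N u = (y (u $ 1) / sqrt ((x' (u $ 1))\<^sup>2 + (y' (u $ 1))\<^sup>2)) *\<^sub>R vector [- y' (u $ 1), x' (u $ 1), 0]" for u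
  have N1: "riem (cylinder x y u) (N u) (N u) = 1" for u
  proof -
    define q where "q = sqrt ((x' (u $ 1))\<^sup>2 + (y' (u $ 1))\<^sup>2)"
    have q: "q > 0" "q\<^sup>2 = (x' (u $ 1))\<^sup>2 + (y' (u $ 1))\<^sup>2" using nz[of "u $ 1"] by (auto simp: q_def)
    have "riem (cylinder x y u) (N u) (N u) = ((x' (u $ 1))\<^sup>2 + (y' (u $ 1))\<^sup>2) / q\<^sup>2"
      unfolding N_def q_def[symmetric] using q(1) pos[of "u $ 1"] 
      by (simp add: riem_eq cylinder_def field_simps power2_eq_square)
    also have "\<dots> = 1" using q by (metis divide_self less_irrefl zero_less_power)
    finally show ?thesis .
  qed
  have N0: "riem (cylinder x y u) (N u) (partial i (cylinder x y) u) = 0" for u i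
    using exhaust_2[of i] by (auto simp: partial riem_eq N_def)
  have cont: "continuous_on UNIV N"
    unfolding N_def vector_3_axis
  proof (intro continuous_intros)
    have c: "continuous_on UNIV (\<lambda>u::real^2. g (u $ 1))" if "\<And>s. (g has_real_derivative g' s) (at s)" for g g'
      using that by (intro continuous_on_compose2[of UNIV g UNIV "\<lambda>u. u $ 1"] continuous_intros)
         (auto intro!: DERIV_continuous continuous_at_imp_continuous_on)
    show "continuous_on UNIV (\<lambda>u::real^2. y (u $ 1))" "continuous_on UNIV (\<lambda>u::real^2. x' (u $ 1))"
      "continuous_on UNIV (\<lambda>u::real^2. y' (u $ 1))" "continuous_on UNIV (\<lambda>u::real^2. x' (u $ 1))"
      "continuous_on UNIV (\<lambda>u::real^2. y' (u $ 1))"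
      by (rule c[OF y] c[OF x'] c[OF y'])+
    show "\<forall>u\<in>UNIV. sqrt ((x' (u $ 1))\<^sup>2 + (y' (u $ 1))\<^sup>2) \<noteq> 0" using nz 
      by (metis less_irrefl real_sqrt_eq_zero_cancel_iff)
  qed
  have "unit_normal UNIV (cylinder x y) N"
    unfolding unit_normal_def using N1 N0 cont by blast
  moreover have "mean_curvature (cylinder x y) N u = riem (cylinder x y u) (N u) (axis 2 1)" for u
    using reaper_equation_cylinder[OF open_UNIV x y x' y', of u N] pos reg N1 N0 eq by (simp add: strip)
  moreover have "immersed_surface UNIV (cylinder x y)"
    unfolding immersed_surface_def
  proof (intro conjI ballI)
    show "smooth_on UNIV (cylinder x y)" by (rule smooth_on_cylinder[OF smooth])
    show "cylinder x y ` UNIV \<subseteq> H2xR" using pos by (auto simp: cylinder_def H2xR_def)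
    fix u :: "real^2"
    have "(cylinder x y has_derivative (\<lambda>h. vector [x' (u $ 1) * h $ 1, y' (u $ 1) * h $ 1, 1 * h $ 2])) (at u)"
      unfolding cylinder_eq_field by (rule has_derivative_cylinder_field[OF x y])
    hence "frechet_derivative (cylinder x y) (at u)
        = (\<lambda>h. vector [x' (u $ 1) * h $ 1, y' (u $ 1) * h $ 1, 1 * h $ 2])"
      by (rule frechet_derivative_at[symmetric])
    thus "inj (frechet_derivative (cylinder x y) (at u))"
      using reg[of "u $ 1"] by (simp add: inj_def vec_eq_iff forall_3 forall_2) metis
  qed
  moreover have "(\<lambda>p. p + t *\<^sub>R axis 3 1) ` range (cylinder x y) = range (cylinder x y)" for t
  proof -
    have 1: "cylinder x y u + t *\<^sub>R axis 3 1 = cylinder x y (vector [u $ 1, u $ 2 + t])" for u t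
      by (simp add: vec_eq_iff forall_3 cylinder_def axis_def)
    have 2: "cylinder x y u = cylinder x y (vector [u $ 1, u $ 2 - t]) + t *\<^sub>R axis 3 1" for u
      by (simp add: 1) (simp add: cylinder_def)
    show ?thesis
    proof (intro equalityI subsetI)
      fix p assume "p \<in> (\<lambda>p. p + t *\<^sub>R axis 3 1) ` range (cylinder x y)"
      then obtain u where "p = cylinder x y u + t *\<^sub>R axis 3 1" by blast
      thus "p \<in> range (cylinder x y)" using 1 by (metis rangeI)
    next
      fix p assume "p \<in> range (cylinder x y)"
      then obtain u where "p = cylinder x y u" by blast
      thus "p \<in> (\<lambda>p. p + t *\<^sub>R axis 3 1) ` range (cylinder x y)" using 2[of u] by (metis imageI rangeI)
    qed
  qed
  ultimately show ?thesis
    unfolding vertical_cplus_grim_reaper_def cplus_grim_reaper_def by blast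
qed

text \<open>
  The first-order system for the generating curve. The equations for \<open>x\<close> and \<open>y\<close> say that \<open>s\<close> is hyperbolic arc length and \<open>\<theta>\<close> is the Euclidean angle of the
  curve; the third equation is \<open>H = \<langle>N, \<partial>\<^sub>y\<rangle>\<close>.
\<close>

definition reaper_curve :: "real set \<Rightarrow> (real \<Rightarrow> real) \<Rightarrow> (real \<Rightarrow> real) \<Rightarrow> (real \<Rightarrow> real) \<Rightarrow> bool" where
  "reaper_curve I x y \<theta> \<longleftrightarrow> (\<forall>s\<in>I. y s > 0 \<and>
     (x has_real_derivative y s * cos (\<theta> s)) (at s) \<and>
     (y has_real_derivative y s * sin (\<theta> s)) (at s) \<and>
     (\<theta> has_real_derivative cos (\<theta> s) * (2 / y s - 1)) (at s))"

lemma reaper_curveD: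
  assumes "reaper_curve I x y \<theta>" "s \<in> I"
  shows "y s > 0" "(x has_real_derivative y s * cos (\<theta> s)) (at s)"
    "(y has_real_derivative y s * sin (\<theta> s)) (at s)"
    "(\<theta> has_real_derivative cos (\<theta> s) * (2 / y s - 1)) (at s)"
  using assms by (auto simp: reaper_curve_def)

text \<open>
  Bootstrapping: the right-hand sides are polynomials in \<open>y\<close>, \<open>1 / y\<close>, \<open>cos \<theta>\<close> and \<open>sin \<theta>\<close>, and the
  derivatives of these four functions are again such polynomials. Hence one order of
  differentiability of all of them together yields the next.
\<close>

lemma reaper_curve_smooth:
  assumes "reaper_curve UNIV x y \<theta>"
  shows "smooth_jet n x" "smooth_jet n y" "smooth_jet n \<theta>"
proof -
  note d = reaper_curveD[OF assms UNIV_I]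
  have "smooth_jet n x \<and> smooth_jet n y \<and> smooth_jet n \<theta> \<and> smooth_jet n (\<lambda>s. cos (\<theta> s)) \<and>
     smooth_jet n (\<lambda>s. sin (\<theta> s)) \<and> smooth_jet n (\<lambda>s. 1 / y s)"
  proof (induction n)
    case (Suc n)
    note IH = Suc.IH
    let ?t = "\<lambda>s. cos (\<theta> s) * (2 * (1 / y s) - 1)"
    have t: "smooth_jet n ?t" using IH by (intro smooth_jet_intros) auto
    have "smooth_jet (Suc n) x" using d(2) by (rule smooth_jet_SucI) (use IH in \<open>auto intro: smooth_jet_intros\<close>)
    moreover have "smooth_jet (Suc n) y" using d(3) by (rule smooth_jet_SucI) (use IH in \<open>auto intro: smooth_jet_intros\<close>)
    moreover have "smooth_jet (Suc n) \<theta>" by (rule smooth_jet_SucI[where f'="?t"]) (use d(4) t in auto)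
    moreover have "smooth_jet (Suc n) (\<lambda>s. cos (\<theta> s))"
      by (rule smooth_jet_SucI[where f'="\<lambda>s. - (sin (\<theta> s) * ?t s)"])
         (use IH t d(4) in \<open>auto intro!: derivative_eq_intros smooth_jet_intros\<close>)
    moreover have "smooth_jet (Suc n) (\<lambda>s. sin (\<theta> s))"
      by (rule smooth_jet_SucI[where f'="\<lambda>s. cos (\<theta> s) * ?t s"])
         (use IH t d(4) in \<open>auto intro!: derivative_eq_intros smooth_jet_intros\<close>)
    moreover have "smooth_jet (Suc n) (\<lambda>s. 1 / y s)"
    proof (rule smooth_jet_SucI)
      show "smooth_jet n (\<lambda>s. - ((1 / y s) * sin (\<theta> s)))" using IH by (intro smooth_jet_intros) auto
      fix s show "((\<lambda>s. 1 / y s) has_real_derivative - ((1 / y s) * sin (\<theta> s))) (at s)"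
        using d(1)[of s] by (auto intro!: derivative_eq_intros d(3) simp: field_simps)
    qed
    ultimately show ?case by blast
  qed (simp add: smooth_jet_0)
  thus "smooth_jet n x" "smooth_jet n y" "smooth_jet n \<theta>" by auto
qed

lemma reaper_curve_second_derivatives:
  assumes "reaper_curve I x y \<theta>" "s \<in> I"
  shows "((\<lambda>s. y s * cos (\<theta> s)) has_real_derivative
            y s * sin (\<theta> s) * cos (\<theta> s) - y s * sin (\<theta> s) * (cos (\<theta> s) * (2 / y s - 1))) (at s)"
    and "((\<lambda>s. y s * sin (\<theta> s)) has_real_derivative
            y s * sin (\<theta> s) * sin (\<theta> s) + y s * cos (\<theta> s) * (cos (\<theta> s) * (2 / y s - 1))) (at s)"
  using reaper_curveD[OF assms] by (auto intro!: derivative_eq_intros)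

theorem reaper_curve_imp_reaper:
  assumes "reaper_curve UNIV x y \<theta>"
  shows "generating_curve UNIV x y \<theta>" "vertical_cplus_grim_reaper UNIV (cylinder x y)"
proof -
  note d = reaper_curveD[OF assms UNIV_I] and d2 = reaper_curve_second_derivatives[OF assms UNIV_I]
  show "generating_curve UNIV x y \<theta>"
    unfolding generating_curve_def using d(2,3) smooth_fun_onI reaper_curve_smooth(3)[OF assms] by blast
  show "vertical_cplus_grim_reaper UNIV (cylinder x y)"
  proof (rule vertical_cplus_grim_reaper_cylinder[OF d(2) d2(1) d(3) d2(2) reaper_curve_smooth(1,2)[OF assms] d(1)])
    fix s
    show "y s * cos (\<theta> s) \<noteq> 0 \<or> y s * sin (\<theta> s) \<noteq> 0"
      using d(1)[of s] sin_zero_abs_cos_one[of "\<theta> s"] by auto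
    define c S Y where "c = cos (\<theta> s)" and "S = sin (\<theta> s)" and "Y = y s"
    have Y: "Y > 0" and cS: "S\<^sup>2 + c\<^sup>2 = 1" using d(1) by (auto simp: c_def S_def Y_def)
    have "Y\<^sup>2 * (Y * c * (Y * S * S + Y * c * (c * (2 / Y - 1))) -
         Y * S * (Y * S * c - Y * S * (c * (2 / Y - 1)))) = Y\<^sup>2 * Y\<^sup>2 * (c * (2 / Y - 1)) * (S\<^sup>2 + c\<^sup>2)"
      by (simp add: algebra_simps power2_eq_square)
    also have "\<dots> = Y * c * ((Y * c)\<^sup>2 + (Y * S)\<^sup>2) * (2 - Y)"
    proof -
      have "(Y * c)\<^sup>2 + (Y * S)\<^sup>2 = Y\<^sup>2" using cS by (simp add: power_mult_distrib flip: distrib_left add.commute)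
      thus ?thesis using cS Y by (simp add: field_simps power2_eq_square)
    qed
    finally show "(y s)\<^sup>2 * (y s * cos (\<theta> s) * (y s * sin (\<theta> s) * sin (\<theta> s) + y s * cos (\<theta> s) * (cos (\<theta> s) * (2 / y s - 1))) -
         y s * sin (\<theta> s) * (y s * sin (\<theta> s) * cos (\<theta> s) - y s * sin (\<theta> s) * (cos (\<theta> s) * (2 / y s - 1))))
       = y s * cos (\<theta> s) * ((y s * cos (\<theta> s))\<^sup>2 + (y s * sin (\<theta> s))\<^sup>2) * (2 - y s)"
      unfolding c_def S_def Y_def .
  qed
qed

text \<open>
  With \<open>x' = y cos \<theta>\<close> and \<open>y' = y sin \<theta>\<close> the scalar equation reads
  \<open>y\<^sup>4 (\<theta>' + cos \<theta>) = 2 y\<^sup>3 cos \<theta>\<close>: the hyperbolic curvature of the curve is \<open>\<theta>' + cos \<theta>\<close>.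
\<close>

theorem reaper_imp_reaper_curve:
  assumes I: "open I" and gen: "generating_curve I x y \<theta>"
    and reap: "vertical_cplus_grim_reaper (strip I) (cylinder x y)"
  shows "reaper_curve I x y \<theta>"
proof -
  have pos: "y s > 0" if "s \<in> I" for s
  proof -
    have "cylinder x y ` strip I \<subseteq> H2xR"
      using reap unfolding vertical_cplus_grim_reaper_def cplus_grim_reaper_def immersed_surface_def by blast
    moreover have "vector [s, 0] \<in> strip I" using that by (simp add: strip_def)
    ultimately have "cylinder x y (vector [s, 0]) \<in> H2xR" by blast
    thus ?thesis by (simp add: cylinder_def H2xR_def)
  qed
  have x: "(x has_real_derivative y s * cos (\<theta> s)) (at s)" and y: "(y has_real_derivative y s * sin (\<theta> s)) (at s)"
    if "s \<in> I" for s using gen that by (auto simp: generating_curve_def)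
  have \<theta>: "(\<theta> has_real_derivative deriv \<theta> s) (at s)" if "s \<in> I" for s
  proof -
    have "(deriv ^^ 0) \<theta> differentiable (at s)"
      using gen that unfolding generating_curve_def smooth_fun_on_def by blast
    thus ?thesis by (simp add: DERIV_deriv_iff_real_differentiable)
  qed
  have x': "((\<lambda>s. y s * cos (\<theta> s)) has_real_derivative
       y s * sin (\<theta> s) * cos (\<theta> s) - y s * sin (\<theta> s) * deriv \<theta> s) (at s)"
    and y': "((\<lambda>s. y s * sin (\<theta> s)) has_real_derivative
       y s * sin (\<theta> s) * sin (\<theta> s) + y s * cos (\<theta> s) * deriv \<theta> s) (at s)" if "s \<in> I" for s
    using x y \<theta> that by (auto intro!: derivative_eq_intros)
  obtain N where N: "unit_normal (strip I) (cylinder x y) N"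
    "\<And>u. u \<in> strip I \<Longrightarrow> mean_curvature (cylinder x y) N u = riem (cylinder x y u) (N u) (axis 2 1)"
    using reap unfolding vertical_cplus_grim_reaper_def cplus_grim_reaper_def by blast
  have "deriv \<theta> s = cos (\<theta> s) * (2 / y s - 1)" if s: "s \<in> I" for s
  proof -
    define u :: "real^2" where "u = vector [s, 0]"
    have u: "u \<in> strip I" "u $ 1 = s" using s by (auto simp: u_def strip_def)
    define c S Y t where "c = cos (\<theta> s)" and "S = sin (\<theta> s)" and "Y = y s" and "t = deriv \<theta> s"
    have Y: "Y > 0" and cS: "S\<^sup>2 + c\<^sup>2 = 1" using pos[OF s] by (auto simp: c_def S_def Y_def)
    have reg: "Y * c \<noteq> 0 \<or> Y * S \<noteq> 0" using Y cS by auto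
    have "Y\<^sup>2 * (Y * c * (Y * S * S + Y * c * t) - Y * S * (Y * S * c - Y * S * t))
       = Y * c * ((Y * c)\<^sup>2 + (Y * S)\<^sup>2) * (2 - Y)"
      using reaper_equation_cylinder[OF I x y x' y' u(1), of N] N(2)[OF u(1)] N(1) u reg pos[OF s]
      unfolding unit_normal_def c_def S_def Y_def t_def by simp
    moreover have "(Y * c)\<^sup>2 + (Y * S)\<^sup>2 = Y\<^sup>2" 
      using cS by (simp add: power_mult_distrib flip: distrib_left add.commute)
    moreover have "Y\<^sup>2 * (Y * c * (Y * S * S + Y * c * t) - Y * S * (Y * S * c - Y * S * t))
        = Y^3 * (Y * t * (S\<^sup>2 + c\<^sup>2))"
      by (simp add: algebra_simps power2_eq_square power3_eq_cube)
    ultimately have "Y^3 * (Y * t * (S\<^sup>2 + c\<^sup>2)) = Y * c * Y\<^sup>2 * (2 - Y)" by metis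
    hence "Y^3 * (Y * t) = Y^3 * (c * (2 - Y))"
      unfolding cS by (simp add: algebra_simps power2_eq_square power3_eq_cube)
    hence "Y * t = c * (2 - Y)" using Y by simp
    hence "t = c * (2 / Y - 1)" using Y by (simp add: field_simps)
    thus ?thesis by (simp add: t_def c_def Y_def)
  qed
  thus ?thesis using pos x y \<theta> unfolding reaper_curve_def by auto
qed


section \<open>Lipschitz differential equations\<close>

lemma continuous_has_antiderivative:
  fixes f :: "real \<Rightarrow> 'a::euclidean_space"
  assumes "continuous_on UNIV f"
  shows "\<exists>F. F 0 = 0 \<and> (\<forall>t. (F has_vector_derivative f t) (at t))"
proof -
  have "isCont f t" for t using assms by (simp add: continuous_on_eq_continuous_at)
  then obtain F where F: "\<And>t. (F has_vector_derivative f t) (at t)"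
    using einterval_antiderivative[of "-\<infinity>" \<infinity> f] by auto
  have "((\<lambda>t. F t - F 0) has_vector_derivative f t) (at t)" for t
    using has_vector_derivative_diff[OF F[of t] has_vector_derivative_const[of "F 0"]] by simp
  thus ?thesis by (intro exI[of _ "\<lambda>t. F t - F 0"]) simp
qed

text \<open>
  Integrating \<open>exp (K * \<bar>t\<bar>)\<close> gains a factor \<open>1 / K\<close>; this is what makes the Picard operator a
  contraction on the whole line for a suitable weight.
\<close>

lemma antiderivative_exp_bound:
  fixes F :: "real \<Rightarrow> 'a::real_normed_vector"
  assumes F: "F 0 = 0" "\<And>t. (F has_vector_derivative f t) (at t)"
    and bound: "\<And>t. norm (f t) \<le> C * exp (K * \<bar>t\<bar>)" and K: "K > 0" and C: "C \<ge> 0"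
  shows "norm (F t) \<le> C / K * exp (K * \<bar>t\<bar>)"
proof -
  have forward: "norm (G t) \<le> C / K * exp (K * t)"
    if G: "G 0 = 0" "\<And>t. (G has_vector_derivative g t) (at t)"
      and g: "\<And>t. norm (g t) \<le> C * exp (K * \<bar>t\<bar>)" and t: "t > 0"
    for G g :: "real \<Rightarrow> 'a" and t
  proof -
    have "norm (G t - G 0) \<le> C / K * exp (K * t) - C / K * exp (K * 0)"
    proof (rule differentiable_bound_general[where \<phi>="\<lambda>s. C / K * exp (K * s)"
            and \<phi>'="\<lambda>s. C * exp (K * s)", OF t])
      show "continuous_on {0..t} G"
        using G(2) by (meson continuous_at_imp_continuous_on has_vector_derivative_continuous)
      show "((\<lambda>s. C / K * exp (K * s)) has_vector_derivative C * exp (K * s)) (at s)" for s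
        using K by (auto intro!: derivative_eq_intros
            simp: has_real_derivative_iff_has_vector_derivative[symmetric])
      show "norm (g s) \<le> C * exp (K * s)" if "0 < s" for s using g[of s] that by simp
    qed (use K in \<open>auto intro!: continuous_intros G(2)\<close>)
    moreover have "C / K \<ge> 0" using K C by simp
    ultimately show ?thesis using G(1) by simp
  qed
  have reflected: "((\<lambda>t. F (- t)) has_vector_derivative - f (- t)) (at t)" for t
    using vector_diff_chain_at[of uminus "-1" t F "f (- t)"] F(2)[of "- t"]
    by (simp add: o_def has_vector_derivative_minus has_vector_derivative_id)
  consider "t = 0" | "t > 0" | "t < 0" by linarith
  thus ?thesis
  proof cases
    case 1
    thus ?thesis using F(1) K C by simp
  next
    case 2
    thus ?thesis using forward[OF F bound 2] by simp
  next
    case 3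
    thus ?thesis using forward[OF _ reflected, of "- t"] F(1) bound[of "- _"] by simp
  qed
qed

lemma has_vector_derivative_reflect:
  assumes "(F has_vector_derivative f) (at (- t))"
  shows "((\<lambda>t. F (- t)) has_vector_derivative - f) (at (t::real))"
  using vector_diff_chain_at[of uminus "-1" t F f] assms
  by (simp add: o_def has_vector_derivative_minus has_vector_derivative_id)

text \<open>
  Picard iteration done once on the whole line. A function of at most exponential growth is written as
  \<open>exp (K * \<bar>t\<bar>)\<close> times a bounded continuous function; on the latter the Picard operator contracts by
  \<open>L / K \<le> 1 / 2\<close>, and Banach's theorem gives a solution for all times.
\<close>

theorem lipschitz_ode_solution:
  fixes F :: "'a::euclidean_space \<Rightarrow> 'a"
  assumes L: "\<And>p q. norm (F p - F q) \<le> L * norm (p - q)" and L0: "L \<ge> 0"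
  shows "\<exists>\<phi>. \<phi> 0 = a \<and> (\<forall>t. (\<phi> has_vector_derivative F (\<phi> t)) (at t))"
proof -
  define K where "K = 2 * L + 1"
  have K: "K > 0" "L / K \<le> 1/2" using L0 by (auto simp: K_def field_simps)
  have contF: "continuous_on UNIV F"
    by (rule lipschitz_on_continuous_on[of L]) (use L L0 in \<open>auto simp: lipschitz_on_def dist_norm\<close>)
  define field where "field z t = F (exp (K * \<bar>t\<bar>) *\<^sub>R apply_bcontfun z t)" for z :: "real \<Rightarrow>\<^sub>C 'a" and t
  have "continuous_on UNIV (field z)" for z
    unfolding field_def by (intro continuous_on_compose2[OF contF] continuous_intros) auto
  hence "\<exists>\<Phi>. \<Phi> 0 = 0 \<and> (\<forall>t. (\<Phi> has_vector_derivative field z t) (at t))" for z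
    by (rule continuous_has_antiderivative)
  then obtain A where A: "\<And>z. A z 0 = 0" "\<And>z t. (A z has_vector_derivative field z t) (at t)"
    by metis
  define T where "T z t = exp (- K * \<bar>t\<bar>) *\<^sub>R (a + A z t)" for z t
  have T_bcontfun: "T z \<in> bcontfun" for z
  proof -
    have "bounded (range (apply_bcontfun z))" by simp
    then obtain M where M: "\<And>t. norm (apply_bcontfun z t) \<le> M" "M > 0"
      unfolding bounded_pos by auto
    define C where "C = norm (F 0) + L * M"
    have "norm (field z t) \<le> C * exp (K * \<bar>t\<bar>)" for t
    proof -
      have "norm (field z t) \<le> norm (F 0) + norm (field z t - F 0)"
        by (metis add.commute diff_add_cancel norm_triangle_ineq)
      also have "norm (field z t - F 0) \<le> L * (exp (K * \<bar>t\<bar>) * norm (apply_bcontfun z t))"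
        unfolding field_def using L[of _ 0] by (metis abs_exp_cancel diff_zero norm_scaleR)
      also have "\<dots> \<le> L * (exp (K * \<bar>t\<bar>) * M)"
        by (intro mult_left_mono M(1) L0) auto
      also have "norm (F 0) \<le> norm (F 0) * exp (K * \<bar>t\<bar>)"
        using K(1) by (simp add: mult_le_cancel_left1)
      finally show ?thesis by (simp add: C_def algebra_simps)
    qed
    moreover have "C \<ge> 0" using L0 M(2) by (simp add: C_def)
    ultimately have *: "norm (A z t) \<le> C / K * exp (K * \<bar>t\<bar>)" for t
      using antiderivative_exp_bound[OF A] K(1) by blast
    have "norm (T z t) \<le> norm a + C / K" for t
    proof -
      have "norm (T z t) = exp (- K * \<bar>t\<bar>) * norm (a + A z t)" by (simp add: T_def)
      also have "\<dots> \<le> exp (- K * \<bar>t\<bar>) * (norm a + C / K * exp (K * \<bar>t\<bar>))"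
        by (intro mult_left_mono order_trans[OF norm_triangle_ineq] add_left_mono *) auto
      also have "\<dots> = exp (- K * \<bar>t\<bar>) * norm a + C / K"
        by (simp add: algebra_simps exp_minus)
      also have "exp (- K * \<bar>t\<bar>) * norm a \<le> 1 * norm a"
        using K(1) by (intro mult_right_mono) auto
      finally show ?thesis by simp
    qed
    moreover have "continuous_on UNIV (A z)"
      using A(2) by (meson continuous_at_imp_continuous_on has_vector_derivative_continuous)
    hence "continuous_on UNIV (T z)" unfolding T_def by (intro continuous_intros)
    ultimately show ?thesis unfolding bcontfun_def bounded_iff by auto
  qed
  define T' where "T' z = Bcontfun (T z)" for z
  have T': "apply_bcontfun (T' z) = T z" for z
    using T_bcontfun by (simp add: T'_def Bcontfun_inverse)
  have "dist (T' z1) (T' z2) \<le> 1/2 * dist z1 z2" for z1 z2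
  proof (rule dist_bound)
    fix t
    have d: "((\<lambda>t. A z1 t - A z2 t) has_vector_derivative field z1 t - field z2 t) (at t)" for t
      by (intro has_vector_derivative_diff A(2))
    have "norm (field z1 t - field z2 t) \<le> (L * dist z1 z2) * exp (K * \<bar>t\<bar>)" for t
    proof -
      have "norm (field z1 t - field z2 t)
          \<le> L * norm (exp (K * \<bar>t\<bar>) *\<^sub>R (apply_bcontfun z1 t - apply_bcontfun z2 t))"
        unfolding field_def scaleR_diff_right by (rule L)
      also have "\<dots> = L * dist (apply_bcontfun z1 t) (apply_bcontfun z2 t) * exp (K * \<bar>t\<bar>)"
        by (simp add: dist_norm)
      also have "\<dots> \<le> L * dist z1 z2 * exp (K * \<bar>t\<bar>)"
        by (intro mult_right_mono mult_left_mono dist_bounded L0) auto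
      finally show ?thesis .
    qed
    hence "norm (A z1 t - A z2 t) \<le> (L * dist z1 z2) / K * exp (K * \<bar>t\<bar>)"
      using antiderivative_exp_bound[OF _ d] A(1) K(1) L0 by simp
    hence "exp (- K * \<bar>t\<bar>) * norm (A z1 t - A z2 t)
        \<le> exp (- K * \<bar>t\<bar>) * ((L * dist z1 z2) / K * exp (K * \<bar>t\<bar>))"
      by (intro mult_left_mono) auto
    also have "\<dots> = L / K * dist z1 z2" by (simp add: exp_minus)
    also have "\<dots> \<le> 1/2 * dist z1 z2" using K(2) by (intro mult_right_mono) auto
    also have "exp (- K * \<bar>t\<bar>) * norm (A z1 t - A z2 t) = dist (T z1 t) (T z2 t)"
      by (simp add: T_def dist_norm flip: scaleR_diff_right)
    finally show "dist (apply_bcontfun (T' z1) t) (apply_bcontfun (T' z2) t) \<le> 1/2 * dist z1 z2"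
      by (simp add: T')
  qed
  then obtain z where z: "T' z = z"
    using banach_fix_type[of "1/2" T'] by auto
  define \<phi> where "\<phi> t = a + A z t" for t
  have "exp (K * \<bar>t\<bar>) *\<^sub>R apply_bcontfun z t = \<phi> t" for t
    using T'[of z] unfolding z by (simp add: T_def \<phi>_def flip: exp_add)
  hence "field z t = F (\<phi> t)" for t by (simp add: field_def)
  moreover have "(\<phi> has_vector_derivative field z t) (at t)" for t
    unfolding \<phi>_def using has_vector_derivative_add[OF has_vector_derivative_const A(2)] by simp
  ultimately have "\<phi> 0 = a \<and> (\<forall>t. (\<phi> has_vector_derivative F (\<phi> t)) (at t))"
    by (simp add: \<phi>_def A(1))
  thus ?thesis by blast
qed

text \<open>
  Gronwall: the squared distance of two solutions, multiplied by \<open>exp (- 2 * L * t)\<close>, cannot grow.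
\<close>

lemma lipschitz_ode_unique_forward:
  fixes F :: "'a::real_inner \<Rightarrow> 'a"
  assumes L: "\<And>u v. norm (F u - F v) \<le> L * norm (u - v)"
    and p: "\<And>s. t0 \<le> s \<Longrightarrow> s \<le> t \<Longrightarrow> (p has_vector_derivative F (p s)) (at s)"
    and q: "\<And>s. t0 \<le> s \<Longrightarrow> s \<le> t \<Longrightarrow> (q has_vector_derivative F (q s)) (at s)"
    and init: "p t0 = q t0" and t: "t0 \<le> t"
  shows "p t = q t"
proof -
  define n where "n s = (p s - q s) \<bullet> (p s - q s)" for s
  define d where "d s = n s * exp (- (2 * L) * (s - t0))" for s
  have "d t \<le> d t0"
  proof (rule DERIV_nonpos_imp_nonincreasing[OF t])
    fix s assume s: "t0 \<le> s" "s \<le> t"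
    let ?e = "exp (- (2 * L) * (s - t0))"
    let ?d' = "2 * ((p s - q s) \<bullet> (F (p s) - F (q s)) - L * ((p s - q s) \<bullet> (p s - q s))) * ?e"
    have pq: "((\<lambda>s. p s - q s) has_vector_derivative F (p s) - F (q s)) (at s)"
      by (intro has_vector_derivative_diff p q s)
    have "(n has_real_derivative 2 * ((p s - q s) \<bullet> (F (p s) - F (q s)))) (at s)"
      using has_derivative_inner[OF pq[unfolded has_vector_derivative_def] pq[unfolded has_vector_derivative_def]]
      unfolding has_field_derivative_def n_def by (rule has_derivative_eq_rhs) (auto simp: inner_commute algebra_simps)
    hence "(d has_real_derivative ?d') (at s)"
    proof -
      assume n: "(n has_real_derivative 2 * ((p s - q s) \<bullet> (F (p s) - F (q s)))) (at s)"
      have e: "((\<lambda>s. exp (- (2 * L) * (s - t0))) has_real_derivative - (2 * L) * ?e) (at s)"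
        by (auto intro!: derivative_eq_intros)
      show ?thesis
        unfolding d_def by (rule DERIV_cong[OF DERIV_mult[OF n e]]) (simp add: n_def algebra_simps)
    qed
    moreover have "(p s - q s) \<bullet> (F (p s) - F (q s)) \<le> L * ((p s - q s) \<bullet> (p s - q s))"
    proof -
      have "(p s - q s) \<bullet> (F (p s) - F (q s)) \<le> norm (p s - q s) * norm (F (p s) - F (q s))"
        by (rule norm_cauchy_schwarz)
      also have "\<dots> \<le> norm (p s - q s) * (L * norm (p s - q s))" by (intro mult_left_mono L) auto
      finally show ?thesis by (simp add: power2_norm_eq_inner[symmetric] power2_eq_square mult_ac)
    qed
    hence "?d' \<le> 0" by (intro mult_nonpos_nonneg mult_nonneg_nonpos) auto
    ultimately show "\<exists>y. (d has_real_derivative y) (at s) \<and> y \<le> 0" by blast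
  qed
  hence "((p t - q t) \<bullet> (p t - q t)) * exp (- (2 * L) * (t - t0)) \<le> 0" using init by (simp add: d_def n_def)
  hence "(p t - q t) \<bullet> (p t - q t) \<le> 0" by (simp add: mult_le_0_iff)
  hence "(p t - q t) \<bullet> (p t - q t) = 0" using inner_ge_zero antisym by blast
  thus ?thesis by simp
qed

theorem lipschitz_ode_unique:
  fixes F :: "'a::real_inner \<Rightarrow> 'a"
  assumes L: "\<And>u v. norm (F u - F v) \<le> L * norm (u - v)"
    and I: "is_interval I" "t0 \<in> I" "t \<in> I"
    and p: "\<And>s. s \<in> I \<Longrightarrow> (p has_vector_derivative F (p s)) (at s)"
    and q: "\<And>s. s \<in> I \<Longrightarrow> (q has_vector_derivative F (q s)) (at s)"
    and init: "p t0 = q t0"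
  shows "p t = q t"
proof (cases "t0 \<le> t")
  case True
  have "s \<in> I" if "t0 \<le> s" "s \<le> t" for s using I that unfolding is_interval_1 by blast
  thus ?thesis
    by (intro lipschitz_ode_unique_forward[where F=F and L=L and p=p and q=q, OF L _ _ init True] p q)
next
  case False
  have reflected: "((\<lambda>s. r (- s)) has_vector_derivative - F (r (- s))) (at s)"
    if "- s \<in> I" "\<And>s. s \<in> I \<Longrightarrow> (r has_vector_derivative F (r s)) (at s)" for r s
    by (rule has_vector_derivative_reflect) (use that in auto)
  have "(\<lambda>s. p (- s)) (- t) = (\<lambda>s. q (- s)) (- t)"
  proof (rule lipschitz_ode_unique_forward[where F="\<lambda>u. - F u" and L=L and ?t0.0="- t0"
        and p="\<lambda>s. p (- s)" and q="\<lambda>s. q (- s)"])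
    show "norm (- F u - - F v) \<le> L * norm (u - v)" for u v
      using L[of u v] by (simp add: norm_minus_commute)
    fix s assume "- t0 \<le> s" "s \<le> - t"
    hence "t \<le> - s" "- s \<le> t0" by linarith+
    hence "- s \<in> I" using I unfolding is_interval_1 by blast
    thus "((\<lambda>s. p (- s)) has_vector_derivative - F (p (- s))) (at s)"
      "((\<lambda>s. q (- s)) has_vector_derivative - F (q (- s))) (at s)"
      using reflected p q by auto
  qed (use False init in auto)
  thus ?thesis by simp
qed


section \<open>First integral, uniqueness and existence\<close>

text \<open>
  The integrating factor of the system: \<open>mu' / mu = 1 / y - 2 / y\<^sup>2\<close>, which makes
  \<open>cos \<theta> / mu y\<close> constant along solutions.
\<close>

definition mu :: "real \<Rightarrow> real" where "mu y = y * exp (2 / y)"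

lemma mu_deriv: "y > 0 \<Longrightarrow> (mu has_real_derivative exp (2 / y) * (1 - 2 / y)) (at y)"
  unfolding mu_def by (auto intro!: derivative_eq_intros simp: field_simps)

lemma mu_pos: "y > 0 \<Longrightarrow> mu y > 0"
  by (simp add: mu_def)

lemma isCont_mu: "y > 0 \<Longrightarrow> isCont mu y"
  by (rule DERIV_isCont[OF mu_deriv])

lemma mu_strict_antimono:
  assumes "0 < a" "a < b" "b \<le> 2"
  shows "mu b < mu a"
proof (rule DERIV_neg_imp_decreasing_open[OF assms(2)])
  show "continuous_on {a..b} mu"
    by (intro continuous_at_imp_continuous_on ballI isCont_mu) (use assms in auto)
  fix t assume "a < t" "t < b"
  hence "t > 0" "exp (2 / t) * (1 - 2 / t) < 0" using assms by (auto simp: mult_less_0_iff)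
  thus "\<exists>y. (mu has_real_derivative y) (at t) \<and> y < 0" using mu_deriv by blast
qed

lemma mu_strict_mono:
  assumes "2 \<le> a" "a < b"
  shows "mu a < mu b"
proof (rule DERIV_pos_imp_increasing_open[OF assms(2)])
  show "continuous_on {a..b} mu"
    by (intro continuous_at_imp_continuous_on ballI isCont_mu) (use assms in auto)
  fix t assume "a < t" "t < b"
  hence "t > 0" "exp (2 / t) * (1 - 2 / t) > 0" using assms by auto
  thus "\<exists>y. (mu has_real_derivative y) (at t) \<and> y > 0" using mu_deriv by blast
qed

text \<open>
  The strict minimum of \<open>mu\<close> at \<open>2\<close> is the reason for the special role of the plane at height \<open>2\<close>.
\<close>

lemma mu_ge_2: "y > 0 \<Longrightarrow> mu 2 \<le> mu y" and mu_gt_2: "y > 0 \<Longrightarrow> y \<noteq> 2 \<Longrightarrow> mu 2 < mu y"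
  using mu_strict_antimono[of y 2] mu_strict_mono[of 2 y] by (cases y "2::real" rule: linorder_cases; simp)+

lemma mu_ge: "y > 0 \<Longrightarrow> y \<le> mu y"
  by (simp add: mu_def mult_le_cancel_left1)

text \<open>
  In particular \<open>mu y\<close> tends to infinity as \<open>y\<close> tends to \<open>0\<close>.
\<close>

lemma mu_ge_inverse: "y > 0 \<Longrightarrow> 2 / y \<le> mu y"
proof -
  assume y: "y > 0"
  have "1 + 2 / y + (2 / y)\<^sup>2 / 2 \<le> exp (2 / y)" using exp_lower_Taylor_quadratic[of "2 / y"] y by simp
  hence "y * (1 + 2 / y + (2 / y)\<^sup>2 / 2) \<le> mu y" unfolding mu_def using y by (intro mult_left_mono) auto
  moreover have "y * (1 + 2 / y + (2 / y)\<^sup>2 / 2) = y + 2 + 2 / y"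
    using y by (simp add: field_simps power2_eq_square)
  ultimately show ?thesis using y by linarith
qed

lemma mu_le: "y \<ge> 2 \<Longrightarrow> mu y \<le> exp 1 * y"
  by (simp add: mu_def)

lemma reaper_curve_first_integral:
  assumes curve: "reaper_curve I x y \<theta>" and I: "is_interval I" "s \<in> I" "t \<in> I"
  shows "cos (\<theta> s) * mu (y t) = cos (\<theta> t) * mu (y s)"
proof -
  have d: "((\<lambda>s. cos (\<theta> s) / mu (y s)) has_field_derivative 0) (at r within I)" if r: "r \<in> I" for r
  proof -
    note d = reaper_curveD[OF curve r]
    have m: "((\<lambda>s. mu (y s)) has_real_derivative exp (2 / y r) * (1 - 2 / y r) * (y r * sin (\<theta> r))) (at r)"
      by (rule DERIV_chain2[OF mu_deriv d(3)]) (rule d)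
    have "((\<lambda>s. cos (\<theta> s) / mu (y s)) has_real_derivative
       (- sin (\<theta> r) * (cos (\<theta> r) * (2 / y r - 1)) * mu (y r)
         - cos (\<theta> r) * (exp (2 / y r) * (1 - 2 / y r) * (y r * sin (\<theta> r)))) / (mu (y r) * mu (y r))) (at r)"
      by (rule DERIV_divide[OF _ m]) (use d mu_pos[of "y r"] in \<open>auto intro!: derivative_eq_intros\<close>)
    moreover have "- sin (\<theta> r) * (cos (\<theta> r) * (2 / y r - 1)) * mu (y r)
         - cos (\<theta> r) * (exp (2 / y r) * (1 - 2 / y r) * (y r * sin (\<theta> r))) = 0"
      by (simp add: mu_def algebra_simps)
    ultimately show ?thesis by (simp add: has_field_derivative_at_within)
  qed
  have "convex I" using I(1) by (simp add: is_interval_convex)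
  from has_field_derivative_zero_constant[OF this d] obtain c where "\<And>s. s \<in> I \<Longrightarrow> cos (\<theta> s) / mu (y s) = c" by blast
  from this[OF I(2)] this[OF I(3)] show ?thesis
    using mu_pos[OF reaper_curveD(1)[OF curve I(2)]] mu_pos[OF reaper_curveD(1)[OF curve I(3)]]
    by (simp add: field_simps)
qed

text \<open>
  The system for \<open>(ln y, \<theta>)\<close> with \<open>1 / y = exp (- ln y)\<close> kept constant below the height \<open>exp m\<close>. The
  truncation makes the field globally Lipschitz, and it agrees with the original field at all heights
  at least \<open>exp m\<close>.
\<close>

definition trunc_field :: "real \<Rightarrow> real \<times> real \<Rightarrow> real \<times> real" where
  "trunc_field m p = (sin (snd p), cos (snd p) * (2 * exp (- max (fst p) m) - 1))"

lemma trunc_field_lipschitz: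
  "\<exists>L\<ge>0. \<forall>p q. norm (trunc_field m p - trunc_field m q) \<le> L * norm (p - q)"
proof -
  define M where "M = 2 * exp (- m) + 1"
  have M: "M > 0" by (simp add: M_def add_pos_pos)
  have sin: "\<bar>sin a - sin b\<bar> \<le> \<bar>a - b\<bar>" for a b :: real
    using field_differentiable_bound[of UNIV sin cos 1 a b] by (auto intro!: derivative_eq_intros)
  have cos: "\<bar>cos a - cos b\<bar> \<le> \<bar>a - b\<bar>" for a b :: real
    using field_differentiable_bound[of UNIV cos "\<lambda>x. - sin x" 1 a b] by (auto intro!: derivative_eq_intros)
  have exp: "\<bar>exp (- max a m) - exp (- max b m)\<bar> \<le> exp (- m) * \<bar>a - b\<bar>" for a b
  proof -
    have d: "((\<lambda>s. exp (- s)) has_real_derivative - exp (- s)) (at s within {m..})" for s :: real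
      by (auto intro!: derivative_eq_intros)
    have "norm (exp (- max a m) - exp (- max b m)) \<le> exp (- m) * norm (max a m - max b m)"
      by (rule field_differentiable_bound[OF _ d]) auto
    hence "\<bar>exp (- max a m) - exp (- max b m)\<bar> \<le> exp (- m) * \<bar>max a m - max b m\<bar>" by simp
    also have "\<dots> \<le> exp (- m) * \<bar>a - b\<bar>" by (intro mult_left_mono) auto
    finally show ?thesis .
  qed
  have "norm (trunc_field m (a, c) - trunc_field m (b, d)) \<le> (1 + M + M) * norm ((a, c) - (b, d))" for a b c d
  proof -
    define u w where "u = 2 * exp (- max a m) - 1" and "w = 2 * exp (- max b m) - 1"
    have u: "\<bar>u\<bar> \<le> M"
    proof -
      have "exp (- max a m) \<le> exp (- m)" by simp
      thus ?thesis using exp_gt_zero[of "- max a m"] unfolding u_def M_def abs_le_iff by linarith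
    qed
    have uw: "\<bar>u - w\<bar> \<le> M * \<bar>a - b\<bar>"
    proof -
      have "u - w = 2 * (exp (- max a m) - exp (- max b m))" by (simp add: u_def w_def)
      hence "\<bar>u - w\<bar> = 2 * \<bar>exp (- max a m) - exp (- max b m)\<bar>" by (simp only: abs_mult abs_numeral)
      also have "\<dots> \<le> 2 * (exp (- m) * \<bar>a - b\<bar>)" by (intro mult_left_mono exp) auto
      also have "\<dots> \<le> M * \<bar>a - b\<bar>" by (simp add: M_def algebra_simps)
      finally show ?thesis .
    qed
    have n: "\<bar>a - b\<bar> \<le> norm ((a, c) - (b, d))" "\<bar>c - d\<bar> \<le> norm ((a, c) - (b, d))"
      using norm_fst_le[of "a - b" "c - d"] norm_snd_le[of "c - d" "a - b"] by auto
    have "norm (trunc_field m (a, c) - trunc_field m (b, d)) \<le> \<bar>sin c - sin d\<bar> + \<bar>cos c * u - cos d * w\<bar>"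
      unfolding trunc_field_def u_def w_def by simp (metis norm_Pair_le real_norm_def)
    also have "\<bar>cos c * u - cos d * w\<bar> = \<bar>(cos c - cos d) * u + cos d * (u - w)\<bar>"
      by (simp add: algebra_simps)
    also have "\<dots> \<le> \<bar>cos c - cos d\<bar> * \<bar>u\<bar> + \<bar>cos d\<bar> * \<bar>u - w\<bar>"
      by (rule order_trans[OF abs_triangle_ineq]) (simp add: abs_mult)
    also have "\<dots> \<le> \<bar>c - d\<bar> * M + 1 * (M * \<bar>a - b\<bar>)"
      by (intro add_mono mult_mono cos u uw) auto
    also have "\<bar>sin c - sin d\<bar> + (\<bar>c - d\<bar> * M + 1 * (M * \<bar>a - b\<bar>))
        \<le> norm ((a, c) - (b, d)) + (norm ((a, c) - (b, d)) * M + 1 * (M * norm ((a, c) - (b, d))))"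
      using sin[of c d] n M by (intro add_mono mult_mono) auto
    finally show ?thesis by (simp add: algebra_simps)
  qed
  hence "\<forall>p q. norm (trunc_field m p - trunc_field m q) \<le> (1 + M + M) * norm (p - q)"
    by (metis surj_pair)
  thus ?thesis using M by (intro exI[of _ "1 + M + M"]) simp
qed

lemma reaper_curve_trunc_field:
  assumes "reaper_curve I x y \<theta>" "s \<in> I" "y s \<ge> c" "c > 0"
  shows "((\<lambda>s. (ln (y s), \<theta> s)) has_vector_derivative trunc_field (ln c) (ln (y s), \<theta> s)) (at s)"
proof -
  note d = reaper_curveD[OF assms(1,2)]
  have "max (ln (y s)) (ln c) = ln (y s)" using assms d by simp
  hence e: "exp (- max (ln (y s)) (ln c)) = 1 / y s" using d(1) by (simp add: exp_minus field_simps)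
  have "((\<lambda>s. ln (y s)) has_real_derivative sin (\<theta> s)) (at s)"
    using d(1) by (auto intro!: derivative_eq_intros d(3))
  thus ?thesis unfolding trunc_field_def fst_conv snd_conv e
    using d(4) by (intro has_vector_derivative_Pair) (auto simp: has_real_derivative_iff_has_vector_derivative)
qed

theorem reaper_curve_unique:
  assumes a: "reaper_curve I x1 y1 \<theta>1" and b: "reaper_curve I x2 y2 \<theta>2"
    and I: "is_interval I" "s0 \<in> I" "s \<in> I"
    and lower: "c > 0" "\<And>s. s \<in> I \<Longrightarrow> y1 s \<ge> c" "\<And>s. s \<in> I \<Longrightarrow> y2 s \<ge> c"
    and init: "y1 s0 = y2 s0" "\<theta>1 s0 = \<theta>2 s0"
  shows "y1 s = y2 s" "\<theta>1 s = \<theta>2 s" "x1 s - x2 s = x1 s0 - x2 s0"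
proof -
  obtain L where L: "\<And>p q. norm (trunc_field (ln c) p - trunc_field (ln c) q) \<le> L * norm (p - q)"
    using trunc_field_lipschitz by blast
  have *: "(ln (y1 s), \<theta>1 s) = (ln (y2 s), \<theta>2 s)" if "s \<in> I" for s
    by (rule lipschitz_ode_unique[where F="trunc_field (ln c)" and p="\<lambda>s. (ln (y1 s), \<theta>1 s)"
          and q="\<lambda>s. (ln (y2 s), \<theta>2 s)", OF L I(1,2) that])
       (auto intro!: reaper_curve_trunc_field[OF a] reaper_curve_trunc_field[OF b] simp: lower init)
  have eq: "y1 s = y2 s \<and> \<theta>1 s = \<theta>2 s" if "s \<in> I" for s
    using *[OF that] reaper_curveD(1)[OF a that] reaper_curveD(1)[OF b that] by simp
  thus "y1 s = y2 s" "\<theta>1 s = \<theta>2 s" using I by auto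
  have d: "((\<lambda>s. x1 s - x2 s) has_field_derivative 0) (at r within I)" if "r \<in> I" for r
    using DERIV_diff[OF reaper_curveD(2)[OF a that] reaper_curveD(2)[OF b that]] eq[OF that]
    by (simp add: has_field_derivative_at_within)
  have "convex I" using I(1) by (simp add: is_interval_convex)
  from has_field_derivative_zero_constant[OF this d] obtain k where k: "\<And>s. s \<in> I \<Longrightarrow> x1 s - x2 s = k" by blast
  show "x1 s - x2 s = x1 s0 - x2 s0" by (rule trans[OF k[OF I(3)] k[OF I(2), symmetric]])
qed

text \<open>
  The truncated system also has a first integral, \<open>cos \<theta> * exp (- B v)\<close>, where \<open>B\<close> is an
  antiderivative of \<open>1 - 2 * exp (- max v m)\<close>. Started at \<open>v = m\<close> with \<open>\<theta> = 0\<close> it gives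
  \<open>B v \<le> B m\<close> for all times; since \<open>B\<close> decreases strictly below \<open>m\<close>, the solution never enters the
  region where the field was changed.
\<close>

theorem reaper_curve_exists:
  assumes y0: "0 < y0" "y0 < 2"
  shows "\<exists>x y \<theta>. reaper_curve UNIV x y \<theta> \<and> x 0 = 0 \<and> y 0 = y0 \<and> \<theta> 0 = 0"
proof -
  define m where "m = ln y0"
  have em: "exp (- m) = 1 / y0" using y0 by (simp add: m_def exp_minus inverse_eq_divide)
  obtain L where "L \<ge> 0" "\<And>p q. norm (trunc_field m p - trunc_field m q) \<le> L * norm (p - q)"
    using trunc_field_lipschitz by blast
  then obtain \<phi> where \<phi>: "\<phi> 0 = (m, 0)" "\<And>t. (\<phi> has_vector_derivative trunc_field m (\<phi> t)) (at t)"
    using lipschitz_ode_solution by meson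
  define v \<theta> where "v = (\<lambda>t. fst (\<phi> t))" and "\<theta> = (\<lambda>t. snd (\<phi> t))"
  define b where "b t = 1 - 2 * exp (- max t m)" for t
  have v: "(v has_real_derivative sin (\<theta> t)) (at t)" for t
    using bounded_linear.has_vector_derivative[OF bounded_linear_fst \<phi>(2)[of t]]
    by (simp add: v_def \<theta>_def trunc_field_def has_real_derivative_iff_has_vector_derivative)
  have \<theta>: "(\<theta> has_real_derivative - (cos (\<theta> t) * b (v t))) (at t)" for t
    using bounded_linear.has_vector_derivative[OF bounded_linear_snd \<phi>(2)[of t]]
    by (simp add: v_def \<theta>_def b_def trunc_field_def has_real_derivative_iff_has_vector_derivative algebra_simps)
  have "continuous_on UNIV b" unfolding b_def by (intro continuous_intros)
  then obtain B where B: "\<And>t. (B has_real_derivative b t) (at t)"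
    using continuous_has_antiderivative[of b] by (auto simp: has_real_derivative_iff_has_vector_derivative)
  have "((\<lambda>t. cos (\<theta> t) * exp (- B (v t))) has_real_derivative 0) (at t)" for t
  proof -
    have "((\<lambda>t. B (v t)) has_real_derivative b (v t) * sin (\<theta> t)) (at t)"
      by (rule DERIV_chain2[OF B v])
    thus ?thesis by (auto intro!: derivative_eq_intros \<theta> simp: algebra_simps)
  qed
  hence "cos (\<theta> t) * exp (- B (v t)) = cos (\<theta> 0) * exp (- B (v 0))" for t
    using DERIV_isconst_all[of "\<lambda>t. cos (\<theta> t) * exp (- B (v t))"] by blast
  hence "cos (\<theta> t) * exp (- B (v t)) = exp (- B m)" for t
    using \<phi>(1) by (simp add: v_def \<theta>_def)
  hence "exp (- B m) \<le> exp (- B (v t))" for t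
    by (metis cos_le_one exp_ge_zero mult.left_neutral mult_right_mono)
  hence Bv: "B (v t) \<le> B m" for t by simp
  have vm: "v t \<ge> m" for t
  proof (rule ccontr)
    assume "\<not> v t \<ge> m"
    hence lt: "v t < m" by simp
    have neg: "b s < 0" if "s \<le> m" for s
      using that y0 by (simp add: b_def em max_def)
    have "B m < B (v t)"
      by (rule DERIV_neg_imp_decreasing[OF lt]) (use B neg in blast)
    thus False using Bv[of t] by simp
  qed
  define y where "y t = exp (v t)" for t
  have ypos: "y t > 0" for t by (simp add: y_def)
  have y: "(y has_real_derivative y t * sin (\<theta> t)) (at t)" for t
    unfolding y_def by (auto intro!: derivative_eq_intros v)
  have b: "- b (v t) = 2 / y t - 1" for t
    using vm[of t] by (simp add: b_def y_def max_def exp_minus inverse_eq_divide)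
  have \<theta>': "(\<theta> has_real_derivative cos (\<theta> t) * (2 / y t - 1)) (at t)" for t
    using \<theta>[of t] unfolding b[symmetric] by simp
  have "continuous_on UNIV y" "continuous_on UNIV \<theta>"
    by (intro continuous_at_imp_continuous_on ballI DERIV_isCont[OF y] DERIV_isCont[OF \<theta>'])+
  hence "continuous_on UNIV (\<lambda>t. y t * cos (\<theta> t))" by (intro continuous_intros)
  from continuous_has_antiderivative[OF this, folded has_real_derivative_iff_has_vector_derivative]
  obtain x where x: "x 0 = 0" "\<And>t. (x has_real_derivative y t * cos (\<theta> t)) (at t)" by blast
  have "reaper_curve UNIV x y \<theta>" unfolding reaper_curve_def using x(2) y \<theta>' ypos by blast
  moreover have "y 0 = y0" "\<theta> 0 = 0" using \<phi>(1) y0 by (auto simp: y_def v_def \<theta>_def m_def)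
  ultimately show ?thesis using x(1) by blast
qed


section \<open>The oscillating solutions\<close>

lemma DERIV_reflect:
  "(f has_real_derivative D) (at (c - s)) \<Longrightarrow> ((\<lambda>s. f (c - s)) has_real_derivative - D) (at s)"
proof -
  assume f: "(f has_real_derivative D) (at (c - s))"
  have "((\<lambda>s. c - s) has_real_derivative - 1) (at s)" by (auto intro!: derivative_eq_intros)
  from DERIV_chain2[OF f this] show ?thesis by simp
qed

lemma DERIV_translate:
  "(f has_real_derivative D) (at (s + c)) \<Longrightarrow> ((\<lambda>s. f (s + c)) has_real_derivative D) (at s)"
  by (simp add: DERIV_shift)

lemma reaper_curve_translate:
  assumes "reaper_curve UNIV x y \<theta>"
  shows "reaper_curve UNIV (\<lambda>s. x (s + c) + a) (\<lambda>s. y (s + c)) (\<lambda>s. \<theta> (s + c))"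
  unfolding reaper_curve_def
proof (intro ballI conjI)
  fix s
  note d = reaper_curveD[OF assms UNIV_I, of "s + c"]
  show "y (s + c) > 0" by (rule d)
  show "((\<lambda>s. x (s + c) + a) has_real_derivative y (s + c) * cos (\<theta> (s + c))) (at s)"
    using DERIV_add[OF DERIV_translate[OF d(2)] DERIV_const[of a]] by simp
  show "((\<lambda>s. y (s + c)) has_real_derivative y (s + c) * sin (\<theta> (s + c))) (at s)"
    by (rule DERIV_translate[OF d(3)])
  show "((\<lambda>s. \<theta> (s + c)) has_real_derivative cos (\<theta> (s + c)) * (2 / y (s + c) - 1)) (at s)"
    by (rule DERIV_translate[OF d(4)])
qed

lemma reaper_curve_reflect:
  assumes "reaper_curve UNIV x y \<theta>"
  shows "reaper_curve UNIV (\<lambda>s. - x (c - s)) (\<lambda>s. y (c - s)) (\<lambda>s. - \<theta> (c - s))"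
  unfolding reaper_curve_def
proof (intro ballI conjI)
  fix s
  note d = reaper_curveD[OF assms UNIV_I, of "c - s"]
  show "y (c - s) > 0" by (rule d)
  show "((\<lambda>s. - x (c - s)) has_real_derivative y (c - s) * cos (- \<theta> (c - s))) (at s)"
    using DERIV_minus[OF DERIV_reflect[OF d(2)]] by simp
  show "((\<lambda>s. y (c - s)) has_real_derivative y (c - s) * sin (- \<theta> (c - s))) (at s)"
    using DERIV_reflect[OF d(3)] by simp
  show "((\<lambda>s. - \<theta> (c - s)) has_real_derivative cos (- \<theta> (c - s)) * (2 / y (c - s) - 1)) (at s)"
    using DERIV_minus[OF DERIV_reflect[OF d(4)]] by simp
qed

text \<open>
  The solution as a graph \<open>y = f x\<close> over the horizontal axis, with slope \<open>p = f'\<close>, minimum \<open>y0\<close> at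
  \<open>0\<close> and half period \<open>T\<close>. The third equation is the first integral, because \<open>1 + p\<^sup>2 = 1 / (cos \<theta>)\<^sup>2\<close>.
\<close>

definition reaper_profile :: "real \<Rightarrow> (real \<Rightarrow> real) \<Rightarrow> (real \<Rightarrow> real) \<Rightarrow> real \<Rightarrow> bool" where
  "reaper_profile y0 f p T \<longleftrightarrow>
     (\<forall>a. (f has_real_derivative p a) (at a) \<and>
          (p has_real_derivative (1 + (p a)\<^sup>2) * (2 / f a - 1) / f a) (at a) \<and>
          (1 + (p a)\<^sup>2) * (mu (f a))\<^sup>2 = (mu y0)\<^sup>2 \<and>
          y0 \<le> f a \<and> f (- a) = f a \<and> f (a + 2 * T) = f a) \<and>
     f 0 = y0 \<and> T > 0 \<and> p T = 0 \<and> (\<forall>a. 0 < a \<longrightarrow> a < T \<longrightarrow> p a > 0)"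

locale standard_orbit =
  fixes y0 :: real and x y \<theta> :: "real \<Rightarrow> real"
  assumes y0: "0 < y0" "y0 < 2"
    and curve: "reaper_curve UNIV x y \<theta>"
    and init: "x 0 = 0" "y 0 = y0" "\<theta> 0 = 0"
begin

lemmas deriv = reaper_curveD[OF curve UNIV_I]

lemma mu_y0: "mu 2 > 0" "mu y0 > mu 2"
  using mu_pos[of 2] mu_strict_antimono[of y0 2] y0 by auto

lemma cos_eq: "cos (\<theta> s) * mu y0 = mu (y s)"
  using reaper_curve_first_integral[OF curve is_interval_univ UNIV_I UNIV_I, of s 0] init by simp

lemma y_ge: "y0 \<le> y s"
proof (rule ccontr)
  assume "\<not> y0 \<le> y s"
  hence "mu y0 < mu (y s)" using mu_strict_antimono[of "y s" y0] deriv(1) y0 by simp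
  moreover have "cos (\<theta> s) * mu y0 \<le> 1 * mu y0" using mu_y0 by (intro mult_right_mono) auto
  ultimately show False using cos_eq[of s] by simp
qed

lemma cos_ge: "mu 2 / mu y0 \<le> cos (\<theta> s)"
  using cos_eq[of s] mu_ge_2[OF deriv(1), of s] mu_y0 by (simp add: divide_le_eq)

lemma cos_pos: "cos (\<theta> s) > 0"
  using cos_ge[of s] mu_y0 by (meson divide_pos_pos less_le_trans less_trans)

text \<open>
  The angle starts at \<open>0\<close> and \<open>cos \<theta>\<close> never vanishes, so by connectedness it cannot reach
  \<open>\<plusminus> pi / 2\<close>: the curve is a graph.
\<close>

lemma theta_bounds: "- (pi / 2) < \<theta> s" "\<theta> s < pi / 2"
proof -
  have "connected (range \<theta>)"
    by (intro connected_continuous_image continuous_at_imp_continuous_on ballI DERIV_isCont[OF deriv(4)])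
       (auto simp: connected_UNIV)
  hence int: "is_interval (range \<theta>)" by (simp add: is_interval_connected_1)
  have zero: "0 \<in> range \<theta>" using init by (metis rangeI)
  have no: "pi / 2 \<notin> range \<theta>" "- (pi / 2) \<notin> range \<theta>"
    using cos_pos by (metis cos_minus cos_pi_half image_iff less_irrefl)+
  show "\<theta> s < pi / 2"
  proof (rule ccontr)
    assume "\<not> \<theta> s < pi / 2"
    hence "pi / 2 \<in> range \<theta>" using int zero unfolding is_interval_1
      by (metis linorder_not_less pi_half_ge_zero rangeI)
    thus False using no by simp
  qed
  show "- (pi / 2) < \<theta> s"
  proof (rule ccontr)
    assume "\<not> - (pi / 2) < \<theta> s"
    hence "\<theta> s \<le> - (pi / 2)" "- (pi / 2) \<le> 0" using pi_half_ge_zero by linarith+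
    hence "- (pi / 2) \<in> range \<theta>" using int zero unfolding is_interval_1 by (metis rangeI)
    thus False using no by simp
  qed
qed

text \<open>
  Reflecting the solution in the vertical line through a point with horizontal tangent gives a solution
  with the same data at that point.
\<close>

lemma reflect:
  assumes "\<theta> c = 0"
  shows "y (2 * c - s) = y s" "\<theta> (2 * c - s) = - \<theta> s" "x (2 * c - s) = 2 * x c - x s"
proof -
  note u = reaper_curve_unique[OF reaper_curve_reflect[OF curve, of "2 * c"] curve is_interval_univ
      UNIV_I UNIV_I y0(1) y_ge y_ge, of c s]
  show "y (2 * c - s) = y s" "\<theta> (2 * c - s) = - \<theta> s" "x (2 * c - s) = 2 * x c - x s"
    using u assms by auto
qed

lemma odd_even: "y (- s) = y s" "\<theta> (- s) = - \<theta> s" "x (- s) = - x s"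
  using reflect[of 0 s] init by auto

text \<open>
  Otherwise \<open>y\<close> would increase forever. If it stayed below \<open>2\<close>, then \<open>\<theta>\<close> would not decrease and \<open>y\<close>
  would grow at least linearly; once \<open>y\<close> is beyond \<open>2\<close>, \<open>\<theta>\<close> decreases at least linearly because \<open>cos \<theta>\<close>
  is bounded below by \<open>mu 2 / mu y0\<close>. Both contradict the known bounds.
\<close>

lemma theta_nonpos_somewhere: "\<exists>s>0. \<theta> s \<le> 0"
proof (rule ccontr)
  assume "\<not> ?thesis"
  hence pos: "\<theta> s > 0" if "s > 0" for s using that by force
  have sin_pos: "sin (\<theta> s) > 0" if "s > 0" for s
    using pos[OF that] theta_bounds(2)[of s] by (intro sin_gt_zero) auto
  have y_mono: "y s < y t" if "0 < s" "s < t" for s t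
    by (rule DERIV_pos_imp_increasing[OF that(2)])
       (use that sin_pos deriv(1,3) in \<open>meson less_le_trans mult_pos_pos\<close>)
  show False
  proof (cases "\<exists>s>0. y s \<ge> 2")
    case True
    then obtain s2 where s2: "s2 > 0" "y s2 \<ge> 2" by blast
    define b where "b = y (s2 + 1)"
    have b: "b > 2" using y_mono[of s2 "s2 + 1"] s2 by (simp add: b_def)
    define \<delta> where "\<delta> = mu 2 / mu y0 * (1 - 2 / b)"
    have \<delta>: "\<delta> > 0" using b mu_y0 by (auto simp: \<delta>_def intro!: mult_pos_pos divide_pos_pos)
    \<comment> \<open>long enough for the angle to drop by \<open>pi\<close>, the width of its range\<close>
    define t where "t = s2 + 1 + pi / \<delta>"
    have t: "s2 + 1 < t" using \<delta> by (simp add: t_def)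
    have "\<theta> t + \<delta> * t \<le> \<theta> (s2 + 1) + \<delta> * (s2 + 1)"
    proof (rule DERIV_nonpos_imp_nonincreasing[where f="\<lambda>s. \<theta> s + \<delta> * s"])
      fix s assume s: "s2 + 1 \<le> s" "s \<le> t"
      have "b \<le> y s" using y_mono[of "s2 + 1" s] s s2 by (cases "s = s2 + 1") (auto simp: b_def)
      hence "1 - 2 / b \<le> 1 - 2 / y s" using b by (simp add: frac_le)
      moreover have "1 - 2 / b \<ge> 0" using b by simp
      ultimately have "\<delta> \<le> cos (\<theta> s) * (1 - 2 / y s)"
        unfolding \<delta>_def using cos_ge[of s] cos_pos[of s] by (intro mult_mono) auto
      hence "cos (\<theta> s) * (2 / y s - 1) + \<delta> \<le> 0" by (simp add: algebra_simps)
      moreover have "((\<lambda>s. \<theta> s + \<delta> * s) has_real_derivative cos (\<theta> s) * (2 / y s - 1) + \<delta>) (at s)"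
        using deriv(4)[of s] by (auto intro!: derivative_eq_intros)
      ultimately show "\<exists>d. ((\<lambda>s. \<theta> s + \<delta> * s) has_real_derivative d) (at s) \<and> d \<le> 0" by blast
    qed (use t in simp)
    moreover have "\<delta> * t = \<delta> * (s2 + 1) + pi" using \<delta> by (simp add: t_def distrib_left)
    ultimately have "\<theta> t + pi \<le> \<theta> (s2 + 1)" by linarith
    thus False using theta_bounds[of t] theta_bounds[of "s2 + 1"] by linarith
  next
    case False
    hence lt: "y s < 2" if "s > 0" for s using that by force
    have \<theta>_mono: "\<theta> 1 \<le> \<theta> s" if "1 \<le> s" for s
    proof (rule DERIV_nonneg_imp_nondecreasing[OF that])
      fix r assume r: "1 \<le> r" "r \<le> s"
      have "cos (\<theta> r) * (2 / y r - 1) \<ge> 0"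
        using cos_pos[of r] lt[of r] deriv(1)[of r] r by (intro mult_nonneg_nonneg) auto
      thus "\<exists>d. (\<theta> has_real_derivative d) (at r) \<and> 0 \<le> d" using deriv(4) by blast
    qed
    define \<delta> where "\<delta> = y0 * sin (\<theta> 1)"
    have \<delta>: "\<delta> > 0" using y0 sin_pos[of 1] by (simp add: \<delta>_def)
    \<comment> \<open>long enough for the height to rise by \<open>2\<close>\<close>
    define t where "t = 1 + 2 / \<delta>"
    have "y 1 - \<delta> * 1 \<le> y t - \<delta> * t"
    proof (rule DERIV_nonneg_imp_nondecreasing[where f="\<lambda>s. y s - \<delta> * s"])
      fix s assume s: "1 \<le> s" "s \<le> t"
      have "sin (\<theta> 1) \<le> sin (\<theta> s)"
        using \<theta>_mono[OF s(1)] theta_bounds[of 1] theta_bounds[of s] by (intro sin_monotone_2pi_le) auto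
      hence "\<delta> \<le> y s * sin (\<theta> s)" unfolding \<delta>_def
        using y_ge[of s] y0 sin_pos[of 1] by (intro mult_mono) auto
      moreover have "((\<lambda>s. y s - \<delta> * s) has_real_derivative y s * sin (\<theta> s) - \<delta>) (at s)"
        using deriv(3)[of s] by (auto intro!: derivative_eq_intros)
      ultimately show "\<exists>d. ((\<lambda>s. y s - \<delta> * s) has_real_derivative d) (at s) \<and> 0 \<le> d"
        by (intro exI conjI) auto
    qed (use \<delta> in \<open>simp add: t_def\<close>)
    moreover have "\<delta> * t = \<delta> * 1 + 2" using \<delta> by (simp add: t_def distrib_left)
    ultimately have "y 1 + 2 \<le> y t" by linarith
    moreover have "t > 0" using \<delta> by (simp add: t_def add_pos_pos)
    ultimately show False using lt[of t] deriv(1)[of 1] by simp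
  qed
qed

lemma first_turn: "\<exists>s1>0. \<theta> s1 = 0 \<and> (\<forall>s. 0 < s \<longrightarrow> s < s1 \<longrightarrow> \<theta> s > 0)"
proof -
  have "cos (\<theta> 0) * (2 / y 0 - 1) > 0" using init y0 by simp
  from DERIV_pos_inc_right[OF deriv(4)[of 0] this]
  obtain \<delta> where \<delta>: "\<delta> > 0" "\<And>h. 0 < h \<Longrightarrow> h < \<delta> \<Longrightarrow> \<theta> h > 0" using init by auto
  have cont: "continuous_on A \<theta>" for A
    by (intro continuous_at_imp_continuous_on ballI DERIV_isCont[OF deriv(4)])
  \<comment> \<open>starting at \<open>\<delta> / 2\<close> excludes the zero of \<open>\<theta>\<close> at \<open>0\<close>\<close>
  define Z where "Z = {s. \<delta> / 2 \<le> s \<and> \<theta> s \<le> 0}"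
  have "closed Z" unfolding Z_def
    by (intro closed_Collect_conj closed_Collect_le continuous_intros cont)
  moreover have "Z \<noteq> {}"
  proof -
    obtain s where "s > 0" "\<theta> s \<le> 0" using theta_nonpos_somewhere by blast
    hence "s \<in> Z" using \<delta>(2)[of s] by (force simp: Z_def)
    thus ?thesis by blast
  qed
  moreover have bdd: "bdd_below Z" unfolding bdd_below_def Z_def by (intro exI[of _ "\<delta> / 2"]) auto
  ultimately have Inf: "Inf Z \<in> Z" by (intro closed_contains_Inf)
  define s1 where "s1 = Inf Z"
  have s1: "\<delta> / 2 \<le> s1" "\<theta> s1 \<le> 0" using Inf by (auto simp: s1_def Z_def)
  have before: "\<theta> s > 0" if "0 < s" "s < s1" for s
  proof (cases "s < \<delta>")
    case False
    thus ?thesis using that cInf_lower[OF _ bdd, of s] \<delta>(1) by (force simp: s1_def Z_def)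
  qed (use \<delta> that in auto)
  have "\<theta> s1 = 0"
  proof (rule ccontr)
    assume "\<theta> s1 \<noteq> 0"
    hence neg: "\<theta> s1 < 0" using s1 by simp
    have "\<theta> (\<delta> / 2) > 0" using \<delta> by simp
    then obtain r where r: "\<delta> / 2 \<le> r" "r \<le> s1" "\<theta> r = 0"
      using IVT2'[of \<theta> s1 0 "\<delta> / 2"] neg s1 cont by auto
    thus False using before[of r] \<delta>(1) neg by (cases "r = s1") auto
  qed
  thus ?thesis using before s1 \<delta>(1) by (intro exI[of _ s1]) auto
qed

lemma x_strict_mono:
  assumes "s < t"
  shows "x s < x t"
proof (rule DERIV_pos_imp_increasing[OF assms])
  fix r
  show "\<exists>d. (x has_real_derivative d) (at r) \<and> 0 < d"
    using deriv(1,2)[of r] cos_pos[of r] by (meson mult_pos_pos)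
qed

text \<open>
  The horizontal speed \<open>y cos \<theta>\<close> is bounded below by a positive constant, so the graph is entire.
\<close>

lemma surj_x: "\<exists>s. x s = a"
proof -
  define \<delta> where "\<delta> = y0 * (mu 2 / mu y0)"
  have \<delta>: "\<delta> > 0" using y0 mu_y0 by (auto simp: \<delta>_def intro!: mult_pos_pos divide_pos_pos)
  define t where "t = \<bar>a\<bar> / \<delta>"
  have t: "t \<ge> 0" "\<delta> * t = \<bar>a\<bar>" using \<delta> by (auto simp: t_def)
  have "x 0 - \<delta> * 0 \<le> x t - \<delta> * t"
  proof (rule DERIV_nonneg_imp_nondecreasing[where f="\<lambda>s. x s - \<delta> * s", OF t(1)])
    fix s
    have "\<delta> \<le> y s * cos (\<theta> s)" unfolding \<delta>_def
      using y_ge[of s] y0 cos_ge[of s] mu_y0 by (intro mult_mono) auto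
    moreover have "((\<lambda>s. x s - \<delta> * s) has_real_derivative y s * cos (\<theta> s) - \<delta>) (at s)"
      using deriv(2)[of s] by (auto intro!: derivative_eq_intros)
    ultimately show "\<exists>d. ((\<lambda>s. x s - \<delta> * s) has_real_derivative d) (at s) \<and> 0 \<le> d"
      by (intro exI conjI) auto
  qed
  hence "\<bar>a\<bar> \<le> x t" using init t by simp
  moreover have "x (- t) = - x t" by (rule odd_even)
  moreover have "continuous_on {- t..t} x"
    by (intro continuous_at_imp_continuous_on ballI DERIV_isCont[OF deriv(2)])
  ultimately show ?thesis using IVT'[of x "- t" a t] t by force
qed

definition arc :: "real \<Rightarrow> real" where "arc = inv x"

lemma x_arc: "x (arc a) = a"
  unfolding arc_def using surj_x[of a] by (metis f_inv_into_f rangeI)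

lemma inj_x: "inj x"
  by (rule linorder_injI) (use x_strict_mono in force)

lemma arc_x: "arc (x s) = s"
  unfolding arc_def by (rule inv_f_f[OF inj_x])

lemma arc_deriv: "(arc has_real_derivative 1 / (y (arc a) * cos (\<theta> (arc a)))) (at a)"
proof -
  have "isCont arc (x (arc a))"
    by (rule isCont_inverse_function[where d=1 and g=arc and f=x]) (simp_all add: arc_x DERIV_isCont[OF deriv(2)])
  hence "isCont arc a" by (simp add: x_arc)
  moreover have "y (arc a) * cos (\<theta> (arc a)) \<noteq> 0"
    using deriv(1)[of "arc a"] cos_pos[of "arc a"] by simp
  ultimately show ?thesis
    using DERIV_inverse_function[OF deriv(2), of arc a "a - 1" "a + 1"] x_arc
    by (simp add: inverse_eq_divide)
qed

definition f :: "real \<Rightarrow> real" where "f a = y (arc a)"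
definition p :: "real \<Rightarrow> real" where "p a = tan (\<theta> (arc a))"

lemma f_deriv: "(f has_real_derivative p a) (at a)"
  using DERIV_chain2[OF deriv(3) arc_deriv, of a] cos_pos[of "arc a"] deriv(1)[of "arc a"]
  unfolding f_def[abs_def] p_def tan_def by simp

lemma p_deriv: "(p has_real_derivative (1 + (p a)\<^sup>2) * (2 / f a - 1) / f a) (at a)"
proof -
  let ?s = "arc a"
  have c: "cos (\<theta> ?s) \<noteq> 0" using cos_pos[of ?s] by simp
  have "((\<lambda>s. tan (\<theta> s)) has_real_derivative inverse ((cos (\<theta> ?s))\<^sup>2) * (cos (\<theta> ?s) * (2 / y ?s - 1))) (at ?s)"
    by (rule DERIV_chain2[OF DERIV_tan[OF c] deriv(4)])
  from DERIV_chain2[OF this arc_deriv]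
  have "(p has_real_derivative inverse ((cos (\<theta> ?s))\<^sup>2) * (cos (\<theta> ?s) * (2 / y ?s - 1)) *
      (1 / (y ?s * cos (\<theta> ?s)))) (at a)" unfolding p_def[abs_def] .
  moreover have "inverse ((cos (\<theta> ?s))\<^sup>2) = 1 + (p a)\<^sup>2"
    using tan_sec[OF c] by (simp add: p_def power_inverse)
  ultimately show ?thesis using c by (simp add: f_def)
qed

lemma p_first_integral: "(1 + (p a)\<^sup>2) * (mu (f a))\<^sup>2 = (mu y0)\<^sup>2"
proof -
  have c: "cos (\<theta> (arc a)) \<noteq> 0" using cos_pos[of "arc a"] by simp
  have "1 + (p a)\<^sup>2 = inverse ((cos (\<theta> (arc a)))\<^sup>2)" using tan_sec[OF c] by (simp add: p_def power_inverse)
  moreover have "mu (f a) = cos (\<theta> (arc a)) * mu y0" by (simp add: f_def cos_eq)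
  ultimately show ?thesis using c by (simp add: power_mult_distrib)
qed

text \<open>
  The two reflections at the points \<open>0\<close> and \<open>s1\<close> with horizontal tangent generate the period \<open>2 * x s1\<close>.
\<close>

theorem profile: "\<exists>T. reaper_profile y0 f p T"
proof -
  obtain s1 where s1: "s1 > 0" "\<theta> s1 = 0" "\<And>s. 0 < s \<Longrightarrow> s < s1 \<Longrightarrow> \<theta> s > 0"
    using first_turn by blast
  have "arc 0 = 0" using arc_x[of 0] init by simp
  moreover have "arc (- a) = - arc a" for a using arc_x[of "- arc a"] x_arc[of a] odd_even(3)[of "arc a"] by simp
  moreover have "f (a + 2 * x s1) = f a" for a
  proof -
    have "x (2 * s1 - (- arc a)) = 2 * x s1 + a"
      unfolding reflect(3)[OF s1(2)] odd_even(3) x_arc by simp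
    hence "arc (a + 2 * x s1) = 2 * s1 - (- arc a)" by (metis add.commute arc_x)
    thus ?thesis by (simp only: f_def reflect(1)[OF s1(2)] odd_even(1))
  qed
  moreover have "p (x s1) = 0" by (simp add: p_def arc_x s1)
  moreover have "x s1 > 0" using x_strict_mono[OF s1(1)] init by simp
  moreover have "p a > 0" if "0 < a" "a < x s1" for a
  proof -
    have "0 < arc a" "arc a < s1"
      using that x_strict_mono x_arc init by (metis linorder_neqE_linordered_idom order_less_asym)+
    thus ?thesis using s1(3) theta_bounds(2) unfolding p_def by (intro tan_gt_zero) auto
  qed
  ultimately have "reaper_profile y0 f p (x s1)"
    unfolding reaper_profile_def using f_deriv p_deriv p_first_integral y_ge init odd_even
    by (simp add: f_def)
  thus ?thesis ..
qed

lemma range_cylinder: "range (cylinder x y) = range (cylinder (\<lambda>s. s) f)"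
proof -
  have "cylinder x y u = cylinder (\<lambda>s. s) f (vector [x (u $ 1), u $ 2])" for u
    by (simp add: cylinder_def f_def arc_x)
  moreover have "cylinder (\<lambda>s. s) f u = cylinder x y (vector [arc (u $ 1), u $ 2])" for u
    by (simp add: cylinder_def f_def x_arc)
  ultimately show ?thesis by (intro equalityI subsetI) (metis rangeE rangeI)+
qed

text \<open>
  The maximum of \<open>y\<close> is the other solution of \<open>mu b = mu y0\<close>, beyond \<open>2\<close>. Hence the orbit meets every height
  that the first integral allows.
\<close>

lemma y_takes_values:
  assumes "y0 \<le> b" "mu b \<le> mu y0"
  shows "\<exists>s. y s = b"
proof -
  obtain s1 where s1: "s1 > 0" "\<theta> s1 = 0" "\<And>s. 0 < s \<Longrightarrow> s < s1 \<Longrightarrow> \<theta> s > 0"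
    using first_turn by blast
  have cont: "continuous_on A y" for A
    by (intro continuous_at_imp_continuous_on ballI DERIV_isCont[OF deriv(3)])
  have "y 0 < y s1"
  proof (rule DERIV_pos_imp_increasing_open[OF s1(1) _ cont])
    fix s assume "0 < s" "s < s1"
    hence "sin (\<theta> s) > 0" using s1(3)[of s] theta_bounds(2)[of s] by (intro sin_gt_zero) auto
    thus "\<exists>d. (y has_real_derivative d) (at s) \<and> d > 0" using deriv(1,3) by (meson mult_pos_pos)
  qed
  hence gt: "y0 < y s1" by (simp add: init)
  have m: "mu (y s1) = mu y0" using cos_eq[of s1] s1 by simp
  have "y s1 \<ge> 2" using mu_strict_antimono[of y0 "y s1"] y0 gt m by force
  hence "b \<le> y s1" using mu_strict_mono[of "y s1" b] m assms(2) by force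
  thus ?thesis using IVT'[of y 0 b s1] assms(1) s1(1) cont init by force
qed

end


section \<open>Classification of the generating curves\<close>

lemma reaper_curve_subset: "reaper_curve J x y \<theta> \<Longrightarrow> I \<subseteq> J \<Longrightarrow> reaper_curve I x y \<theta>"
  by (auto simp: reaper_curve_def)

lemma reaper_curve_rotate:
  assumes "reaper_curve I x y \<theta>" "cos e = 1"
  shows "reaper_curve I x y (\<lambda>s. \<theta> s + e)"
proof -
  have [simp]: "cos e = 1" "sin e = 0" using assms(2) cos_one_sin_zero by auto
  show ?thesis
    using assms(1) unfolding reaper_curve_def cos_add sin_add
    by (auto intro: DERIV_add[where E=0, simplified] DERIV_const)
qed

lemma reaper_curve_reverse:
  assumes "reaper_curve I x y \<theta>" "cos d = -1"
  shows "reaper_curve {s. c - s \<in> I} (\<lambda>s. x (c - s)) (\<lambda>s. y (c - s)) (\<lambda>s. \<theta> (c - s) + d)"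
  unfolding reaper_curve_def
proof (intro ballI conjI)
  have [simp]: "sin d = 0" using sin_cos_squared_add[of d] unfolding assms(2) by simp
  fix s assume "s \<in> {s. c - s \<in> I}"
  hence "c - s \<in> I" by simp
  note d = reaper_curveD[OF assms(1) this]
  show "y (c - s) > 0" by (rule d)
  show "((\<lambda>s. x (c - s)) has_real_derivative y (c - s) * cos (\<theta> (c - s) + d)) (at s)"
    using DERIV_reflect[OF d(2)] by (simp add: cos_add assms(2))
  show "((\<lambda>s. y (c - s)) has_real_derivative y (c - s) * sin (\<theta> (c - s) + d)) (at s)"
    using DERIV_reflect[OF d(3)] by (simp add: sin_add assms(2))
  show "((\<lambda>s. \<theta> (c - s) + d) has_real_derivative cos (\<theta> (c - s) + d) * (2 / y (c - s) - 1)) (at s)"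
    using DERIV_add[OF DERIV_reflect[OF d(4)] DERIV_const[of d]] by (simp add: cos_add assms(2))
qed

lemma range_cylinder_reparam:
  assumes "surj \<phi>"
  shows "range (cylinder (\<lambda>s. X (\<phi> s) + a) (\<lambda>s. Y (\<phi> s))) = translate_x a (range (cylinder X Y))"
proof (intro equalityI subsetI)
  fix q assume "q \<in> range (cylinder (\<lambda>s. X (\<phi> s) + a) (\<lambda>s. Y (\<phi> s)))"
  then obtain u where "q = cylinder (\<lambda>s. X (\<phi> s) + a) (\<lambda>s. Y (\<phi> s)) u" by blast
  hence "q = cylinder X Y (vector [\<phi> (u $ 1), u $ 2]) + a *\<^sub>R axis 1 1"
    by (simp add: cylinder_def vec_eq_iff forall_3 axis_def)
  thus "q \<in> translate_x a (range (cylinder X Y))" unfolding translate_x_def by blast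
next
  fix q assume "q \<in> translate_x a (range (cylinder X Y))"
  then obtain u where q: "q = cylinder X Y u + a *\<^sub>R axis 1 1" unfolding translate_x_def by blast
  obtain s where "\<phi> s = u $ 1" using assms by (metis surjD)
  hence "q = cylinder (\<lambda>s. X (\<phi> s) + a) (\<lambda>s. Y (\<phi> s)) (vector [s, u $ 2])"
    using q by (simp add: cylinder_def vec_eq_iff forall_3 axis_def)
  thus "q \<in> range (cylinder (\<lambda>s. X (\<phi> s) + a) (\<lambda>s. Y (\<phi> s)))" by blast
qed

lemma mu_takes_values:
  assumes "mu 2 < k"
  obtains y0 where "0 < y0" "y0 < 2" "mu y0 = k"
proof -
  have k: "k > 0" using assms mu_pos[of 2] by simp
  define a where "a = min 1 (2 / k)"
  have a: "0 < a" "a \<le> 1" using k by (auto simp: a_def)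
  have "k = 2 / (2 / k)" by simp
  also have "\<dots> \<le> 2 / a" using a k by (intro divide_left_mono) (auto simp: a_def)
  also have "\<dots> \<le> mu a" by (rule mu_ge_inverse) (rule a)
  finally have "k \<le> mu a" .
  moreover have "continuous_on {a..2} mu"
    by (intro continuous_at_imp_continuous_on ballI isCont_mu) (use a in auto)
  ultimately obtain y0 where "a \<le> y0" "y0 \<le> 2" "mu y0 = k"
    using IVT2'[of mu 2 k a] assms a by auto
  thus ?thesis using that[of y0] a assms by (cases "y0 = 2") auto
qed

text \<open>
  A solution on the level of the standard orbit is a piece of it. At the parameter \<open>s0\<close> the height is attained
  by the orbit, and the first integral leaves two values of the angle modulo \<open>2 * pi\<close>, opposite
  to each other; they belong to the symmetric parameters \<open>s1\<close> and \<open>- s1\<close> of the orbit. Uniqueness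
  does the rest.
\<close>

lemma (in standard_orbit) orbit_unique:
  assumes c: "reaper_curve I x' y' \<theta>'" and I: "is_interval I" "s0 \<in> I"
    and first: "cos (\<theta>' s0) * mu y0 = mu (y' s0)"
  shows "\<exists>c a k. \<forall>s\<in>I. x' s = x (s + c) + a \<and> y' s = y (s + c) \<and> \<theta>' s = \<theta> (s + c) + 2 * pi * of_int k"
proof -
  have pos: "y' s > 0" if "s \<in> I" for s by (rule reaper_curveD[OF c that])
  have ge: "y0 \<le> y' s" if s: "s \<in> I" for s
  proof (rule ccontr)
    assume "\<not> y0 \<le> y' s"
    hence "mu y0 < mu (y' s)" using mu_strict_antimono[of "y' s" y0] pos[OF s] y0 by simp
    moreover have "cos (\<theta>' s) * mu y0 = mu (y' s)"
    proof -
      have "cos (\<theta>' s) * mu (y' s0) = cos (\<theta>' s0) * mu (y' s)"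
        by (rule reaper_curve_first_integral[OF c I(1) s I(2)])
      hence "cos (\<theta>' s0) * (cos (\<theta>' s) * mu y0) = cos (\<theta>' s0) * mu (y' s)"
        unfolding first[symmetric] by (simp add: mult_ac)
      moreover have "cos (\<theta>' s0) \<noteq> 0" using first mu_pos[OF pos[OF I(2)]] by auto
      ultimately show ?thesis by simp
    qed
    moreover have "cos (\<theta>' s) * mu y0 \<le> 1 * mu y0" using mu_y0 by (intro mult_right_mono) auto
    ultimately show False by simp
  qed
  have "mu (y' s0) \<le> mu y0"
    unfolding first[symmetric] using mu_y0 mult_right_mono[OF cos_le_one[of "\<theta>' s0"], of "mu y0"] by simp
  then obtain s1 where s1: "y s1 = y' s0" using y_takes_values ge[OF I(2)] by blast
  have "cos (\<theta>' s0) * mu y0 = cos (\<theta> s1) * mu y0" using first cos_eq[of s1] s1 by simp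
  hence "cos (\<theta>' s0) = cos (\<theta> s1)" using mu_y0 by simp
  then obtain k :: int where "\<theta>' s0 = \<theta> s1 + 2 * pi * of_int k \<or> \<theta>' s0 = - \<theta> s1 + 2 * pi * of_int k"
  proof -
    have "(sin (\<theta>' s0))\<^sup>2 = (sin (\<theta> s1))\<^sup>2" by (simp add: sin_squared_eq \<open>cos (\<theta>' s0) = cos (\<theta> s1)\<close>)
    hence "sin (\<theta>' s0) = sin (\<theta> s1) \<or> sin (\<theta>' s0) = sin (- \<theta> s1)" by (simp add: power2_eq_iff)
    thus ?thesis
      using that sin_cos_eq_iff[of "\<theta>' s0" "\<theta> s1"] sin_cos_eq_iff[of "\<theta>' s0" "- \<theta> s1"]
        \<open>cos (\<theta>' s0) = cos (\<theta> s1)\<close> by (metis cos_minus)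
  qed
  then obtain s2 where s2: "y s2 = y' s0" "\<theta>' s0 = \<theta> s2 + 2 * pi * of_int k"
    using s1 odd_even[of s1] by metis
  define c where "c = s2 - s0"
  have std: "reaper_curve I (\<lambda>s. x (s + c) + 0) (\<lambda>s. y (s + c)) (\<lambda>s. \<theta> (s + c) + 2 * pi * of_int k)"
    by (intro reaper_curve_rotate reaper_curve_subset[OF reaper_curve_translate[OF curve]]) (auto simp: cos_int_2pin)
  have "x' s = x (s + c) + (x' s0 - x (s0 + c)) \<and> y' s = y (s + c) \<and> \<theta>' s = \<theta> (s + c) + 2 * pi * of_int k"
    if "s \<in> I" for s
    using reaper_curve_unique[OF assms(1) std I that y0(1) ge y_ge] s2 by (auto simp: c_def algebra_simps)
  thus ?thesis by blast
qed

text \<open>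
  By the first integral \<open>cos \<theta>\<close> vanishes identically, so the curve is vertical and runs
  through the vertical line exponentially.
\<close>

lemma reaper_curve_extends_plane_x:
  assumes c: "reaper_curve I x y \<theta>" and I: "is_interval I" "s0 \<in> I" and cos0: "cos (\<theta> s0) = 0"
  shows "\<exists>X Y \<Theta>. (\<forall>s\<in>I. X s = x s \<and> Y s = y s \<and> \<Theta> s = \<theta> s) \<and> reaper_curve UNIV X Y \<Theta> \<and>
           range (cylinder X Y) = {p \<in> H2xR. p $ 1 = x s0}"
proof -
  note d = reaper_curveD[OF c]
  have cos: "cos (\<theta> s) = 0" if "s \<in> I" for s
    using reaper_curve_first_integral[OF c I(1) that I(2)] cos0 mu_pos[OF d(1)[OF I(2)]] by simp
  have conv: "convex I" using I(1) by (simp add: is_interval_convex)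
  have "(\<theta> has_real_derivative 0) (at s within I)" if "s \<in> I" for s
    using d(4)[OF that] cos[OF that] by (simp add: has_field_derivative_at_within)
  from has_field_derivative_zero_constant[OF conv this] have \<theta>: "\<theta> s = \<theta> s0" if "s \<in> I" for s
    using that I(2) by metis
  have "(x has_real_derivative 0) (at s within I)" if "s \<in> I" for s
    using d(2)[OF that] cos[OF that] by (simp add: has_field_derivative_at_within)
  from has_field_derivative_zero_constant[OF conv this] have x: "x s = x s0" if "s \<in> I" for s
    using that I(2) by metis
  define \<sigma> where "\<sigma> = sin (\<theta> s0)"
  have \<sigma>: "\<sigma> \<noteq> 0" using cos0 sin_zero_abs_cos_one[of "\<theta> s0"] by (auto simp: \<sigma>_def)
  have "((\<lambda>s. y s * exp (- \<sigma> * (s - s0))) has_real_derivative 0) (at s within I)" if "s \<in> I" for s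
  proof (rule has_field_derivative_at_within)
    have e: "((\<lambda>s. exp (- \<sigma> * (s - s0))) has_real_derivative - \<sigma> * exp (- \<sigma> * (s - s0))) (at s)"
      by (auto intro!: derivative_eq_intros)
    show "((\<lambda>s. y s * exp (- \<sigma> * (s - s0))) has_real_derivative 0) (at s)"
      by (rule DERIV_cong[OF DERIV_mult[OF d(3)[OF that] e]]) (simp add: \<sigma>_def \<theta>[OF that])
  qed
  from has_field_derivative_zero_constant[OF conv this]
  have e: "y s * exp (- \<sigma> * (s - s0)) = y s0 * exp (- \<sigma> * (s0 - s0))" if "s \<in> I" for s
    using that I(2) by metis
  have y: "y s = y s0 * exp (\<sigma> * (s - s0))" if "s \<in> I" for s
  proof -
    have "y s = y s * exp (- \<sigma> * (s - s0)) * exp (\<sigma> * (s - s0))"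
      by (simp add: mult.assoc flip: exp_add)
    thus ?thesis unfolding e[OF that] by simp
  qed
  define Y where "Y s = y s0 * exp (\<sigma> * (s - s0))" for s
  have Ypos: "Y s > 0" for s using d(1)[OF I(2)] by (simp add: Y_def)
  have "(Y has_real_derivative Y s * \<sigma>) (at s)" for s
    unfolding Y_def by (auto intro!: derivative_eq_intros)
  hence "reaper_curve UNIV (\<lambda>_. x s0) Y (\<lambda>_. \<theta> s0)"
    unfolding reaper_curve_def using Ypos cos0 \<sigma>_def by simp
  moreover have "range (cylinder (\<lambda>_. x s0) Y) = {p \<in> H2xR. p $ 1 = x s0}"
  proof (intro equalityI subsetI)
    fix p assume p: "p \<in> {p \<in> H2xR. p $ 1 = x s0}"
    hence p2: "p $ 2 > 0" by (simp add: H2xR_def)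
    have "Y (s0 + ln (p $ 2 / y s0) / \<sigma>) = p $ 2"
      using \<sigma> p2 d(1)[OF I(2)] by (simp add: Y_def)
    hence "p = cylinder (\<lambda>_. x s0) Y (vector [s0 + ln (p $ 2 / y s0) / \<sigma>, p $ 3])"
      using p by (simp add: cylinder_def vec_eq_iff forall_3)
    thus "p \<in> range (cylinder (\<lambda>_. x s0) Y)" by blast
  qed (use Ypos in \<open>auto simp: cylinder_def H2xR_def\<close>)
  moreover have "\<forall>s\<in>I. x s0 = x s \<and> Y s = y s \<and> \<theta> s0 = \<theta> s"
  proof
    fix s assume s: "s \<in> I"
    show "x s0 = x s \<and> Y s = y s \<and> \<theta> s0 = \<theta> s"
      using x[OF s] y[OF s] \<theta>[OF s] by (simp add: Y_def)
  qed
  ultimately show ?thesis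
    by - (rule exI[of _ "\<lambda>_. x s0"], rule exI[of _ Y], rule exI[of _ "\<lambda>_. \<theta> s0"], blast)
qed

text \<open>
  The level of the minimum of \<open>mu\<close> allows the single height \<open>2\<close>.
\<close>

lemma reaper_curve_extends_plane_y:
  assumes c: "reaper_curve I x y \<theta>" and I: "is_interval I" "s0 \<in> I"
    and eq: "\<bar>cos (\<theta> s0)\<bar> * mu 2 = mu (y s0)"
  shows "\<exists>X Y \<Theta>. (\<forall>s\<in>I. X s = x s \<and> Y s = y s \<and> \<Theta> s = \<theta> s) \<and> reaper_curve UNIV X Y \<Theta> \<and>
           range (cylinder X Y) = {p. p $ 2 = 2}"
proof -
  note d = reaper_curveD[OF c]
  have nz: "cos (\<theta> s0) \<noteq> 0" using eq mu_pos[OF d(1)[OF I(2)]] by auto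
  have y: "y s = 2" if s: "s \<in> I" for s
  proof (rule ccontr)
    assume "y s \<noteq> 2"
    hence "mu 2 < mu (y s)" using mu_gt_2 d(1)[OF s] by blast
    hence "\<bar>cos (\<theta> s0)\<bar> * mu 2 < \<bar>cos (\<theta> s0)\<bar> * mu (y s)" using nz by simp
    also have "\<dots> = \<bar>cos (\<theta> s0) * mu (y s)\<bar>" using mu_pos[OF d(1)[OF s]] by (simp add: abs_mult)
    also have "\<dots> = \<bar>cos (\<theta> s) * mu (y s0)\<bar>" using reaper_curve_first_integral[OF c I(1) s I(2)] by simp
    also have "\<dots> \<le> mu (y s0)" using mu_pos[OF d(1)[OF I(2)]] abs_cos_le_one[of "\<theta> s"]
      by (simp add: abs_mult mult_left_le_one_le)
    finally show False using eq by simp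
  qed
  have "\<bar>cos (\<theta> s0)\<bar> = 1" using eq y[OF I(2)] mu_pos[of 2] by simp
  hence "(cos (\<theta> s0))\<^sup>2 = 1" by (metis power2_abs one_power2)
  hence sin0: "sin (\<theta> s0) = 0" using sin_squared_eq[of "\<theta> s0"] by simp
  have conv: "convex I" using I(1) by (simp add: is_interval_convex)
  have "(\<theta> has_real_derivative 0) (at s within I)" if "s \<in> I" for s
    using d(4)[OF that] y[OF that] by (simp add: has_field_derivative_at_within)
  from has_field_derivative_zero_constant[OF conv this] have \<theta>: "\<theta> s = \<theta> s0" if "s \<in> I" for s
    using that I(2) by metis
  have "((\<lambda>s. x s - 2 * cos (\<theta> s0) * (s - s0)) has_real_derivative 0) (at s within I)" if "s \<in> I" for s
  proof (rule has_field_derivative_at_within)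
    have e: "((\<lambda>s. 2 * cos (\<theta> s0) * (s - s0)) has_real_derivative 2 * cos (\<theta> s0)) (at s)"
      by (auto intro!: derivative_eq_intros)
    show "((\<lambda>s. x s - 2 * cos (\<theta> s0) * (s - s0)) has_real_derivative 0) (at s)"
      by (rule DERIV_cong[OF DERIV_diff[OF d(2)[OF that] e]]) (simp add: y[OF that] \<theta>[OF that])
  qed
  from has_field_derivative_zero_constant[OF conv this]
  have "x s - 2 * cos (\<theta> s0) * (s - s0) = x s0 - 2 * cos (\<theta> s0) * (s0 - s0)" if "s \<in> I" for s
    using that I(2) by metis
  hence x: "x s = x s0 + 2 * cos (\<theta> s0) * (s - s0)" if "s \<in> I" for s using that by fastforce
  define X where "X s = x s0 + 2 * cos (\<theta> s0) * (s - s0)" for s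
  have "(X has_real_derivative 2 * cos (\<theta> s0)) (at s)" for s
    unfolding X_def by (auto intro!: derivative_eq_intros)
  hence "reaper_curve UNIV X (\<lambda>_. 2) (\<lambda>_. \<theta> s0)"
    unfolding reaper_curve_def using sin0 by simp
  moreover have "range (cylinder X (\<lambda>_. 2)) = {p. p $ 2 = 2}"
  proof (intro equalityI subsetI)
    fix p :: "real^3" assume p: "p \<in> {p. p $ 2 = 2}"
    have "X (s0 + (p $ 1 - x s0) / (2 * cos (\<theta> s0))) = p $ 1" using nz by (simp add: X_def)
    hence "p = cylinder X (\<lambda>_. 2) (vector [s0 + (p $ 1 - x s0) / (2 * cos (\<theta> s0)), p $ 3])"
      using p by (simp add: cylinder_def vec_eq_iff forall_3)
    thus "p \<in> range (cylinder X (\<lambda>_. 2))" by blast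
  qed (auto simp: cylinder_def)
  moreover have "\<forall>s\<in>I. X s = x s \<and> 2 = y s \<and> \<theta> s0 = \<theta> s"
  proof
    fix s assume s: "s \<in> I"
    show "X s = x s \<and> 2 = y s \<and> \<theta> s0 = \<theta> s"
      using x[OF s] y[OF s] \<theta>[OF s] by (simp add: X_def)
  qed
  ultimately show ?thesis
    by - (rule exI[of _ X], rule exI[of _ "\<lambda>_. 2"], rule exI[of _ "\<lambda>_. \<theta> s0"], blast)
qed

text \<open>
  The three cases are the values of the first integral \<open>\<bar>cos \<theta>\<bar> / mu y\<close>: it is zero, maximal, or in between.
  In the last case a curve with \<open>cos \<theta> < 0\<close> traverses the graph backwards and is treated by reversing time,
  which adds \<open>pi\<close> to the angle.
\<close>

theorem reaper_curve_classification:
  fixes OX OY O\<Theta> :: "real \<Rightarrow> real \<Rightarrow> real"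
  assumes orbits: "\<And>y0. 0 < y0 \<Longrightarrow> y0 < 2 \<Longrightarrow> standard_orbit y0 (OX y0) (OY y0) (O\<Theta> y0)"
    and c: "reaper_curve I x y \<theta>" and I: "is_interval I" "I \<noteq> {}"
  shows "\<exists>X Y \<Theta>. (\<forall>s\<in>I. X s = x s \<and> Y s = y s \<and> \<Theta> s = \<theta> s) \<and> reaper_curve UNIV X Y \<Theta> \<and>
           (range (cylinder X Y) = {p. p $ 2 = 2} \<or>
            (\<exists>x0. range (cylinder X Y) = {p \<in> H2xR. p $ 1 = x0}) \<or>
            (\<exists>y0\<in>{0<..<2}. \<exists>a. range (cylinder X Y) = translate_x a (range (cylinder (OX y0) (OY y0)))))"
proof -
  obtain s0 where s0: "s0 \<in> I" using I(2) by blast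
  note d = reaper_curveD[OF c]
  have m: "mu (y s0) > 0" by (rule mu_pos[OF d(1)[OF s0]])
  consider "cos (\<theta> s0) = 0" | "cos (\<theta> s0) \<noteq> 0" "\<bar>cos (\<theta> s0)\<bar> * mu 2 = mu (y s0)"
    | "cos (\<theta> s0) \<noteq> 0" "\<bar>cos (\<theta> s0)\<bar> * mu 2 \<noteq> mu (y s0)" by blast
  thus ?thesis
  proof cases
    case 1
    thus ?thesis using reaper_curve_extends_plane_x[OF c I(1) s0] by meson
  next
    case 2
    thus ?thesis using reaper_curve_extends_plane_y[OF c I(1) s0] by meson
  next
    case 3
    define k where "k = mu (y s0) / \<bar>cos (\<theta> s0)\<bar>"
    have "\<bar>cos (\<theta> s0)\<bar> * mu 2 \<le> 1 * mu (y s0)"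
      using mu_ge_2[OF d(1)[OF s0]] mu_pos[of 2] by (intro mult_mono) auto
    hence "mu 2 < k" using 3 by (simp add: k_def less_divide_eq mult.commute)
    then obtain y0 where h: "0 < y0" "y0 < 2" "mu y0 = k" by (rule mu_takes_values)
    interpret o: standard_orbit y0 "OX y0" "OY y0" "O\<Theta> y0" by (rule orbits[OF h(1,2)])
    have first: "\<bar>cos (\<theta> s0)\<bar> * mu y0 = mu (y s0)" using 3(1) by (simp add: h(3) k_def)
    show ?thesis
    proof (cases "cos (\<theta> s0) > 0")
      case True
      then obtain c' a n where eq: "\<And>s. s \<in> I \<Longrightarrow> x s = OX y0 (s + c') + a \<and> y s = OY y0 (s + c') \<and>
          \<theta> s = O\<Theta> y0 (s + c') + 2 * pi * of_int n"
        using o.orbit_unique[OF c I(1) s0] first by auto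
      let ?X = "\<lambda>s. OX y0 (s + c') + a" and ?Y = "\<lambda>s. OY y0 (s + c')"
        and ?\<Theta> = "\<lambda>s. O\<Theta> y0 (s + c') + 2 * pi * of_int n"
      have "reaper_curve UNIV ?X ?Y ?\<Theta>"
        by (intro reaper_curve_rotate reaper_curve_translate o.curve) (simp add: cos_int_2pin)
      moreover have "surj (\<lambda>s. s + c')" by (rule surjI[of _ "\<lambda>s. s - c'"]) simp
      hence "range (cylinder ?X ?Y) = translate_x a (range (cylinder (OX y0) (OY y0)))"
        by (rule range_cylinder_reparam)
      moreover have "\<forall>s\<in>I. ?X s = x s \<and> ?Y s = y s \<and> ?\<Theta> s = \<theta> s" using eq by auto
      moreover have "y0 \<in> {0<..<2}" using h by simp
      ultimately show ?thesis
        by - (rule exI[of _ ?X], rule exI[of _ ?Y], rule exI[of _ ?\<Theta>], blast)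
    next
      case False
      define I' where "I' = {s. 0 - s \<in> I}"
      have rev: "reaper_curve I' (\<lambda>s. x (0 - s)) (\<lambda>s. y (0 - s)) (\<lambda>s. \<theta> (0 - s) + pi)"
        unfolding I'_def by (rule reaper_curve_reverse[OF c]) simp
      have "is_interval I'"
        unfolding is_interval_1
      proof (intro ballI allI impI)
        fix a b r assume "a \<in> I'" "b \<in> I'" and r: "a \<le> r \<and> r \<le> b"
        hence "0 - b \<in> I" "0 - a \<in> I" by (simp_all add: I'_def)
        moreover have "0 - b \<le> 0 - r" "0 - r \<le> 0 - a" using r by simp_all
        ultimately have "0 - r \<in> I" using I(1) unfolding is_interval_1 by blast
        thus "r \<in> I'" by (simp add: I'_def)
      qed
      moreover have "- s0 \<in> I'" using s0 by (simp add: I'_def)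
      ultimately have I': "is_interval I'" "- s0 \<in> I'" by blast+
      have "cos (\<theta> (0 - (- s0)) + pi) * mu y0 = mu (y (0 - (- s0)))"
        using False first 3(1) by (simp add: cos_add abs_if split: if_splits)
      then obtain c' a n where eq: "\<And>s. s \<in> I' \<Longrightarrow> x (0 - s) = OX y0 (s + c') + a \<and>
          y (0 - s) = OY y0 (s + c') \<and> \<theta> (0 - s) + pi = O\<Theta> y0 (s + c') + 2 * pi * of_int n"
        using o.orbit_unique[OF rev I'] by blast
      let ?X = "\<lambda>s. OX y0 (c' - s) + a" and ?Y = "\<lambda>s. OY y0 (c' - s)"
        and ?\<Theta> = "\<lambda>s. O\<Theta> y0 (c' - s) + (2 * pi * of_int n - pi)"
      have c'': "reaper_curve UNIV (\<lambda>s. OX y0 (s + 0) + a) (\<lambda>s. OY y0 (s + 0)) (\<lambda>s. O\<Theta> y0 (s + 0))"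
        by (rule reaper_curve_translate[OF o.curve])
      have "cos (2 * pi * of_int n - pi) = - 1" by (simp add: cos_diff cos_int_2pin)
      from reaper_curve_reverse[OF c'' this, of c'] have "reaper_curve UNIV ?X ?Y ?\<Theta>" by simp
      moreover have "surj (\<lambda>s. c' - s)" by (rule surjI[of _ "\<lambda>s. c' - s"]) simp
      hence "range (cylinder ?X ?Y) = translate_x a (range (cylinder (OX y0) (OY y0)))"
        by (rule range_cylinder_reparam)
      moreover have "\<forall>s\<in>I. ?X s = x s \<and> ?Y s = y s \<and> ?\<Theta> s = \<theta> s"
      proof
        fix s assume "s \<in> I"
        thus "?X s = x s \<and> ?Y s = y s \<and> ?\<Theta> s = \<theta> s" using eq[of "- s"] by (simp add: I'_def algebra_simps)
      qed
      moreover have "y0 \<in> {0<..<2}" using h by simp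
      ultimately show ?thesis
        by - (rule exI[of _ ?X], rule exI[of _ ?Y], rule exI[of _ ?\<Theta>], blast)
    qed
  qed
qed


section \<open>Uniform smallness of all derivatives\<close>

text \<open>
  \<open>B\<close> is an algebra of families containing the constants and \<open>Z\<close> an ideal of it. With bounded
  families and families tending to \<open>0\<close> this yields uniform convergence of all derivatives; with no
  condition at all it yields smoothness of a single function.
\<close>

locale jet_ideal =
  fixes B Z :: "('t \<Rightarrow> real \<Rightarrow> real) \<Rightarrow> bool"
  assumes B_const: "B (\<lambda>_ _. c)"
    and B_add: "B f \<Longrightarrow> B g \<Longrightarrow> B (\<lambda>\<tau> y. f \<tau> y + g \<tau> y)"
    and B_mult: "B f \<Longrightarrow> B g \<Longrightarrow> B (\<lambda>\<tau> y. f \<tau> y * g \<tau> y)"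
    and Z_add: "Z f \<Longrightarrow> Z g \<Longrightarrow> Z (\<lambda>\<tau> y. f \<tau> y + g \<tau> y)"
    and BZ_mult: "B f \<Longrightarrow> Z g \<Longrightarrow> Z (\<lambda>\<tau> y. f \<tau> y * g \<tau> y)"
    and Z_B: "Z f \<Longrightarrow> B f"
begin

lemma jet_B_const: "jet B F J n (\<lambda>_ _. c)"
  by (rule jet_const) (rule B_const)

lemma jet_B_add: "jet B F J n f \<Longrightarrow> jet B F J n g \<Longrightarrow> jet B F J n (\<lambda>\<tau> y. f \<tau> y + g \<tau> y)"
  by (rule jet_add[where P=B]) (erule (1) B_add)

lemma jet_B_mult: "jet B F J n f \<Longrightarrow> jet B F J n g \<Longrightarrow> jet B F J n (\<lambda>\<tau> y. f \<tau> y * g \<tau> y)"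
  by (rule jet_mult[where P=B and Q=B and R=B]) (erule (1) B_mult, erule (1) B_add)

lemma jet_BZ_mult: "jet B F J n f \<Longrightarrow> jet Z F J n g \<Longrightarrow> jet Z F J n (\<lambda>\<tau> y. f \<tau> y * g \<tau> y)"
  by (rule jet_mult[where P=B and Q=Z and R=Z]) (erule (1) BZ_mult, erule (1) Z_add)

lemma jet_Z_B: "jet Z F J n f \<Longrightarrow> jet B F J n f"
  by (rule jet_mono[where P=Z]) (erule Z_B)

text \<open>
  With \<open>w = f - 2\<close> and \<open>v = 1 / f\<close> the graph equation becomes the polynomial system
  \<open>w' = p\<close>, \<open>p' = - (1 + p\<^sup>2) v\<^sup>2 w\<close>, \<open>v' = - v\<^sup>2 p\<close>. The first two right-hand sides are in the ideal generated by \<open>w\<close>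
  and \<open>p\<close>, so the smallness of \<open>w\<close> and \<open>p\<close> carries over to all derivatives.
\<close>

lemma jet_graph:
  assumes ev: "\<forall>\<^sub>F \<tau> in F. \<forall>a\<in>J. f \<tau> a \<noteq> 0 \<and> (f \<tau> has_real_derivative p \<tau> a) (at a) \<and>
      (p \<tau> has_real_derivative (1 + (p \<tau> a)\<^sup>2) * (2 / f \<tau> a - 1) / f \<tau> a) (at a)"
    and w: "Z (\<lambda>\<tau> a. f \<tau> a - 2)" and p: "Z p" and v: "B (\<lambda>\<tau> a. 1 / f \<tau> a)"
  shows "jet Z F J n (\<lambda>\<tau> a. f \<tau> a - 2) \<and> jet Z F J n p \<and> jet B F J n (\<lambda>\<tau> a. 1 / f \<tau> a)"
proof (induction n)
  case (Suc n)
  hence IH: "jet Z F J n (\<lambda>\<tau> a. f \<tau> a - 2)" "jet Z F J n p" "jet B F J n (\<lambda>\<tau> a. 1 / f \<tau> a)"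
    by auto
  have pB: "jet B F J n p" by (rule jet_Z_B[OF IH(2)])
  have "jet Z F J (Suc n) (\<lambda>\<tau> a. f \<tau> a - 2)"
  proof (rule jet_SucI[where P=Z and f="\<lambda>\<tau> a. f \<tau> a - 2" and f'=p, OF _ IH(2) w])
    show "\<forall>\<^sub>F \<tau> in F. \<forall>a\<in>J. ((\<lambda>a. f \<tau> a - 2) has_real_derivative p \<tau> a) (at a)"
      using ev
    proof eventually_elim
      case (elim \<tau>)
      show ?case
      proof
        fix a assume "a \<in> J"
        hence "(f \<tau> has_real_derivative p \<tau> a) (at a)" using elim by blast
        from DERIV_diff[OF this DERIV_const[of 2]]
        show "((\<lambda>a. f \<tau> a - 2) has_real_derivative p \<tau> a) (at a)" by simp
      qed
    qed
  qed
  moreover have "jet Z F J (Suc n) p"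
  proof (rule jet_SucI[where P=Z and f=p, OF _ _ p])
    let ?p' = "\<lambda>\<tau> a. ((1 + p \<tau> a * p \<tau> a) * (- 1 * ((1 / f \<tau> a) * (1 / f \<tau> a)))) * (f \<tau> a - 2)"
    show "jet Z F J n ?p'"
      by (intro jet_BZ_mult jet_B_mult jet_B_add jet_B_const pB IH(1,3))
    show "\<forall>\<^sub>F \<tau> in F. \<forall>a\<in>J. (p \<tau> has_real_derivative ?p' \<tau> a) (at a)"
      using ev
    proof eventually_elim
      case (elim \<tau>)
      show ?case
      proof
        fix a assume a: "a \<in> J"
        hence nz: "f \<tau> a \<noteq> 0" using elim by blast
        have eq: "(1 + (p \<tau> a)\<^sup>2) * (2 / f \<tau> a - 1) / f \<tau> a = ?p' \<tau> a"
          using nz by (simp add: field_simps power2_eq_square)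
        show "(p \<tau> has_real_derivative ?p' \<tau> a) (at a)"
          unfolding eq[symmetric] using elim a by blast
      qed
    qed
  qed
  moreover have "jet B F J (Suc n) (\<lambda>\<tau> a. 1 / f \<tau> a)"
  proof (rule jet_SucI[where P=B and f="\<lambda>\<tau> a. 1 / f \<tau> a", OF _ _ v])
    let ?v' = "\<lambda>\<tau> a. (- 1 * p \<tau> a) * ((1 / f \<tau> a) * (1 / f \<tau> a))"
    show "jet B F J n ?v'"
      by (intro jet_B_mult jet_B_const pB IH(3))
    show "\<forall>\<^sub>F \<tau> in F. \<forall>a\<in>J. ((\<lambda>a. 1 / f \<tau> a) has_real_derivative ?v' \<tau> a) (at a)"
      using ev
    proof eventually_elim
      case (elim \<tau>)
      show ?case
      proof
        fix a assume a: "a \<in> J"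
        have nz: "f \<tau> a \<noteq> 0" and d: "(f \<tau> has_real_derivative p \<tau> a) (at a)" using elim a by blast+
        show "((\<lambda>a. 1 / f \<tau> a) has_real_derivative ?v' \<tau> a) (at a)"
          by (rule DERIV_cong[OF DERIV_divide[OF DERIV_const d nz]]) (use nz in simp)
      qed
    qed
  qed
  ultimately show ?case by blast
qed (simp add: w p v)

text \<open>
  The same argument for a graph \<open>x = X y\<close> over the vertical axis: the slope \<open>u\<close> satisfies an equation whose
  right-hand side is divisible by \<open>u\<close>.
\<close>

lemma jet_sheet:
  assumes ev: "\<forall>\<^sub>F \<tau> in F. \<forall>y\<in>J. (X \<tau> has_real_derivative u \<tau> y) (at y) \<and>
      (u \<tau> has_real_derivative (1 / y - 2 / y\<^sup>2) * (u \<tau> y * (1 + (u \<tau> y)\<^sup>2))) (at y)"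
    and J: "\<And>y. y \<in> J \<Longrightarrow> y > 0"
    and X: "Z X" and u: "Z u" and v: "B (\<lambda>_ y. 1 / y)"
  shows "jet Z F J n X"
proof -
  have "jet Z F J n X \<and> jet Z F J n u \<and> jet B F J n (\<lambda>_ y. 1 / y)"
  proof (induction n)
    case (Suc n)
    hence IH: "jet Z F J n X" "jet Z F J n u" "jet B F J n (\<lambda>_ y. 1 / y)" by auto
    have uB: "jet B F J n u" by (rule jet_Z_B[OF IH(2)])
    have "jet Z F J (Suc n) X"
      by (rule jet_SucI[where P=Z and f=X and f'=u, OF _ IH(2) X]) (use ev in \<open>eventually_elim, blast\<close>)
    moreover have "jet Z F J (Suc n) u"
    proof (rule jet_SucI[where P=Z and f=u, OF _ _ u])
      let ?u' = "\<lambda>\<tau> y. ((1 / y + (- 2) * ((1 / y) * (1 / y))) * (1 + u \<tau> y * u \<tau> y)) * u \<tau> y"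
      show "jet Z F J n ?u'"
        by (intro jet_BZ_mult jet_B_mult jet_B_add jet_B_const uB IH(2,3))
      show "\<forall>\<^sub>F \<tau> in F. \<forall>y\<in>J. (u \<tau> has_real_derivative ?u' \<tau> y) (at y)"
        using ev
      proof eventually_elim
        case (elim \<tau>)
        show ?case
        proof
          fix y assume y: "y \<in> J"
          have eq: "(1 / y - 2 / y\<^sup>2) * (u \<tau> y * (1 + (u \<tau> y)\<^sup>2)) = ?u' \<tau> y"
            by (simp add: power2_eq_square)
          show "(u \<tau> has_real_derivative ?u' \<tau> y) (at y)"
            unfolding eq[symmetric] using elim y by blast
        qed
      qed
    qed
    moreover have "jet B F J (Suc n) (\<lambda>_ y. 1 / y)"
    proof (rule jet_SucI[where P=B and f="\<lambda>_ y. 1 / y", OF _ _ v])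
      show "jet B F J n (\<lambda>_ y. - 1 * ((1 / y) * (1 / y)))"
        by (intro jet_B_mult jet_B_const IH(3))
      have "((\<lambda>y. 1 / y) has_real_derivative - 1 * ((1 / y) * (1 / y))) (at y)" if "y \<in> J" for y :: real
        by (rule DERIV_cong[OF DERIV_divide[OF DERIV_const DERIV_ident]]) (use J[OF that] in auto)
      thus "\<forall>\<^sub>F \<tau> in F. \<forall>y\<in>J. ((\<lambda>y. 1 / y) has_real_derivative - 1 * ((1 / y) * (1 / y))) (at y)"
        by (intro always_eventually) blast
    qed
    ultimately show ?case by blast
  qed (simp add: X u v)
  thus ?thesis by blast
qed

end

definition unif_bounded :: "'t filter \<Rightarrow> real set \<Rightarrow> ('t \<Rightarrow> real \<Rightarrow> real) \<Rightarrow> bool" where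
  "unif_bounded F J f \<longleftrightarrow> (\<exists>M. \<forall>\<^sub>F \<tau> in F. \<forall>y\<in>J. \<bar>f \<tau> y\<bar> \<le> M)"

definition unif_null :: "'t filter \<Rightarrow> real set \<Rightarrow> ('t \<Rightarrow> real \<Rightarrow> real) \<Rightarrow> bool" where
  "unif_null F J f \<longleftrightarrow> (\<forall>e>0. \<forall>\<^sub>F \<tau> in F. \<forall>y\<in>J. \<bar>f \<tau> y\<bar> < e)"

lemma jet_ideal_smooth: "jet_ideal (\<lambda>_. True) (\<lambda>_. True)"
  by unfold_locales auto

lemma jet_ideal_null: "jet_ideal (unif_bounded F J) (unif_null F J)"
proof
  fix f g :: "'a \<Rightarrow> real \<Rightarrow> real" and c :: real
  show "unif_bounded F J (\<lambda>_ _. c)" unfolding unif_bounded_def by (intro exI[of _ "\<bar>c\<bar>"]) simp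
  {
    assume "unif_bounded F J f" "unif_bounded F J g"
    then obtain M M' where M: "\<forall>\<^sub>F \<tau> in F. \<forall>y\<in>J. \<bar>f \<tau> y\<bar> \<le> M" "\<forall>\<^sub>F \<tau> in F. \<forall>y\<in>J. \<bar>g \<tau> y\<bar> \<le> M'"
      unfolding unif_bounded_def by blast
    have "\<forall>\<^sub>F \<tau> in F. \<forall>y\<in>J. \<bar>f \<tau> y + g \<tau> y\<bar> \<le> M + M'"
      using M by eventually_elim (meson abs_triangle_ineq add_mono order_trans)
    thus "unif_bounded F J (\<lambda>\<tau> y. f \<tau> y + g \<tau> y)" unfolding unif_bounded_def by blast
    have "\<forall>\<^sub>F \<tau> in F. \<forall>y\<in>J. \<bar>f \<tau> y * g \<tau> y\<bar> \<le> \<bar>M\<bar> * \<bar>M'\<bar>"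
      using M
    proof eventually_elim
      case (elim \<tau>)
      show ?case unfolding abs_mult
        using elim by (intro ballI mult_mono) (meson abs_ge_self abs_ge_zero order_trans)+
    qed
    thus "unif_bounded F J (\<lambda>\<tau> y. f \<tau> y * g \<tau> y)" unfolding unif_bounded_def by blast
  }
  {
    assume fg: "unif_null F J f" "unif_null F J g"
    show "unif_null F J (\<lambda>\<tau> y. f \<tau> y + g \<tau> y)"
      unfolding unif_null_def
    proof (intro allI impI)
      fix e :: real assume "e > 0"
      hence "\<forall>\<^sub>F \<tau> in F. \<forall>y\<in>J. \<bar>f \<tau> y\<bar> < e / 2" "\<forall>\<^sub>F \<tau> in F. \<forall>y\<in>J. \<bar>g \<tau> y\<bar> < e / 2"
        using fg unfolding unif_null_def by (meson half_gt_zero)+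
      thus "\<forall>\<^sub>F \<tau> in F. \<forall>y\<in>J. \<bar>f \<tau> y + g \<tau> y\<bar> < e"
      proof eventually_elim
        case (elim \<tau>)
        show ?case
        proof
          fix y assume "y \<in> J"
          hence "\<bar>f \<tau> y\<bar> < e / 2" "\<bar>g \<tau> y\<bar> < e / 2" using elim by auto
          thus "\<bar>f \<tau> y + g \<tau> y\<bar> < e" by linarith
        qed
      qed
    qed
  }
  {
    assume fg: "unif_bounded F J f" "unif_null F J g"
    obtain M where M: "\<forall>\<^sub>F \<tau> in F. \<forall>y\<in>J. \<bar>f \<tau> y\<bar> \<le> M" using fg(1) unfolding unif_bounded_def by blast
    show "unif_null F J (\<lambda>\<tau> y. f \<tau> y * g \<tau> y)"
      unfolding unif_null_def
    proof (intro allI impI)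
      fix e :: real assume e: "e > 0"
      have "e / (\<bar>M\<bar> + 1) > 0" using e by simp
      hence "\<forall>\<^sub>F \<tau> in F. \<forall>y\<in>J. \<bar>g \<tau> y\<bar> < e / (\<bar>M\<bar> + 1)" using fg(2) unfolding unif_null_def by blast
      thus "\<forall>\<^sub>F \<tau> in F. \<forall>y\<in>J. \<bar>f \<tau> y * g \<tau> y\<bar> < e"
        using M
      proof eventually_elim
        case (elim \<tau>)
        show ?case
        proof
          fix y assume y: "y \<in> J"
          have "\<bar>f \<tau> y * g \<tau> y\<bar> \<le> (\<bar>M\<bar> + 1) * \<bar>g \<tau> y\<bar>"
            unfolding abs_mult using bspec[OF elim(2) y] by (intro mult_right_mono) auto
          also have "\<dots> < (\<bar>M\<bar> + 1) * (e / (\<bar>M\<bar> + 1))"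
            using elim(1) y by (intro mult_strict_left_mono) auto
          also have "\<dots> = e" by simp
          finally show "\<bar>f \<tau> y * g \<tau> y\<bar> < e" .
        qed
      qed
    qed
  }
  show "unif_null F J f \<Longrightarrow> unif_bounded F J f"
  proof -
    assume "unif_null F J f"
    hence "\<forall>\<^sub>F \<tau> in F. \<forall>y\<in>J. \<bar>f \<tau> y\<bar> < 1" unfolding unif_null_def by simp
    hence "\<forall>\<^sub>F \<tau> in F. \<forall>y\<in>J. \<bar>f \<tau> y\<bar> \<le> 1" by eventually_elim force
    thus "unif_bounded F J f" unfolding unif_bounded_def by blast
  qed
qed

lemma unif_null_zero: "unif_null F J (\<lambda>_ _. 0)"
  by (simp add: unif_null_def)

lemma partials_uniform_limit_zero:
  assumes J: "open J" and jet: "\<And>n. jet (unif_null F J) F J n \<phi>"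
    and w: "\<forall>\<^sub>F \<tau> in F. \<forall>p. p $ m \<in> J \<longrightarrow> w \<tau> p = \<phi> \<tau> (p $ m)"
    and D: "\<And>p. p \<in> D \<Longrightarrow> p $ m \<in> J"
  shows "uniform_limit D (\<lambda>\<tau>. partials is (w \<tau>)) (\<lambda>_. 0) F"
proof -
  obtain \<psi> where \<psi>: "jet (unif_null F J) F J 0 \<psi>"
    "\<forall>\<^sub>F \<tau> in F. \<forall>p. p $ m \<in> J \<longrightarrow> partials is (w \<tau>) p = \<psi> \<tau> (p $ m)"
    using partials_jet[of J "unif_null F J" F 0 "is" \<phi> m w] J jet w unif_null_zero by blast
  show ?thesis
    unfolding uniform_limit_iff
  proof (intro allI impI)
    fix e :: real assume "e > 0"
    hence "\<forall>\<^sub>F \<tau> in F. \<forall>y\<in>J. \<bar>\<psi> \<tau> y\<bar> < e" using \<psi>(1) by (simp add: unif_null_def)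
    with \<psi>(2) show "\<forall>\<^sub>F \<tau> in F. \<forall>p\<in>D. dist (partials is (w \<tau>) p) 0 < e"
      by eventually_elim (simp add: D)
  qed
qed

lemma partials_differentiable:
  fixes w :: "real^'n::finite \<Rightarrow> real"
  assumes J: "open J" and jet: "\<And>n. jet (\<lambda>_. True) (principal {\<tau>}) J n \<phi>"
    and w: "\<And>p. p $ m \<in> J \<Longrightarrow> w p = \<phi> \<tau> (p $ m)" and p: "p $ m \<in> J"
  shows "partials is w differentiable (at p)"
proof -
  have "\<forall>\<^sub>F \<tau>' in principal {\<tau>}. \<forall>p. p $ m \<in> J \<longrightarrow> w p = \<phi> \<tau>' (p $ m)"
    using w by (simp add: eventually_principal)
  from partials_jet[where P="\<lambda>_. True" and n="Suc 0", OF J TrueI jet this, of "is"]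
  obtain \<psi> where \<psi>: "jet (\<lambda>_. True) (principal {\<tau>}) J (Suc 0) \<psi>"
    and "\<forall>\<^sub>F \<tau>' in principal {\<tau>}. \<forall>p. p $ m \<in> J \<longrightarrow> partials is w p = \<psi> \<tau>' (p $ m)"
    by blast
  hence eq: "partials is w p = \<psi> \<tau> (p $ m)" if "p $ m \<in> J" for p
    using that unfolding eventually_principal by blast
  obtain \<psi>' where "\<forall>y\<in>J. (\<psi> \<tau> has_real_derivative \<psi>' \<tau> y) (at y)"
    using \<psi> unfolding jet.simps eventually_principal by blast
  hence "(\<psi> \<tau> has_real_derivative \<psi>' \<tau> (p $ m)) (at (p $ m))" using p by blast
  hence "\<psi> \<tau> differentiable (at (p $ m))" using real_differentiable_def by blast
  moreover have "(\<lambda>p::real^'n. p $ m) differentiable (at p)"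
    by (simp add: bounded_linear_imp_differentiable bounded_linear_vec_nth)
  ultimately have "(\<lambda>p. \<psi> \<tau> (p $ m)) differentiable (at p)"
    using differentiable_chain_at[of "\<lambda>p::real^'n. p $ m" p "\<psi> \<tau>"] by (simp add: o_def)
  then obtain d where "((\<lambda>p. \<psi> \<tau> (p $ m)) has_derivative d) (at p)" unfolding differentiable_def by blast
  moreover have "open {p::real^'n. p $ m \<in> J}"
    using open_vimage[OF J, of "\<lambda>u::real^'n. u $ m"] by (simp add: vimage_def continuous_on_component)
  ultimately have "(partials is w has_derivative d) (at p)"
    by (rule has_derivative_transform_within_open) (use p eq in auto)
  thus ?thesis by (rule differentiableI)
qed


section \<open>Convergence to the plane at height two\<close>

lemma reaper_profileD:
  assumes "reaper_profile y0 f p T"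
  shows "(f has_real_derivative p a) (at a)"
    "(p has_real_derivative (1 + (p a)\<^sup>2) * (2 / f a - 1) / f a) (at a)"
    "(1 + (p a)\<^sup>2) * (mu (f a))\<^sup>2 = (mu y0)\<^sup>2"
    "y0 \<le> f a" "f (- a) = f a" "f (a + 2 * T) = f a"
    "f 0 = y0" "T > 0" "p T = 0" "0 < a \<Longrightarrow> a < T \<Longrightarrow> p a > 0"
  using assms unfolding reaper_profile_def by blast+

lemma in_graph_iff: "q \<in> range (cylinder (\<lambda>s. s) f) \<longleftrightarrow> q $ 2 = f (q $ 1)"
proof
  assume q: "q $ 2 = f (q $ 1)"
  have "q = cylinder (\<lambda>s. s) f (vector [q $ 1, q $ 3])"
    using q by (simp add: cylinder_def vec_eq_iff forall_3)
  thus "q \<in> range (cylinder (\<lambda>s. s) f)" by blast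
qed (auto simp: cylinder_def)

lemma reaper_profile_mu_le:
  assumes "reaper_profile y0 f p T" "y0 > 0"
  shows "mu (f a) \<le> mu y0"
proof -
  note d = reaper_profileD[OF assms(1)]
  have "1 * (mu (f a))\<^sup>2 \<le> (1 + (p a)\<^sup>2) * (mu (f a))\<^sup>2" by (intro mult_right_mono) auto
  hence "(mu (f a))\<^sup>2 \<le> (mu y0)\<^sup>2" using d(3) by simp
  thus ?thesis using mu_pos[OF assms(2)] by (rule power2_le_imp_le[OF _ less_imp_le])
qed

lemma eventually_at_left_2: "\<forall>\<^sub>F \<tau> in at_left (2::real). 1 < \<tau> \<and> \<tau> < 2"
  by (intro eventually_at_leftI[of 1]) auto

lemma reaper_profile_jets:
  assumes f: "reaper_profile \<tau> f p T" and "0 < \<tau>"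
  shows "jet (\<lambda>_. True) F UNIV n (\<lambda>_ a. f a - 2)"
proof -
  interpret jet_ideal "\<lambda>_. True" "\<lambda>_. True" by (rule jet_ideal_smooth)
  note d = reaper_profileD[OF f]
  have nz: "f a \<noteq> 0" for a using d(4)[of a] assms(2) by simp
  show ?thesis
    using jet_graph[where f="\<lambda>_. f" and p="\<lambda>_. p" and F=F and J=UNIV and n=n] d(1,2) nz
    by (simp add: eventually_principal)
qed

text \<open>
  As \<open>\<tau>\<close> tends to \<open>2\<close>, the bound \<open>mu (f a) \<le> mu \<tau>\<close> forces \<open>f\<close> towards the minimum of \<open>mu\<close> at \<open>2\<close>, and
  \<open>1 + p\<^sup>2 = (mu \<tau> / mu (f a))\<^sup>2\<close> forces \<open>p\<close> towards \<open>0\<close>, both uniformly on the line.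
\<close>

theorem converges_to_horizontal_plane:
  assumes prof: "\<And>\<tau>. 0 < \<tau> \<Longrightarrow> \<tau> < 2 \<Longrightarrow> reaper_profile \<tau> (f \<tau>) (p \<tau>) (T \<tau>)"
    and G: "\<And>\<tau>. 0 < \<tau> \<Longrightarrow> \<tau> < 2 \<Longrightarrow> G \<tau> = range (cylinder (\<lambda>s. s) (f \<tau>))"
  shows "converges_to_plane 1 G 2 2 (at_left 2)"
proof -
  let ?F = "at_left (2::real)"
  interpret jet_ideal "unif_bounded ?F UNIV" "unif_null ?F UNIV" by (rule jet_ideal_null)
  have near: "\<forall>\<^sub>F \<tau> in ?F. mu \<tau> < k" if "mu 2 < k" for k
  proof -
    have "(mu \<longlongrightarrow> mu 2) ?F"
      using isCont_mu[of 2] by (simp add: isCont_def filterlim_at_split)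
    thus ?thesis using that by (rule order_tendstoD(2))
  qed
  have w0: "unif_null ?F UNIV (\<lambda>\<tau> a. f \<tau> a - 2)"
    unfolding unif_null_def
  proof (intro allI impI)
    fix e' :: real assume e': "e' > 0"
    define e where "e = min e' 1"
    have e: "0 < e" "e \<le> 1" "e \<le> e'" using e' by (auto simp: e_def)
    have "mu 2 < min (mu (2 - e)) (mu (2 + e))"
      using mu_strict_antimono[of "2 - e" 2] mu_strict_mono[of 2 "2 + e"] e by simp
    from near[OF this] eventually_at_left_2
    show "\<forall>\<^sub>F \<tau> in ?F. \<forall>a\<in>UNIV. \<bar>f \<tau> a - 2\<bar> < e'"
    proof eventually_elim
      case (elim \<tau>)
      hence \<tau>: "0 < \<tau>" "\<tau> < 2" by auto
      show ?case
      proof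
        fix a
        have le: "mu (f \<tau> a) \<le> mu \<tau>" by (rule reaper_profile_mu_le[OF prof[OF \<tau>] \<tau>(1)])
        have pos: "f \<tau> a > 0" using reaper_profileD(4)[OF prof[OF \<tau>], of a] \<tau> by simp
        have "\<not> f \<tau> a \<ge> 2 + e"
        proof
          assume "2 + e \<le> f \<tau> a"
          hence "mu (2 + e) \<le> mu (f \<tau> a)"
            using mu_strict_mono[of "2 + e" "f \<tau> a"] e by (cases "f \<tau> a = 2 + e") auto
          thus False using le elim by simp
        qed
        moreover have "\<not> f \<tau> a \<le> 2 - e"
        proof
          assume "f \<tau> a \<le> 2 - e"
          hence "mu (2 - e) \<le> mu (f \<tau> a)"
            using mu_strict_antimono[of "f \<tau> a" "2 - e"] e pos by (cases "f \<tau> a = 2 - e") auto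
          thus False using le elim by simp
        qed
        ultimately show "\<bar>f \<tau> a - 2\<bar> < e'" using e by linarith
      qed
    qed
  qed
  have p0: "unif_null ?F UNIV p"
    unfolding unif_null_def
  proof (intro allI impI)
    fix e :: real assume e: "e > 0"
    have m2: "mu 2 > 0" by (simp add: mu_pos)
    have "mu 2 < mu 2 * sqrt (1 + e\<^sup>2)" using m2 e by simp
    from near[OF this] eventually_at_left_2
    show "\<forall>\<^sub>F \<tau> in ?F. \<forall>a\<in>UNIV. \<bar>p \<tau> a\<bar> < e"
    proof eventually_elim
      case (elim \<tau>)
      hence \<tau>: "0 < \<tau>" "\<tau> < 2" by auto
      show ?case
      proof
        fix a
        note d = reaper_profileD[OF prof[OF \<tau>]]
        have "mu 2 \<le> mu (f \<tau> a)" using mu_ge_2 d(4)[of a] \<tau> by simp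
        hence "(1 + (p \<tau> a)\<^sup>2) * (mu 2)\<^sup>2 \<le> (1 + (p \<tau> a)\<^sup>2) * (mu (f \<tau> a))\<^sup>2"
          using m2 by (intro mult_left_mono power_mono) auto
        also have "\<dots> = (mu \<tau>)\<^sup>2" by (rule d)
        also have "\<dots> < (mu 2 * sqrt (1 + e\<^sup>2))\<^sup>2"
          using elim mu_pos[OF \<tau>(1)] by (intro power_strict_mono) auto
        also have "\<dots> = (1 + e\<^sup>2) * (mu 2)\<^sup>2" by (simp add: power_mult_distrib)
        finally have "(p \<tau> a)\<^sup>2 < e\<^sup>2" using m2 by simp
        hence "\<bar>p \<tau> a\<bar>\<^sup>2 < e\<^sup>2" by simp
        thus "\<bar>p \<tau> a\<bar> < e" using e by (intro power2_less_imp_less[of "\<bar>p \<tau> a\<bar>" e]) auto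
      qed
    qed
  qed
  have v0: "unif_bounded ?F UNIV (\<lambda>\<tau> a. 1 / f \<tau> a)"
    unfolding unif_bounded_def
  proof (intro exI[of _ 1])
    show "\<forall>\<^sub>F \<tau> in ?F. \<forall>a\<in>UNIV. \<bar>1 / f \<tau> a\<bar> \<le> 1"
      using eventually_at_left_2
    proof eventually_elim
      case (elim \<tau>)
      show ?case
      proof
        fix a
        have "1 \<le> f \<tau> a" using reaper_profileD(4)[OF prof, of \<tau> a] elim by simp
        thus "\<bar>1 / f \<tau> a\<bar> \<le> 1" by simp
      qed
    qed
  qed
  have ev: "\<forall>\<^sub>F \<tau> in ?F. \<forall>a\<in>UNIV. f \<tau> a \<noteq> 0 \<and> (f \<tau> has_real_derivative p \<tau> a) (at a) \<and>
      (p \<tau> has_real_derivative (1 + (p \<tau> a)\<^sup>2) * (2 / f \<tau> a - 1) / f \<tau> a) (at a)"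
    using eventually_at_left_2
  proof eventually_elim
    case (elim \<tau>)
    hence \<tau>: "0 < \<tau>" "\<tau> < 2" by auto
    note d = reaper_profileD[OF prof[OF \<tau>]]
    show ?case
    proof (intro ballI conjI)
      fix a
      show "f \<tau> a \<noteq> 0" using d(4)[of a] \<tau> by simp
      show "(f \<tau> has_real_derivative p \<tau> a) (at a)" by (rule d)
      show "(p \<tau> has_real_derivative (1 + (p \<tau> a)\<^sup>2) * (2 / f \<tau> a - 1) / f \<tau> a) (at a)" by (rule d)
    qed
  qed
  have jets: "jet (unif_null ?F UNIV) ?F UNIV n (\<lambda>\<tau> a. f \<tau> a - 2)" for n
    using jet_graph[OF ev w0 p0 v0] by blast
  define W where "W \<tau> q = f \<tau> (q $ 1) - 2" for \<tau> and q :: "real^3"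
  show ?thesis
    unfolding converges_to_plane_def
  proof (intro allI impI exI[of _ "\<lambda>_. W"] conjI)
    fix D :: "(real^3) set" and r :: real
    assume D: "openin (top_of_set {p. p $ 2 = 2}) D" and r: "r > 0"
    have D2: "q $ 2 = 2" if "q \<in> D" for q using openin_imp_subset[OF D] that by blast
    have "\<forall>\<^sub>F \<tau> in ?F. \<forall>a\<in>UNIV. \<bar>f \<tau> a - 2\<bar> < r" using w0 r unfolding unif_null_def by blast
    thus "\<forall>\<^sub>F \<tau> in ?F.
        G \<tau> \<inter> {q + h *\<^sub>R axis 2 1 | q h. q \<in> D \<and> \<bar>h\<bar> < r} = (\<Union>i<(1::nat). (\<lambda>q. q + W \<tau> q *\<^sub>R axis 2 1) ` D) \<and>
        (\<forall>q\<in>D. inj_on (\<lambda>i. W \<tau> q) {..<1::nat}) \<and>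
        (\<forall>i<1::nat. \<forall>is. set is \<subseteq> - {2} \<longrightarrow>
           (\<forall>q\<in>D. partials is (W \<tau>) differentiable (at q within {q. q $ 2 = 2})))"
      using eventually_at_left_2
    proof eventually_elim
      case (elim \<tau>)
      hence \<tau>: "0 < \<tau>" "\<tau> < 2" by auto
      let ?tube = "{q + h *\<^sub>R axis 2 1 | q h. q \<in> D \<and> \<bar>h\<bar> < r}"
      have "G \<tau> \<inter> ?tube = (\<lambda>q. q + W \<tau> q *\<^sub>R axis 2 1) ` D"
      proof (intro equalityI subsetI)
        fix z assume "z \<in> G \<tau> \<inter> ?tube"
        then obtain q h where q: "q \<in> D" "z = q + h *\<^sub>R axis 2 1" and z: "z $ 2 = f \<tau> (z $ 1)"
          unfolding G[OF \<tau>] in_graph_iff[symmetric] by blast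
        have "2 + h = f \<tau> (q $ 1)" using z D2[OF q(1)] by (simp add: q(2) axis_def)
        hence "h = W \<tau> q" by (simp add: W_def)
        thus "z \<in> (\<lambda>q. q + W \<tau> q *\<^sub>R axis 2 1) ` D" using q by blast
      next
        fix z assume "z \<in> (\<lambda>q. q + W \<tau> q *\<^sub>R axis 2 1) ` D"
        then obtain q where q: "q \<in> D" "z = q + W \<tau> q *\<^sub>R axis 2 1" by blast
        have "z $ 2 = f \<tau> (z $ 1)" using D2[OF q(1)] by (simp add: q(2) axis_def W_def)
        moreover have "\<bar>W \<tau> q\<bar> < r" using elim(1) by (simp add: W_def)
        ultimately show "z \<in> G \<tau> \<inter> ?tube"
          unfolding G[OF \<tau>] in_graph_iff[symmetric] using q by blast
      qed
      moreover have "partials is (W \<tau>) differentiable (at q within {q. q $ 2 = 2})" for "is" q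
        by (rule differentiable_at_withinI, rule partials_differentiable[OF open_UNIV reaper_profile_jets[OF prof[OF \<tau>] \<tau>(1)], where m=1])
           (simp_all add: W_def)
      moreover have one: "{..<1::nat} = {0}" by auto
      ultimately show ?case unfolding one by simp
    qed
  next
    fix D :: "(real^3) set" and i :: nat and "is" :: "3 list"
    show "uniform_limit D (\<lambda>\<tau>. partials is (W \<tau>)) (\<lambda>_. 0) ?F"
      by (rule partials_uniform_limit_zero[OF open_UNIV jets, where m=1]) (simp_all add: W_def)
  qed
qed


section \<open>Convergence to a double plane\<close>

locale half_period =
  fixes y0 T :: real and f p :: "real \<Rightarrow> real"
  assumes profile: "reaper_profile y0 f p T" and y0: "0 < y0" "y0 < 2"
begin

lemmas props = reaper_profileD[OF profile]

lemma f_pos: "f a > 0"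
  using props(4)[of a] y0 by simp

lemma continuous_f: "continuous_on A f"
  by (intro continuous_at_imp_continuous_on ballI DERIV_isCont[OF props(1)])

lemma f_strict_mono: "0 \<le> a \<Longrightarrow> a < b \<Longrightarrow> b \<le> T \<Longrightarrow> f a < f b"
proof (rule DERIV_pos_imp_increasing_open[OF _ _ continuous_f])
  fix s assume "0 \<le> a" "b \<le> T" "a < s" "s < b"
  hence "p s > 0" by (intro props(10)) auto
  thus "\<exists>z. (f has_real_derivative z) (at s) \<and> z > 0" using props(1) by blast
qed

lemma f_mono: "0 \<le> a \<Longrightarrow> a \<le> b \<Longrightarrow> b \<le> T \<Longrightarrow> f a \<le> f b"
  using f_strict_mono[of a b] by (cases "a = b") auto

lemma mu_top: "mu (f T) = mu y0"
  using props(3)[of T] props(9) mu_pos[OF f_pos] mu_pos[OF y0(1)] by (simp add: power2_eq_iff_nonneg less_imp_le)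

lemma top_ge: "f T \<ge> 2"
proof (rule ccontr)
  assume "\<not> 2 \<le> f T"
  hence "mu (f T) < mu y0" using f_strict_mono[of 0 T] props(7,8) y0 by (intro mu_strict_antimono) auto
  thus False by (simp add: mu_top)
qed

lemma top_ge_mu: "mu y0 \<le> exp 1 * f T"
  using mu_le[OF top_ge] by (simp add: mu_top)

lemma p_0: "p 0 = 0"
  using props(3)[of 0] mu_pos[OF y0(1)] by (simp add: props(7))

text \<open>
  Where \<open>mu (f a)\<close> is small compared with \<open>mu y0\<close>, the first integral makes the graph steep.
\<close>

lemma steep:
  assumes "0 < a" "a < T" and K: "K > 0" "mu (f a) * (K + 1) \<le> mu y0"
  shows "K \<le> p a"
proof -
  have m: "mu (f a) > 0" by (rule mu_pos[OF f_pos])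
  have "(mu (f a) * (K + 1))\<^sup>2 \<le> (mu y0)\<^sup>2" using K m by (intro power_mono) auto
  hence "(K + 1)\<^sup>2 * (mu (f a))\<^sup>2 \<le> (1 + (p a)\<^sup>2) * (mu (f a))\<^sup>2"
    unfolding props(3) by (simp add: power_mult_distrib mult.commute)
  hence "(K + 1)\<^sup>2 \<le> 1 + (p a)\<^sup>2" using m by simp
  hence "K\<^sup>2 \<le> (p a)\<^sup>2" using K(1) by (simp add: power2_sum)
  thus ?thesis by (rule power2_le_imp_le) (simp add: props(10) assms less_imp_le)
qed

text \<open>
  The half period is at least proportional to the maximum \<open>f T\<close>: \<open>mu y \<ge> y\<close> and the first integral bound
  \<open>(f\<^sup>2)' = 2 f p\<close> by \<open>2 mu y0\<close>, and \<open>mu y0 = mu (f T)\<close> is at most \<open>exp 1 * f T\<close>.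
\<close>

lemma half_period_ge: "(f T - 2) / (2 * exp 1) \<le> T"
proof -
  define N where "N = f T"
  have N: "N \<ge> 2" using top_ge by (simp add: N_def)
  have "(f T)\<^sup>2 - 2 * exp 1 * N * T \<le> (f 0)\<^sup>2 - 2 * exp 1 * N * 0"
  proof (rule DERIV_nonpos_imp_nonincreasing[where f="\<lambda>a. (f a)\<^sup>2 - 2 * exp 1 * N * a"])
    fix a :: real
    have "f a * p a \<le> exp 1 * N"
    proof -
      have "(p a * mu (f a))\<^sup>2 \<le> (mu y0)\<^sup>2"
        unfolding props(3)[of a, symmetric] by (simp add: power_mult_distrib distrib_right)
      hence "p a * mu (f a) \<le> mu y0" using mu_pos[OF y0(1)] by (meson less_imp_le power2_le_imp_le)
      moreover have "f a * p a \<le> mu (f a) * p a \<or> f a * p a \<le> 0"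
      proof (cases "p a \<ge> 0")
        case True
        thus ?thesis using mu_ge[OF f_pos, of a] by (simp add: mult_right_mono)
      next
        case False
        thus ?thesis using f_pos[of a] by (simp add: mult_nonneg_nonpos)
      qed
      moreover have "0 \<le> exp 1 * N" using N by simp
      ultimately show ?thesis using top_ge_mu by (auto simp: N_def mult.commute)
    qed
    moreover have "((\<lambda>a. (f a)\<^sup>2 - 2 * exp 1 * N * a) has_real_derivative 2 * (f a * p a) - 2 * exp 1 * N) (at a)"
      using props(1)[of a] by (auto intro!: derivative_eq_intros)
    ultimately show "\<exists>z. ((\<lambda>a. (f a)\<^sup>2 - 2 * exp 1 * N * a) has_real_derivative z) (at a) \<and> z \<le> 0"
      by (intro exI conjI) auto
  qed (use props(8) in simp)
  hence "N * N \<le> y0 * y0 + 2 * exp 1 * N * T" by (simp add: props(7) N_def power2_eq_square)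
  also have "y0 * y0 \<le> 2 * N" using y0 N by (intro mult_mono) auto
  finally have "N * N \<le> N * (2 + 2 * exp 1 * T)" by (simp add: algebra_simps)
  hence "N \<le> 2 + 2 * exp 1 * T" using N by simp
  thus ?thesis by (simp add: N_def divide_le_eq algebra_simps)
qed

text \<open>
  The inverse of \<open>f\<close> on the rising half period. In a tube around the plane \<open>x = 0\<close> of radius at most the half
  period, the part of the surface at heights between \<open>y0\<close> and \<open>f T\<close> consists of the two graphs \<open>x = sheet y\<close> and \<open>x = - sheet y\<close>.
\<close>

definition sheet :: "real \<Rightarrow> real" where
  "sheet y = (SOME a. 0 < a \<and> a < T \<and> f a = y)"

lemma sheet:
  assumes "y0 < y" "y < f T"
  shows "0 < sheet y" "sheet y < T" "f (sheet y) = y"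
proof -
  obtain a where a: "0 \<le> a" "a \<le> T" "f a = y"
    using IVT'[of f 0 y T] assms props(7,8) continuous_f by auto
  have "a \<noteq> 0" "a \<noteq> T" using a assms props(7) by auto
  hence "\<exists>a. 0 < a \<and> a < T \<and> f a = y" using a by (intro exI[of _ a]) auto
  from someI_ex[OF this] show "0 < sheet y" "sheet y < T" "f (sheet y) = y"
    unfolding sheet_def by auto
qed

lemma f_eqD: "0 \<le> a \<Longrightarrow> a \<le> T \<Longrightarrow> 0 \<le> b \<Longrightarrow> b \<le> T \<Longrightarrow> f a = f b \<Longrightarrow> a = b"
  using f_strict_mono[of a b] f_strict_mono[of b a] by (cases a b rule: linorder_cases) auto

lemma sheet_unique:
  assumes "0 < a" "a < T"
  shows "sheet (f a) = a"
proof -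
  have "y0 < f a" "f a < f T" using f_strict_mono[of 0 a] f_strict_mono[of a T] assms props(7) by auto
  note s = sheet[OF this]
  show ?thesis by (rule f_eqD) (use s assms in auto)
qed

lemma sheet_deriv:
  assumes "y0 < y" "y < f T"
  shows "(sheet has_real_derivative 1 / p (sheet y)) (at y)"
proof -
  note s = sheet[OF assms]
  define e where "e = min (sheet y) (T - sheet y) / 2"
  have e: "e > 0" using s by (simp add: e_def)
  have "isCont sheet (f (sheet y))"
  proof (rule isCont_inverse_function[where d=e and f=f])
    fix z assume z: "\<bar>z - sheet y\<bar> \<le> e"
    have e': "e < sheet y" "e < T - sheet y" using s(1,2) by (auto simp: e_def min_def)
    have "sheet y - e \<le> z" "z \<le> sheet y + e" using z by (auto simp: abs_le_iff)
    hence "0 < z" "z < T" using e' by linarith+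
    thus "sheet (f z) = z" by (rule sheet_unique)
  qed (use e DERIV_isCont[OF props(1)] in auto)
  hence cont: "isCont sheet y" by (simp add: s)
  have "(sheet has_real_derivative inverse (p (sheet y))) (at y)"
  proof (rule DERIV_inverse_function[OF props(1) _ assms _ cont])
    show "p (sheet y) \<noteq> 0" using props(10)[OF s(1,2)] by simp
    fix z assume "y0 < z" "z < f T"
    thus "f (sheet z) = z" by (rule sheet)
  qed
  thus ?thesis by (simp add: inverse_eq_divide)
qed

lemma sheet_slope_deriv:
  assumes "y0 < y" "y < f T"
  shows "((\<lambda>y. 1 / p (sheet y)) has_real_derivative
           (1 / y - 2 / y\<^sup>2) * (1 / p (sheet y) * (1 + (1 / p (sheet y))\<^sup>2))) (at y)"
proof -
  note s = sheet[OF assms]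
  have y: "y > 0" using assms y0 by simp
  have "((\<lambda>y. p (sheet y)) has_real_derivative
     (1 + (p (sheet y))\<^sup>2) * (2 / f (sheet y) - 1) / f (sheet y) * (1 / p (sheet y))) (at y)"
    by (rule DERIV_chain2[OF props(2) sheet_deriv[OF assms]])
  note dp = this[unfolded s(3)]
  define P where "P = p (sheet y)"
  have P: "P > 0" unfolding P_def by (rule props(10)[OF s(1,2)])
  have "(0 * P - 1 * ((1 + P\<^sup>2) * (2 / y - 1) / y * (1 / P))) / (P * P)
      = (1 / y - 2 / y\<^sup>2) * (1 / P * (1 + (1 / P)\<^sup>2))"
    using P y by (simp add: field_simps power2_eq_square)
  thus ?thesis
    using DERIV_divide[OF DERIV_const[of 1] dp] P unfolding P_def by (simp del: times_divide_eq_right)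
qed

text \<open>
  Near its minimum the graph is strongly convex: at heights up to \<open>c \<le> 1\<close> one has
  \<open>f'' \<ge> (2 / f - 1) / f \<ge> 1 / c\<^sup>2\<close>. Hence it climbs to the height \<open>c\<close> within the horizontal distance
  \<open>2 * c\<close>, whatever the value of \<open>y0 < c\<close>.
\<close>

lemma sheet_small:
  assumes c: "y0 < c" "c \<le> 1"
  shows "sheet c \<le> 2 * c"
proof -
  have c0: "c > 0" using c y0 by simp
  have "c < f T" using top_ge c by simp
  note s = sheet[OF c(1) this]
  define k where "k = 1 / c\<^sup>2"
  have fle: "f a \<le> c" if "0 \<le> a" "a \<le> sheet c" for a
    using f_mono[of a "sheet c"] that s by simp
  have pk: "k * a \<le> p a" if a: "0 \<le> a" "a \<le> sheet c" for a
  proof -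
    have "p 0 - k * 0 \<le> p a - k * a"
    proof (rule DERIV_nonneg_imp_nondecreasing[where f="\<lambda>a. p a - k * a", OF a(1)])
      fix r assume r: "0 \<le> r" "r \<le> a"
      have fc: "f r \<le> c" using fle r a by simp
      have "k \<le> 1 / (f r)\<^sup>2" unfolding k_def
        using fc f_pos[of r] by (intro divide_left_mono power_mono) auto
      also have "\<dots> = (1 / f r) / f r" by (simp add: power2_eq_square)
      also have "\<dots> \<le> (2 / f r - 1) / f r"
        using fc c f_pos[of r] by (intro divide_right_mono) (auto simp: field_simps)
      also have "\<dots> = 1 * ((2 / f r - 1) / f r)" by simp
      also have "\<dots> \<le> (1 + (p r)\<^sup>2) * ((2 / f r - 1) / f r)"
        using fc c f_pos[of r] by (intro mult_right_mono divide_nonneg_pos) (auto simp: field_simps)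
      finally have "0 \<le> (1 + (p r)\<^sup>2) * (2 / f r - 1) / f r - k" by simp
      moreover have "((\<lambda>a. p a - k * a) has_real_derivative (1 + (p r)\<^sup>2) * (2 / f r - 1) / f r - k) (at r)"
        using DERIV_diff[OF props(2) DERIV_cmult_Id[of k]] by simp
      ultimately show "\<exists>z. ((\<lambda>a. p a - k * a) has_real_derivative z) (at r) \<and> 0 \<le> z" by blast
    qed
    thus ?thesis by (simp add: p_0)
  qed
  have "f 0 - k / 2 * 0\<^sup>2 \<le> f (sheet c) - k / 2 * (sheet c)\<^sup>2"
  proof (rule DERIV_nonneg_imp_nondecreasing[where f="\<lambda>a. f a - k / 2 * a\<^sup>2"])
    fix r assume r: "0 \<le> r" "r \<le> sheet c"
    have "((\<lambda>a. f a - k / 2 * a\<^sup>2) has_real_derivative p r - k * r) (at r)"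
      using props(1)[of r] by (auto intro!: derivative_eq_intros)
    thus "\<exists>z. ((\<lambda>a. f a - k / 2 * a\<^sup>2) has_real_derivative z) (at r) \<and> 0 \<le> z" using pk[OF r] by force
  qed (use s in simp)
  hence "k / 2 * (sheet c)\<^sup>2 \<le> c" using s(3) props(7) y0 by simp
  hence "(sheet c)\<^sup>2 \<le> 2 * c * c\<^sup>2" using c0 by (simp add: k_def field_simps)
  also have "\<dots> \<le> (2 * c)\<^sup>2" using c c0 by (simp add: power2_eq_square mult_left_le_one_le)
  finally show ?thesis by (rule power2_le_imp_le) (use c0 in simp)
qed

lemma mu_le_on: "0 < c \<Longrightarrow> c \<le> y \<Longrightarrow> y \<le> b \<Longrightarrow> mu y \<le> b * exp (2 / c)"
  unfolding mu_def by (intro mult_mono) (auto intro: divide_left_mono)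

text \<open>
  Above the height \<open>c\<close> the slope is at least \<open>K\<close>, so climbing on to \<open>y \<le> b\<close> costs at most \<open>b / K\<close>.
\<close>

lemma sheet_le:
  assumes c: "y0 < c" "c \<le> 1" and K: "K > 0" and b: "c \<le> b" "b < f T"
    and big: "b * exp (2 / c) * (K + 1) \<le> mu y0" and y: "y0 < y" "y \<le> b"
  shows "sheet y \<le> 2 * c + b / K"
proof -
  have c0: "c > 0" using c y0 by simp
  have cT: "c < f T" using b by simp
  note sc = sheet[OF c(1) cT]
  have small: "sheet c \<le> 2 * c" by (rule sheet_small[OF c])
  have yT: "y < f T" using y b by simp
  note sy = sheet[OF y(1) yT]
  show ?thesis
  proof (cases "sheet y \<le> sheet c")
    case True
    thus ?thesis using small b K c0 by (smt (verit) divide_nonneg_pos)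
  next
    case False
    have "f (sheet c) - K * sheet c \<le> f (sheet y) - K * sheet y"
    proof (rule DERIV_nonneg_imp_nondecreasing[where f="\<lambda>a. f a - K * a"])
      fix r assume r: "sheet c \<le> r" "r \<le> sheet y"
      have "f (sheet c) \<le> f r" "f r \<le> f (sheet y)"
        using r sc(1,2) sy(1,2) by (auto intro!: f_mono)
      hence "mu (f r) \<le> b * exp (2 / c)" using sc sy y by (intro mu_le_on[OF c0]) auto
      hence "mu (f r) * (K + 1) \<le> mu y0" using K by (intro order_trans[OF mult_right_mono big]) auto
      hence "K \<le> p r" using r sc sy K by (intro steep) auto
      moreover have "((\<lambda>a. f a - K * a) has_real_derivative p r - K) (at r)"
        using DERIV_diff[OF props(1) DERIV_cmult_Id[of K]] by simp
      ultimately show "\<exists>z. ((\<lambda>a. f a - K * a) has_real_derivative z) (at r) \<and> 0 \<le> z" by force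
    qed (use False in simp)
    hence "K * (sheet y - sheet c) \<le> b" using sc sy y c0 by (simp add: algebra_simps)
    hence "sheet y - sheet c \<le> b / K" using K by (simp add: field_simps)
    thus ?thesis using small by simp
  qed
qed

lemma mem_graph_iff_sheet:
  assumes "y0 < y" "y < f T" "\<bar>h\<bar> < T"
  shows "y = f h \<longleftrightarrow> \<bar>h\<bar> = sheet y"
proof -
  have even: "f h = f \<bar>h\<bar>" using props(5)[of h] by (simp add: abs_if)
  note s = sheet[OF assms(1,2)]
  show ?thesis
  proof
    assume "y = f h"
    hence "f \<bar>h\<bar> = f (sheet y)" using even s(3) by simp
    from f_eqD[OF _ _ _ _ this] show "\<bar>h\<bar> = sheet y" using s(1,2) assms(3) by simp
  next
    assume "\<bar>h\<bar> = sheet y"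
    hence "f h = f (sheet y)" using even by simp
    thus "y = f h" using s(3) by simp
  qed
qed

end

lemma bounded_part_of_half_plane:
  assumes "bounded D" "closure D \<subseteq> H2xR"
  obtains a b where "0 < a" "a < b" "\<And>q. q \<in> D \<Longrightarrow> a < q $ 2 \<and> q $ 2 < b"
proof (cases "D = {}")
  case True
  thus ?thesis using that[of 1 2] by simp
next
  case False
  have "compact (closure D)" using assms(1) by (simp add: compact_closure)
  moreover have "continuous_on (closure D) (\<lambda>q. q $ 2)" by (intro continuous_intros)
  ultimately obtain q0 where q0: "q0 \<in> closure D" "\<And>q. q \<in> closure D \<Longrightarrow> q0 $ 2 \<le> q $ 2"
    using continuous_attains_inf[of "closure D" "\<lambda>q. q $ 2"] False by auto
  obtain M where M: "\<And>q. q \<in> D \<Longrightarrow> norm q \<le> M" using assms(1) unfolding bounded_iff by blast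
  define a b where "a = q0 $ 2 / 2" and "b = max M a + 1"
  have a: "0 < a" using q0(1) assms(2) by (auto simp: a_def H2xR_def)
  have "a < q $ 2 \<and> q $ 2 < b" if q: "q \<in> D" for q
  proof -
    have "q0 $ 2 \<le> q $ 2" using q0(2) closure_subset q by blast
    moreover have "q $ 2 \<le> M" using M[OF q] component_le_norm_cart[of q 2] by simp
    ultimately show ?thesis using a unfolding a_def b_def by linarith
  qed
  thus ?thesis using that[of a b] a by (simp add: b_def)
qed

text \<open>
  As \<open>\<tau>\<close> tends to \<open>0\<close>, \<open>mu \<tau>\<close> tends to infinity, and with it the maximum and the half period; therefore only
  the two sheets next to the minimum at \<open>x = 0\<close> stay in a given tube. Between two fixed positive heights they tend
  to the plane together with their slopes \<open>1 / p\<close>, hence with all derivatives.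
\<close>

theorem converges_to_double_plane:
  assumes prof: "\<And>\<tau>. 0 < \<tau> \<Longrightarrow> \<tau> < 2 \<Longrightarrow> reaper_profile \<tau> (f \<tau>) (p \<tau>) (T \<tau>)"
    and G: "\<And>\<tau>. 0 < \<tau> \<Longrightarrow> \<tau> < 2 \<Longrightarrow> G \<tau> = range (cylinder (\<lambda>s. s) (f \<tau>))"
  shows "converges_to_plane 2 G 1 0 (at_right 0)"
proof -
  let ?F = "at_right (0::real)"
  have hp: "half_period \<tau> (T \<tau>) (f \<tau>) (p \<tau>)" if "0 < \<tau>" "\<tau> < 2" for \<tau>
    by unfold_locales (use prof[OF that] that in auto)
  have small: "\<forall>\<^sub>F \<tau> in ?F. 0 < \<tau> \<and> \<tau> < c" if "c > 0" for c
    using that by (intro eventually_at_rightI[of 0 c]) auto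
  have large: "\<forall>\<^sub>F \<tau> in ?F. k \<le> mu \<tau>" for k
  proof -
    have "2 / (\<bar>k\<bar> + 1) > 0" by (simp add: add_nonneg_pos)
    from small[OF this] show ?thesis
    proof eventually_elim
      case (elim \<tau>)
      have "\<tau> * (\<bar>k\<bar> + 1) < 2" using elim by (simp add: less_divide_eq add_nonneg_pos)
      hence "\<bar>k\<bar> + 1 \<le> 2 / \<tau>" using elim by (simp add: le_divide_eq mult.commute)
      also have "\<dots> \<le> mu \<tau>" using elim by (intro mu_ge_inverse) simp
      finally show ?case by simp
    qed
  qed
  have small2: "\<forall>\<^sub>F \<tau> in ?F. 0 < \<tau> \<and> \<tau> < 2" by (rule small) simp
  have tall: "\<forall>\<^sub>F \<tau> in ?F. k < f \<tau> (T \<tau>)" for k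
    using large[of "exp 1 * (k + 1)"] small2
  proof eventually_elim
    case (elim \<tau>)
    hence "exp 1 * (k + 1) \<le> exp 1 * f \<tau> (T \<tau>)"
      using half_period.top_ge_mu[OF hp, of \<tau>] by linarith
    hence "k + 1 \<le> f \<tau> (T \<tau>)" by simp
    thus ?case by simp
  qed
  have long: "\<forall>\<^sub>F \<tau> in ?F. k \<le> T \<tau>" for k
    using tall[of "2 + k * (2 * exp 1)"] small2
  proof eventually_elim
    case (elim \<tau>)
    hence "k \<le> (f \<tau> (T \<tau>) - 2) / (2 * exp 1)" by (simp add: le_divide_eq)
    thus ?case using half_period.half_period_ge[OF hp, of \<tau>] elim by linarith
  qed
  define X where "X \<tau> = half_period.sheet (T \<tau>) (f \<tau>)" for \<tau>
  define W where "W i \<tau> q = (if i = 0 then 1 else - 1) * X \<tau> (q $ 2)" for i :: nat and \<tau> and q :: "real^3"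
  have sheet_ode: "(X \<tau> has_real_derivative 1 / p \<tau> (X \<tau> y)) (at y) \<and>
      ((\<lambda>y. 1 / p \<tau> (X \<tau> y)) has_real_derivative
        (1 / y - 2 / y\<^sup>2) * (1 / p \<tau> (X \<tau> y) * (1 + (1 / p \<tau> (X \<tau> y))\<^sup>2))) (at y)"
    if "0 < \<tau>" "\<tau> < 2" "\<tau> < y" "y < f \<tau> (T \<tau>)" for \<tau> y
    unfolding X_def
    by (intro conjI half_period.sheet_deriv[OF hp[OF that(1,2)] that(3,4)]
        half_period.sheet_slope_deriv[OF hp[OF that(1,2)] that(3,4)])
  have smooth: "jet (\<lambda>_. True) (principal {\<tau>}) {a<..<b} n (\<lambda>\<tau> y. k * X \<tau> y)"
    if ab: "0 < a" and \<tau>: "0 < \<tau>" "\<tau> < 2" "\<tau> < a" "b < f \<tau> (T \<tau>)" for a b \<tau> k n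
  proof -
    interpret jet_ideal "\<lambda>_. True" "\<lambda>_. True" by (rule jet_ideal_smooth)
    have "jet (\<lambda>_. True) (principal {\<tau>}) {a<..<b} n X"
      by (rule jet_sheet[where u="\<lambda>\<tau> y. 1 / p \<tau> (X \<tau> y)"])
         (use ab \<tau> sheet_ode in \<open>simp_all add: eventually_principal\<close>)
    thus ?thesis by (intro jet_BZ_mult jet_B_const)
  qed
  have null: "jet (unif_null ?F {a<..<b}) ?F {a<..<b} n (\<lambda>\<tau> y. k * X \<tau> y)"
    if ab: "0 < a" "a < b" for a b k n
  proof -
    interpret jet_ideal "unif_bounded ?F {a<..<b}" "unif_null ?F {a<..<b}" by (rule jet_ideal_null)
    let ?u = "\<lambda>\<tau> y. 1 / p \<tau> (X \<tau> y)"
    have X0: "unif_null ?F {a<..<b} X"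
      unfolding unif_null_def
    proof (intro allI impI)
      fix e :: real assume e: "e > 0"
      \<comment> \<open>of the error \<open>e\<close>, \<open>2 * c\<close> uses at most one half and \<open>b / K\<close> one quarter\<close>
      define c where "c = min (min (a / 2) 1) (e / 4)"
      define K where "K = 4 * b / e"
      have c: "0 < c" "c \<le> 1" "c \<le> b" "c \<le> a" "c \<le> e / 4" using ab e by (auto simp: c_def)
      have K: "0 < K" "b / K = e / 4" using ab e by (auto simp: K_def)
      show "\<forall>\<^sub>F \<tau> in ?F. \<forall>y\<in>{a<..<b}. \<bar>X \<tau> y\<bar> < e"
        using small[OF c(1)] small2 tall[of b] large[of "b * exp (2 / c) * (K + 1)"]
      proof eventually_elim
        case (elim \<tau>)
        hence \<tau>: "0 < \<tau>" "\<tau> < 2" by auto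
        interpret o: half_period \<tau> "T \<tau>" "f \<tau>" "p \<tau>" by (rule hp[OF \<tau>])
        show ?case
        proof
          fix y assume y: "y \<in> {a<..<b}"
          hence \<tau>y: "\<tau> < y" "y < f \<tau> (T \<tau>)" using elim c by auto
          have "X \<tau> y \<le> 2 * c + b / K"
            unfolding X_def by (rule o.sheet_le) (use elim c K y \<tau>y in auto)
          also have "\<dots> < e" using c K e by simp
          finally show "\<bar>X \<tau> y\<bar> < e" using o.sheet(1)[OF \<tau>y] by (simp add: X_def)
        qed
      qed
    qed
    have u0: "unif_null ?F {a<..<b} ?u"
      unfolding unif_null_def
    proof (intro allI impI)
      fix e :: real assume e: "e > 0"
      define K where "K = 2 / e"
      have K: "K > 0" "1 / K = e / 2" using e by (auto simp: K_def)
      show "\<forall>\<^sub>F \<tau> in ?F. \<forall>y\<in>{a<..<b}. \<bar>?u \<tau> y\<bar> < e"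
        using small[OF ab(1)] small2 tall[of b] large[of "b * exp (2 / a) * (K + 1)"]
      proof eventually_elim
        case (elim \<tau>)
        hence \<tau>: "0 < \<tau>" "\<tau> < 2" by auto
        interpret o: half_period \<tau> "T \<tau>" "f \<tau>" "p \<tau>" by (rule hp[OF \<tau>])
        show ?case
        proof
          fix y assume y: "y \<in> {a<..<b}"
          hence \<tau>y: "\<tau> < y" "y < f \<tau> (T \<tau>)" using elim by auto
          note s = o.sheet[OF \<tau>y]
          have "mu y * (K + 1) \<le> b * exp (2 / a) * (K + 1)"
            using y K by (intro mult_right_mono o.mu_le_on[OF ab(1)]) auto
          hence "mu (f \<tau> (o.sheet y)) * (K + 1) \<le> mu \<tau>" using elim s(3) by simp
          from o.steep[OF s(1,2) K(1) this] have le: "K \<le> p \<tau> (X \<tau> y)" by (simp add: X_def)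
          hence "1 / p \<tau> (X \<tau> y) \<le> 1 / K" using K by (intro divide_left_mono) auto
          also have "\<dots> < e" using K e by simp
          finally show "\<bar>?u \<tau> y\<bar> < e" using le K by simp
        qed
      qed
    qed
    have v0: "unif_bounded ?F {a<..<b} (\<lambda>_ y. 1 / y)"
      unfolding unif_bounded_def
      by (intro exI[of _ "1 / a"] always_eventually allI ballI) (use ab in \<open>auto simp: frac_le\<close>)
    have "\<forall>\<^sub>F \<tau> in ?F. \<forall>y\<in>{a<..<b}. (X \<tau> has_real_derivative ?u \<tau> y) (at y) \<and>
      (?u \<tau> has_real_derivative (1 / y - 2 / y\<^sup>2) * (?u \<tau> y * (1 + (?u \<tau> y)\<^sup>2))) (at y)"
      using small[OF ab(1)] small2 tall[of b]
    proof eventually_elim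
      case (elim \<tau>)
      show ?case by (intro ballI sheet_ode) (use elim in auto)
    qed
    from jet_sheet[OF this _ X0 u0 v0] ab have "jet (unif_null ?F {a<..<b}) ?F {a<..<b} n X" by simp
    thus ?thesis by (intro jet_BZ_mult jet_B_const)
  qed
  show ?thesis
    unfolding converges_to_plane_def
  proof (intro allI impI, rule exI[of _ W], rule conjI)
    fix D :: "(real^3) set" and r :: real
    assume D: "openin (top_of_set {p. p $ 1 = 0}) D" "bounded D" "closure D \<subseteq> H2xR" and r: "r > 0"
    have D1: "q $ 1 = 0" if "q \<in> D" for q using openin_imp_subset[OF D(1)] that by blast
    obtain a b where ab: "0 < a" "a < b" and ab': "\<And>q. q \<in> D \<Longrightarrow> a < q $ 2 \<and> q $ 2 < b"
      using bounded_part_of_half_plane[OF D(2,3)] by blast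
    have D2: "q $ 2 \<in> {a<..<b}" if "q \<in> D" for q using ab'[OF that] by simp
    have "unif_null ?F {a<..<b} (\<lambda>\<tau> y. 1 * X \<tau> y)" using null[OF ab, of 0 1] by simp
    hence "\<forall>\<^sub>F \<tau> in ?F. \<forall>y\<in>{a<..<b}. \<bar>1 * X \<tau> y\<bar> < r" using r unfolding unif_null_def by blast
    thus "\<forall>\<^sub>F \<tau> in ?F.
        G \<tau> \<inter> {q + h *\<^sub>R axis 1 1 | q h. q \<in> D \<and> \<bar>h\<bar> < r} = (\<Union>i<2. (\<lambda>q. q + W i \<tau> q *\<^sub>R axis 1 1) ` D) \<and>
        (\<forall>q\<in>D. inj_on (\<lambda>i. W i \<tau> q) {..<2}) \<and>
        (\<forall>i<2. \<forall>is. set is \<subseteq> - {1} \<longrightarrow>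
           (\<forall>q\<in>D. partials is (W i \<tau>) differentiable (at q within {q. q $ 1 = 0})))"
      using long[of r] small[OF ab(1)] small2 tall[of b]
    proof eventually_elim
      case (elim \<tau>)
      hence \<tau>: "0 < \<tau>" "\<tau> < 2" by auto
      interpret o: half_period \<tau> "T \<tau>" "f \<tau>" "p \<tau>" by (rule hp[OF \<tau>])
      have range: "\<tau> < q $ 2" "q $ 2 < f \<tau> (T \<tau>)" if "q \<in> D" for q using D2[OF that] elim by auto
      have Xlt: "X \<tau> (q $ 2) < r" if "q \<in> D" for q using elim(1) D2[OF that] by fastforce
      have Xpos: "X \<tau> (q $ 2) > 0" if "q \<in> D" for q
        unfolding X_def by (rule o.sheet(1)[OF range[OF that]])
      have two: "{..<2::nat} = {0, 1}" by auto
      let ?tube = "{q + h *\<^sub>R axis 1 1 | q h. q \<in> D \<and> \<bar>h\<bar> < r}" and ?sheets = "\<Union>i<2. (\<lambda>q. q + W i \<tau> q *\<^sub>R axis 1 1) ` D"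
      have "G \<tau> \<inter> ?tube = ?sheets"
      proof (intro equalityI subsetI)
        fix z assume "z \<in> G \<tau> \<inter> ?tube"
        then obtain q h where q: "q \<in> D" "z = q + h *\<^sub>R axis 1 1" "\<bar>h\<bar> < r" and z: "z $ 2 = f \<tau> (z $ 1)"
          unfolding G[OF \<tau>] in_graph_iff[symmetric] by blast
        have "q $ 2 = f \<tau> h" using z D1[OF q(1)] by (simp add: q(2) axis_def)
        moreover have "\<bar>h\<bar> < T \<tau>" using q(3) elim(2) by simp
        ultimately have "\<bar>h\<bar> = X \<tau> (q $ 2)"
          using o.mem_graph_iff_sheet[OF range[OF q(1)], of h] by (simp add: X_def)
        hence "h = W 0 \<tau> q \<or> h = W 1 \<tau> q" by (auto simp: W_def)
        thus "z \<in> ?sheets" unfolding two using q by blast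
      next
        fix z assume "z \<in> ?sheets"
        then obtain i q where q: "q \<in> D" "z = q + W i \<tau> q *\<^sub>R axis 1 1" by blast
        have h: "\<bar>W i \<tau> q\<bar> = X \<tau> (q $ 2)" using Xpos[OF q(1)] by (simp add: W_def)
        have "\<bar>W i \<tau> q\<bar> < r" using h Xlt[OF q(1)] by simp
        moreover have "q $ 2 = f \<tau> (W i \<tau> q)"
          using o.mem_graph_iff_sheet[OF range[OF q(1)], of "W i \<tau> q"] h \<open>\<bar>W i \<tau> q\<bar> < r\<close> elim(2)
          by (simp add: X_def)
        hence "z $ 2 = f \<tau> (z $ 1)" using D1[OF q(1)] by (simp add: q(2) axis_def)
        ultimately show "z \<in> G \<tau> \<inter> ?tube"
          unfolding G[OF \<tau>] in_graph_iff[symmetric] using q by blast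
      qed
      moreover have "inj_on (\<lambda>i. W i \<tau> q) {..<2}" if "q \<in> D" for q
        unfolding two using Xpos[OF that] by (simp add: W_def)
      moreover have "partials is (W i \<tau>) differentiable (at q within {q. q $ 1 = 0})" if "q \<in> D" for i "is" q
      proof (rule differentiable_at_withinI, rule partials_differentiable[where J="{a<..<b}" and m=2])
        show "jet (\<lambda>_. True) (principal {\<tau>}) {a<..<b} n (\<lambda>\<tau> y. (if i = 0 then 1 else - 1) * X \<tau> y)" for n
          by (rule smooth) (use ab elim in auto)
      qed (use D2[OF that] in \<open>simp_all add: W_def\<close>)
      ultimately show ?case by blast
    qed
    show "\<forall>i<2. \<forall>is. set is \<subseteq> - {1} \<longrightarrow> uniform_limit D (\<lambda>\<tau>. partials is (W i \<tau>)) (\<lambda>_. 0) ?F"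
    proof (intro allI impI)
      fix i :: nat and "is" :: "3 list"
      show "uniform_limit D (\<lambda>\<tau>. partials is (W i \<tau>)) (\<lambda>_. 0) ?F"
        by (rule partials_uniform_limit_zero[OF _ null[OF ab], where m=2 and k2="if i = 0 then 1 else - 1"])
           (use D2 in \<open>simp_all add: W_def\<close>)
    qed
  qed
qed


section \<open>Classification of vertical grim reapers\<close>

lemma reaper_profile_smooth:
  assumes f: "reaper_profile y0 f p T" and "0 < y0"
  shows "smooth_jet n f"
proof -
  have "smooth_jet n (\<lambda>a. f a - 2)"
    unfolding smooth_jet_def by (rule reaper_profile_jets[OF assms])
  from smooth_jet_add[OF this smooth_jet_const[of n 2]] show ?thesis by simp
qed

lemma reaper_profile_imp_reaper:
  assumes f: "reaper_profile y0 f p T" and "0 < y0"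
  shows "vertical_cplus_grim_reaper UNIV (cylinder (\<lambda>s. s) f)"
proof -
  note d = reaper_profileD[OF f]
  have pos: "f a > 0" for a using d(4)[of a] assms(2) by simp
  have id: "smooth_jet n (\<lambda>s. s)" for n
    by (cases n) (auto intro!: smooth_jet_0 smooth_jet_SucI[where f'="\<lambda>_. 1"] smooth_jet_const derivative_eq_intros)
  show ?thesis
  proof (rule vertical_cplus_grim_reaper_cylinder[where x'="\<lambda>_. 1" and x''="\<lambda>_. 0",
        OF DERIV_ident DERIV_const d(1,2) id reaper_profile_smooth[OF assms] pos])
    fix s
    show "(f s)\<^sup>2 * (1 * ((1 + (p s)\<^sup>2) * (2 / f s - 1) / f s) - p s * 0)
        = 1 * (1\<^sup>2 + (p s)\<^sup>2) * (2 - f s)"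
      using pos[of s] by (simp add: field_simps power2_eq_square)
  qed simp
qed

lemma reaper_profile_periodic:
  assumes "reaper_profile y0 f p T"
  shows "translate_x (2 * T) (range (cylinder (\<lambda>s. s) f)) = range (cylinder (\<lambda>s. s) f)"
proof -
  have "range (cylinder (\<lambda>s. (s - 2 * T) + 2 * T) (\<lambda>s. f (s - 2 * T)))
      = translate_x (2 * T) (range (cylinder (\<lambda>s. s) f))"
    by (rule range_cylinder_reparam, rule surjI[of _ "\<lambda>s. s + 2 * T"]) simp
  moreover have "f (s - 2 * T) = f s" for s
    using reaper_profileD(6)[OF assms, of "s - 2 * T"] by simp
  ultimately show ?thesis by simp
qed

lemma reaper_profile_setdist:
  assumes "reaper_profile y0 f p T" "0 < y0"
  shows "setdist (range (cylinder (\<lambda>s. s) f)) {q. q $ 2 = 0} = y0"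
proof (rule antisym)
  note d = reaper_profileD[OF assms(1)]
  let ?q = "cylinder (\<lambda>s. s) f 0"
  have "setdist (range (cylinder (\<lambda>s. s) f)) {q. q $ 2 = 0} \<le> dist ?q 0"
    by (rule setdist_le_dist) auto
  also have "?q = y0 *\<^sub>R axis 2 1" by (simp add: cylinder_def d(7) vec_eq_iff forall_3 axis_def)
  hence "dist ?q 0 = y0" using assms(2) by simp
  finally show "setdist (range (cylinder (\<lambda>s. s) f)) {q. q $ 2 = 0} \<le> y0" .
  show "y0 \<le> setdist (range (cylinder (\<lambda>s. s) f)) {q. q $ 2 = 0}"
  proof (rule le_setdistI)
    fix q q' :: "real^3" assume "q \<in> range (cylinder (\<lambda>s. s) f)" "q' \<in> {q. q $ 2 = 0}"
    hence "y0 \<le> (q - q') $ 2" using d(4) by (auto simp: in_graph_iff)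
    also have "\<dots> \<le> dist q q'" using component_le_norm_cart[of "q - q'" 2] by (simp add: dist_norm)
    finally show "y0 \<le> dist q q'" .
  next
    have "(0::real^3) \<in> {q. q $ 2 = 0}" by simp
    thus "{q::real^3. q $ 2 = 0} \<noteq> {}" by blast
  qed simp
qed

theorem theorem7p2:
  shows "\<exists>G :: real \<Rightarrow> (real^3) set.
    (\<forall>y0\<in>{0<..<2}.
       (\<exists>f. vertical_cplus_grim_reaper UNIV (graph_xz f) \<and> G y0 = range (graph_xz f)) \<and>
       (\<exists>T>0. translate_x T (G y0) = G y0) \<and>
       setdist (G y0) {p. p $ 2 = 0} = y0) \<and>
    (\<exists>x0. converges_to_plane 2 G 1 x0 (at_right 0)) \<and>
    converges_to_plane 1 G 2 2 (at_left 2) \<and>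
    (\<forall>I x y \<theta>.
       open I \<longrightarrow> is_interval I \<longrightarrow> I \<noteq> {} \<longrightarrow>
       generating_curve I x y \<theta> \<longrightarrow>
       vertical_cplus_grim_reaper (strip I) (cylinder x y) \<longrightarrow>
       (\<exists>X Y \<Theta>.
          (\<forall>s\<in>I. X s = x s \<and> Y s = y s \<and> \<Theta> s = \<theta> s) \<and>
          generating_curve UNIV X Y \<Theta> \<and>
          vertical_cplus_grim_reaper UNIV (cylinder X Y) \<and>
          (range (cylinder X Y) = {p. p $ 2 = 2} \<or>
           (\<exists>x0. range (cylinder X Y) = {p \<in> H2xR. p $ 1 = x0}) \<or>
           (\<exists>y0\<in>{0<..<2}. \<exists>a. range (cylinder X Y) = translate_x a (G y0)))))"
proof -
  have "\<exists>x y \<theta> f p T. standard_orbit y0 x y \<theta> \<and> reaper_profile y0 f p T \<and>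
      range (cylinder x y) = range (cylinder (\<lambda>s. s) f)" if y0: "0 < y0" "y0 < 2" for y0
  proof -
    obtain x y \<theta> where xy: "reaper_curve UNIV x y \<theta>" "x 0 = 0" "y 0 = y0" "\<theta> 0 = 0"
      using reaper_curve_exists[OF y0] by blast
    have so: "standard_orbit y0 x y \<theta>" by unfold_locales (use xy y0 in auto)
    show ?thesis
      using so standard_orbit.profile[OF so] standard_orbit.range_cylinder[OF so] by blast
  qed
  hence "\<forall>y0. \<exists>x y \<theta> f p T. 0 < y0 \<longrightarrow> y0 < 2 \<longrightarrow> standard_orbit y0 x y \<theta> \<and> reaper_profile y0 f p T \<and>
      range (cylinder x y) = range (cylinder (\<lambda>s. s) f)" by blast
  then obtain X Y \<Theta> f p T where *: "\<forall>y0. 0 < y0 \<longrightarrow> y0 < 2 \<longrightarrow>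
      standard_orbit y0 (X y0) (Y y0) (\<Theta> y0) \<and> reaper_profile y0 (f y0) (p y0) (T y0) \<and>
      range (cylinder (X y0) (Y y0)) = range (cylinder (\<lambda>s. s) (f y0))"
    unfolding choice_iff by blast
  have orbit: "standard_orbit y0 (X y0) (Y y0) (\<Theta> y0)"
    and prof: "reaper_profile y0 (f y0) (p y0) (T y0)"
    and range: "range (cylinder (X y0) (Y y0)) = range (cylinder (\<lambda>s. s) (f y0))"
    if "0 < y0" "y0 < 2" for y0 using * that by blast+
  define G where "G y0 = range (cylinder (X y0) (Y y0))" for y0
  have graph: "(\<exists>h. vertical_cplus_grim_reaper UNIV (graph_xz h) \<and> G y0 = range (graph_xz h)) \<and>
       (\<exists>P>0. translate_x P (G y0) = G y0) \<and> setdist (G y0) {p. p $ 2 = 0} = y0"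
    if "y0 \<in> {0<..<2}" for y0
  proof -
    have y0: "0 < y0" "y0 < 2" using that by auto
    have eq: "graph_xz (\<lambda>u. f y0 (u $ 1)) = cylinder (\<lambda>s. s) (f y0)"
      by (simp add: fun_eq_iff graph_xz_def cylinder_def)
    have "vertical_cplus_grim_reaper UNIV (graph_xz (\<lambda>u. f y0 (u $ 1)))"
      unfolding eq by (rule reaper_profile_imp_reaper[OF prof[OF y0] y0(1)])
    moreover have "G y0 = range (graph_xz (\<lambda>u. f y0 (u $ 1)))"
      unfolding eq G_def by (rule range[OF y0])
    moreover have "2 * T y0 > 0" using reaper_profileD(8)[OF prof[OF y0]] by simp
    moreover have "translate_x (2 * T y0) (G y0) = G y0"
      unfolding G_def range[OF y0] by (rule reaper_profile_periodic[OF prof[OF y0]])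
    moreover have "setdist (G y0) {p. p $ 2 = 0} = y0"
      unfolding G_def range[OF y0] by (rule reaper_profile_setdist[OF prof[OF y0] y0(1)])
    ultimately show ?thesis by blast
  qed
  have double: "converges_to_plane 2 G 1 0 (at_right 0)"
    by (rule converges_to_double_plane[OF prof]) (simp_all add: G_def range)
  have single: "converges_to_plane 1 G 2 2 (at_left 2)"
    by (rule converges_to_horizontal_plane[OF prof]) (simp_all add: G_def range)
  have classify: "\<exists>X Y \<Theta>. (\<forall>s\<in>I. X s = x s \<and> Y s = y s \<and> \<Theta> s = \<theta> s) \<and>
          generating_curve UNIV X Y \<Theta> \<and> vertical_cplus_grim_reaper UNIV (cylinder X Y) \<and>
          (range (cylinder X Y) = {p. p $ 2 = 2} \<or>
           (\<exists>x0. range (cylinder X Y) = {p \<in> H2xR. p $ 1 = x0}) \<or>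
           (\<exists>y0\<in>{0<..<2}. \<exists>a. range (cylinder X Y) = translate_x a (G y0)))"
    if I: "open I" "is_interval I" "I \<noteq> {}" and gen: "generating_curve I x y \<theta>"
      and reap: "vertical_cplus_grim_reaper (strip I) (cylinder x y)" for I x y \<theta>
  proof -
    have curve: "reaper_curve I x y \<theta>" by (rule reaper_imp_reaper_curve[OF I(1) gen reap])
    let ?shape = "\<lambda>R. R = {p. p $ 2 = 2} \<or> (\<exists>x0. R = {p \<in> H2xR. p $ 1 = x0}) \<or>
        (\<exists>y0\<in>{0<..<2}. \<exists>a. R = translate_x a (G y0))"
    have "\<exists>X' Y' \<Theta>'. (\<forall>s\<in>I. X' s = x s \<and> Y' s = y s \<and> \<Theta>' s = \<theta> s) \<and> reaper_curve UNIV X' Y' \<Theta>' \<and>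
        ?shape (range (cylinder X' Y'))"
      unfolding G_def by (rule reaper_curve_classification[OF _ curve I(2,3)]) (rule orbit)
    then obtain X' Y' \<Theta>' where ext: "\<forall>s\<in>I. X' s = x s \<and> Y' s = y s \<and> \<Theta>' s = \<theta> s"
      and global: "reaper_curve UNIV X' Y' \<Theta>'" and shape: "?shape (range (cylinder X' Y'))"
      by (elim exE conjE) (rule that)
    show ?thesis
      by (rule exI[of _ X'], rule exI[of _ Y'], rule exI[of _ \<Theta>'], intro conjI ext shape
          reaper_curve_imp_reaper[OF global])
  qed
  show ?thesis
  proof (rule exI[of _ G], intro conjI ballI allI impI)
    show "\<exists>x0. converges_to_plane 2 G 1 x0 (at_right 0)" using double by blast
    show "converges_to_plane 1 G 2 2 (at_left 2)" by (rule single)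
  qed (use graph in blast, use graph in blast, use graph in blast, rule classify)
qed


end
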